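(* Let $r\leq 1$ be an integer coprime with $3$. Let $p>3$ be a prime such that $p\equiv -r\pmod{3}$ and $p\geq 3-r$. Then $$ \sum_{k=0}^{p-1}(6k+r)\frac{(\frac{r}{3})_k^6}{(1)_k^6}\equiv \frac{(-1)^{r+1}80rp^4}{81}\cdot\frac{\Gamma_p(1+\frac{r}{3})^2}{\Gamma_p(1+\frac{2r}{3})^3\Gamma_p(1-\frac{r}{3})^4}\sum_{k=0}^{1-r}\frac{(r-1)_k(\frac{r}{3})_k^3}{(1)_k(\frac{2r}{3})_k^3}\pmod{p^6}. $$
   Context: For $n\in\{0,1,2,\ldots\}$, $(x)_n=x(x+1)\cdots(x+n-1)$ denotes the Pochhammer symbol (with $(x)_0=1$). $\Gamma_p$ denotes Morita's $p$-adic Gamma function. The congruence is understood in $\mathbb{Z}_p$, the ring of $p$-adic integers (all quantities involved are $p$-adic integers). *)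

theory Defs
  imports Complex_Main "HOL-Number_Theory.Cong" "HOL-Computational_Algebra.Primes"
    "HOL-Algebra.Divisibility" "HOL-Algebra.Ring"
begin

hide_const (open) Divisibility.prime

text \<open>The ring of $p$-adic integers as the inverse limit of the rings $\mathbb{Z}/p^n$: an element
  is a compatible sequence of residues, the \<open>n\<close>-th one being represented in \<open>{0..<p^n}\<close>.\<close>

definition padic_ring :: "nat \<Rightarrow> (nat \<Rightarrow> int) ring" where
  "padic_ring p =
    \<lparr>carrier = {x. \<forall>n. 0 \<le> x n \<and> x n < int p ^ n \<and> x (Suc n) mod int p ^ n = x n},
     mult = (\<lambda>x y n. (x n * y n) mod int p ^ n),
     one = (\<lambda>n. 1 mod int p ^ n),
     zero = (\<lambda>n. 0),
     add = (\<lambda>x y n. (x n + y n) mod int p ^ n)\<rparr>"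

definition padic_of_int :: "nat \<Rightarrow> int \<Rightarrow> nat \<Rightarrow> int" where
  "padic_of_int p a = (\<lambda>n. a mod int p ^ n)"

text \<open>The embedding of the \<open>p\<close>-integral rationals. It is meaningful only when \<open>p\<close> does not divide
  the reduced denominator, since otherwise the denominator is not a unit.\<close>

definition padic_of_rat :: "nat \<Rightarrow> rat \<Rightarrow> nat \<Rightarrow> int" where
  "padic_of_rat p q =
    padic_of_int p (fst (quotient_of q)) \<otimes>\<^bsub>padic_ring p\<^esub>
      inv\<^bsub>padic_ring p\<^esub> padic_of_int p (snd (quotient_of q))"

definition padic_cong :: "nat \<Rightarrow> nat \<Rightarrow> (nat \<Rightarrow> int) \<Rightarrow> (nat \<Rightarrow> int) \<Rightarrow> bool" where
  "padic_cong p n x y \<longleftrightarrow>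
    padic_of_int p (int p ^ n) divides\<^bsub>padic_ring p\<^esub> (x \<ominus>\<^bsub>padic_ring p\<^esub> y)"

text \<open>Morita's \<open>p\<close>-adic Gamma function, as the \<open>p\<close>-adic limit of
  $(-1)^m \prod_{0<k<m,\, p\nmid k} k$ as the positive integer $m$ tends to $x$.\<close>

definition padic_Gamma_nat :: "nat \<Rightarrow> nat \<Rightarrow> int" where
  "padic_Gamma_nat p m = (-1) ^ m * (\<Prod>k | 0 < k \<and> k < m \<and> \<not> p dvd k. int k)"

definition padic_Gamma :: "nat \<Rightarrow> (nat \<Rightarrow> int) \<Rightarrow> nat \<Rightarrow> int" where
  "padic_Gamma p x =
    (THE y. y \<in> carrier (padic_ring p) \<and>
       (\<forall>n. \<exists>N. \<forall>m>0. padic_cong p N (padic_of_int p (int m)) x \<longrightarrow>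
          padic_cong p n (padic_of_int p (padic_Gamma_nat p m)) y))"

lemma padic_of_int_closed:
  assumes "p > 0"
  shows "padic_of_int p a \<in> carrier (padic_ring p)"
  using assms by (simp add: padic_ring_def padic_of_int_def mod_mod_cancel)

lemma cring_padic_ring:
  assumes p: "p > 0"
  shows "cring (padic_ring p)"
proof -
  have reduce: "u mod int p ^ Suc n mod int p ^ n = u mod int p ^ n" for u :: int and n
    by (rule mod_mod_cancel) simp
  have bounds: "0 \<le> u mod int p ^ n" "u mod int p ^ n < int p ^ n" for u :: int and n
    using p by simp_all
  have carrierI: "(\<lambda>n. f n mod int p ^ n) \<in> carrier (padic_ring p)"
    if "\<And>n. f (Suc n) mod int p ^ n = f n mod int p ^ n" for f
    using that bounds reduce by (simp add: padic_ring_def)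
  have comp: "x (Suc n) mod int p ^ n = x n" "x n mod int p ^ n = x n"
    if "x \<in> carrier (padic_ring p)" for x n
    using that by (auto simp: padic_ring_def)
  have closed_add: "x \<oplus>\<^bsub>padic_ring p\<^esub> y \<in> carrier (padic_ring p)"
    if "x \<in> carrier (padic_ring p)" "y \<in> carrier (padic_ring p)" for x y
  proof -
    have "(\<lambda>n. (x n + y n) mod int p ^ n) \<in> carrier (padic_ring p)"
      by (rule carrierI) (metis comp that mod_add_eq)
    then show ?thesis by (simp add: padic_ring_def)
  qed
  have closed_mult: "x \<otimes>\<^bsub>padic_ring p\<^esub> y \<in> carrier (padic_ring p)"
    if "x \<in> carrier (padic_ring p)" "y \<in> carrier (padic_ring p)" for x y
  proof -
    have "(\<lambda>n. (x n * y n) mod int p ^ n) \<in> carrier (padic_ring p)"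
      by (rule carrierI) (metis comp that mod_mult_eq)
    then show ?thesis by (simp add: padic_ring_def)
  qed
  have minus: "\<exists>y\<in>carrier (padic_ring p). y \<oplus>\<^bsub>padic_ring p\<^esub> x = \<zero>\<^bsub>padic_ring p\<^esub>"
    if x: "x \<in> carrier (padic_ring p)" for x
  proof
    show "(\<lambda>n. (- x n) mod int p ^ n) \<in> carrier (padic_ring p)"
      by (rule carrierI) (metis comp x mod_minus_eq)
    show "(\<lambda>n. (- x n) mod int p ^ n) \<oplus>\<^bsub>padic_ring p\<^esub> x = \<zero>\<^bsub>padic_ring p\<^esub>"
      by (simp add: padic_ring_def mod_add_left_eq)
  qed
  have one: "\<one>\<^bsub>padic_ring p\<^esub> \<in> carrier (padic_ring p)"
    using padic_of_int_closed[OF p, of 1] by (simp add: padic_ring_def padic_of_int_def)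
  have zero: "\<zero>\<^bsub>padic_ring p\<^esub> \<in> carrier (padic_ring p)"
    using p by (simp add: padic_ring_def)
  show ?thesis
  proof (rule cringI)
    show "abelian_group (padic_ring p)"
    proof (rule abelian_groupI)
      fix x y z assume "x \<in> carrier (padic_ring p)" "y \<in> carrier (padic_ring p)"
        "z \<in> carrier (padic_ring p)"
      show "x \<oplus>\<^bsub>padic_ring p\<^esub> y \<oplus>\<^bsub>padic_ring p\<^esub> z = x \<oplus>\<^bsub>padic_ring p\<^esub> (y \<oplus>\<^bsub>padic_ring p\<^esub> z)"
        by (simp add: padic_ring_def mod_simps add.assoc)
    next
      fix x assume "x \<in> carrier (padic_ring p)"
      then show "\<zero>\<^bsub>padic_ring p\<^esub> \<oplus>\<^bsub>padic_ring p\<^esub> x = x"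
        by (auto simp: padic_ring_def)
    qed (use closed_add zero minus in \<open>auto simp: padic_ring_def add.commute\<close>)
    show "Group.comm_monoid (padic_ring p)"
    proof (rule comm_monoidI)
      fix x y z assume "x \<in> carrier (padic_ring p)" "y \<in> carrier (padic_ring p)"
        "z \<in> carrier (padic_ring p)"
      show "x \<otimes>\<^bsub>padic_ring p\<^esub> y \<otimes>\<^bsub>padic_ring p\<^esub> z = x \<otimes>\<^bsub>padic_ring p\<^esub> (y \<otimes>\<^bsub>padic_ring p\<^esub> z)"
        by (simp add: padic_ring_def mod_simps mult.assoc)
    next
      fix x assume "x \<in> carrier (padic_ring p)"
      then show "\<one>\<^bsub>padic_ring p\<^esub> \<otimes>\<^bsub>padic_ring p\<^esub> x = x"
        by (auto simp: padic_ring_def mod_simps)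
    qed (use closed_mult one in \<open>auto simp: padic_ring_def mult.commute\<close>)
    fix x y z assume "x \<in> carrier (padic_ring p)" "y \<in> carrier (padic_ring p)"
      "z \<in> carrier (padic_ring p)"
    show "(x \<oplus>\<^bsub>padic_ring p\<^esub> y) \<otimes>\<^bsub>padic_ring p\<^esub> z =
        x \<otimes>\<^bsub>padic_ring p\<^esub> z \<oplus>\<^bsub>padic_ring p\<^esub> y \<otimes>\<^bsub>padic_ring p\<^esub> z"
      by (simp add: padic_ring_def mod_simps distrib_right)
  qed
qed

end

theory Submission
  imports Defs "HOL-Number_Theory.Residues"
begin

text \<open>
  Put \<open>a = r/3\<close>, \<open>\<pi> = 2p/3\<close> and \<open>n = (2p - r)/3\<close>, so that \<open>a + n = \<pi>\<close>. In the very-well-poised sum,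
  deform five of the six upper parameters \<open>a\<close> to \<open>a - x\<^sub>i\<close> and the matching lower parameters \<open>1\<close> to
  \<open>1 + x\<^sub>i\<close>, where the \<open>x\<^sub>i\<close> are multiples of \<open>p\<close> with sum zero. If some \<open>x\<^sub>i\<close> equals \<open>\<pi>\<close> the sum
  terminates, and Whipple's transformation followed by Sears' turns it into \<open>p\<^sup>4\<close> times \<open>p\<close>-integral
  factors and a deformation of the short sum on the right-hand side. The closed form singles out one of
  the parameters \<open>x\<^sub>i\<close>, whereas the deformed sum is symmetric; this forces the first-order correction to
  be independent of the \<open>x\<^sub>i\<close>.

  The undeformed sum is recovered as follows. Modulo \<open>p\<^sup>6\<close> the deformed sum is a linear combination of \<open>1\<close>,
  \<open>e\<^sub>2\<close>, \<open>e\<^sub>3\<close>, \<open>e\<^sub>4\<close>, \<open>e\<^sub>2\<^sup>2\<close>, \<open>e\<^sub>2 e\<^sub>3\<close> and \<open>e\<^sub>5\<close>, where \<open>e\<^sub>j\<close> are the elementary symmetric polynomials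
  of the \<open>x\<^sub>i\<close>. The coefficient of \<open>e\<^sub>5\<close> is divisible by \<open>p\<close>, because modulo \<open>p\<close> its summands are
  antisymmetric under \<open>k \<mapsto> n - k\<close>. A suitable weighted average over five points with \<open>x\<^sub>5 = \<pi>\<close> kills
  the other nonconstant monomials, so the undeformed sum is the average of the closed forms.
  What remains is a comparison of units modulo \<open>p\<^sup>2\<close>, for which \<open>\<Gamma>\<^sub>p(p k)\<close> is the \<open>k\<close>-th power of a fixed unit.
\<close>

section \<open>Transformation of very-well-poised sums\<close>

text \<open>A parameter equal to \<open>\<pi>\<close> turns one upper parameter into
  \<open>a - \<pi> = - of_nat n\<close>. This ends the sum, but it also excludes the undeformed
  point, at which all parameters are zero. That point is therefore reached only through an expansion
  in the parameters that is precise to \<open>p ^ 6\<close>. The zero-sum condition serves twice. It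
  removes the first elementary symmetric polynomial, and it gives the last parameter of Sears' sum
  the value \<open>3 * a - 1 = r - 1\<close> at every point, which is why the short sum has
  \<open>2 - r\<close> terms. One of the four powers of \<open>p\<close> is
  \<open>a + of_nat n = \<pi>\<close>; the other three come from Pochhammer symbols that each
  contain one multiple of \<open>p\<close>. Once they are explicit, every other factor matters only
  modulo \<open>p ^ 2\<close>, that is, to first order. They also supply the constant
  \<open>3 * \<pi> * (p / 3) ^ 3 = 2 / 27 * p ^ 4\<close>, to which the average contributes a
  further factor \<open>-5\<close>.\<close>

lemma choose_absorb: "of_nat (Suc i) * of_nat (k choose Suc i) = (of_nat (k choose i) * (of_nat k - of_nat i) :: 'a::comm_ring_1)"
proof (cases "i \<le> k")
  case True
  have "Suc i * (k choose Suc i) = (k choose i) * (k - i)"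
    by (metis binomial_absorb_comp binomial_absorption mult.commute)
  then show ?thesis using True by (metis of_nat_mult of_nat_diff)
qed (simp add: binomial_eq_0)

lemma pochhammer_reflect:
  fixes x :: "'a::comm_ring_1"
  shows "pochhammer (1 - x - of_nat m) m = (-1) ^ m * pochhammer x m"
proof -
  have "1 - x - of_nat m = - (x + of_nat m - 1)" by simp
  then show ?thesis
    by (simp only: pochhammer_minus) (simp add: algebra_simps)
qed

text \<open>The Pfaff-Saalschuetz sum with all denominators cleared, so that no nonvanishing
  conditions have to be carried along. Pascal's rule splits the sum for \<open>Suc k\<close>, and an
  index shift turns every piece into a multiple of \<open>u j\<close>; the multipliers add up to
  \<open>(C - A + of_nat k) * (C - B + of_nat k)\<close>, which does not depend on
  \<open>j\<close>.\<close>

lemma saalschuetz: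
  fixes A B C :: "'a::comm_ring_1"
  shows "(\<Sum>j\<le>k. of_nat (k choose j) * pochhammer A j * pochhammer B j *
      pochhammer (C + of_nat j) (k - j) * pochhammer (C - A - B) (k - j))
    = pochhammer (C - A) k * pochhammer (C - B) k"
proof (induction k)
  case 0
  show ?case by simp
next
  case (Suc k)
  define X where "X = C - A - B"
  define u where "u j = of_nat (k choose j) * pochhammer A j * pochhammer B j *
      pochhammer (C + of_nat j) (k - j) * pochhammer X (k - j)" for j
  define g where "g j = pochhammer A j * pochhammer B j *
      pochhammer (C + of_nat j) (Suc k - j) * pochhammer X (Suc k - j)" for j
  have "(\<Sum>j\<le>Suc k. of_nat (Suc k choose j) * g j)
      = g 0 + (\<Sum>i\<le>k. (of_nat (k choose Suc i) + of_nat (k choose i)) * g (Suc i))"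
    by (subst sum.atMost_Suc_shift) (simp add: add.commute)
  also have "\<dots> = (of_nat (k choose 0) * g 0 + (\<Sum>i\<le>k. of_nat (k choose Suc i) * g (Suc i)))
      + (\<Sum>i\<le>k. of_nat (k choose i) * g (Suc i))"
    by (simp add: distrib_right sum.distrib)
  also have "of_nat (k choose 0) * g 0 + (\<Sum>i\<le>k. of_nat (k choose Suc i) * g (Suc i))
      = (\<Sum>j\<le>Suc k. of_nat (k choose j) * g j)"
    by (subst sum.atMost_Suc_shift) simp
  also have "\<dots> = (\<Sum>j\<le>k. of_nat (k choose j) * g j)"
    by (simp add: binomial_eq_0)
  finally have split: "(\<Sum>j\<le>Suc k. of_nat (Suc k choose j) * g j)
      = (\<Sum>j\<le>k. of_nat (k choose j) * g j) + (\<Sum>i\<le>k. of_nat (k choose i) * g (Suc i))" .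
  have g1: "of_nat (k choose j) * g j = u j * ((C + of_nat k) * (X + of_nat k - of_nat j))"
    if "j \<le> k" for j
    using that unfolding g_def u_def
    by (simp add: Suc_diff_le pochhammer_Suc of_nat_diff algebra_simps)
  \<comment> \<open>Splits \<open>C + of_nat k\<close> into \<open>C + of_nat i\<close> and
    \<open>of_nat k - of_nat i\<close>; the second part moves the binomial coefficient on by one,
    which gives a multiple of \<open>u (Suc i)\<close>.\<close>
  have g2: "of_nat (k choose i) * g (Suc i) = u i * ((A + of_nat i) * (B + of_nat i))
      + of_nat (Suc i) * u (Suc i) * (X + of_nat k - of_nat (Suc i))" if "i \<le> k" for i
  proof (cases "i = k")
    case True
    then show ?thesis by (simp add: g_def u_def pochhammer_Suc binomial_eq_0 algebra_simps)
  next
    case False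
    then have "i < k" using that by simp
    then obtain m where "k = Suc (i + m)" using less_imp_Suc_add by blast
    then have m: "k - i = Suc m" "k - Suc i = m" "k = Suc (i + m)" by simp_all
    have c: "of_nat (Suc i) * of_nat (k choose Suc i) = (of_nat (k choose i) * (1 + of_nat m) :: 'a)"
      by (subst choose_absorb) (simp add: m(3) algebra_simps)
    define P where "P = pochhammer (C + of_nat (Suc i)) m"
    have p1: "pochhammer (C + of_nat (Suc i)) (Suc m) = P * (C + of_nat k)"
      by (simp add: P_def pochhammer_Suc m(3) algebra_simps)
    have p2: "pochhammer (C + of_nat i) (Suc m) = (C + of_nat i) * P"
      by (simp add: P_def pochhammer_rec algebra_simps)
    have "of_nat (Suc i) * u (Suc i) * (X + of_nat k - of_nat (Suc i))
       = (of_nat (Suc i) * of_nat (k choose Suc i)) * (pochhammer A (Suc i) * pochhammer B (Suc i)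
          * P * (pochhammer X m * (X + of_nat m)))"
      unfolding u_def m(2) P_def by (simp add: m(3) algebra_simps)
    then have t2: "of_nat (Suc i) * u (Suc i) * (X + of_nat k - of_nat (Suc i))
       = of_nat (k choose i) * (1 + of_nat m) * (pochhammer A (Suc i) * pochhammer B (Suc i)
          * P * (pochhammer X m * (X + of_nat m)))"
      unfolding c .
    have t1: "u i * ((A + of_nat i) * (B + of_nat i)) = of_nat (k choose i) *
      (pochhammer A (Suc i) * pochhammer B (Suc i)) * ((C + of_nat i) * P * (pochhammer X m * (X + of_nat m)))"
      unfolding u_def m(1) p2 by (simp add: pochhammer_Suc algebra_simps)
    have t0: "of_nat (k choose i) * g (Suc i) = of_nat (k choose i) *
      (pochhammer A (Suc i) * pochhammer B (Suc i)) * (P * (C + of_nat k) * (pochhammer X m * (X + of_nat m)))"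
      unfolding g_def diff_Suc_Suc m(1) p1 by (simp add: pochhammer_Suc algebra_simps)
    show ?thesis unfolding t0 t1 t2 by (simp add: m(3) algebra_simps)
  qed
  have "(\<Sum>i\<le>k. of_nat (Suc i) * u (Suc i) * (X + of_nat k - of_nat (Suc i)))
      = (\<Sum>i\<le>Suc k. of_nat i * u i * (X + of_nat k - of_nat i))"
    by (subst sum.atMost_Suc_shift) simp
  also have "\<dots> = (\<Sum>i\<le>k. of_nat i * u i * (X + of_nat k - of_nat i))"
    by (simp add: u_def binomial_eq_0)
  finally have shift: "(\<Sum>i\<le>k. of_nat (Suc i) * u (Suc i) * (X + of_nat k - of_nat (Suc i)))
      = (\<Sum>i\<le>k. of_nat i * u i * (X + of_nat k - of_nat i))" .
  have "(\<Sum>j\<le>Suc k. of_nat (Suc k choose j) * g j)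
      = (\<Sum>j\<le>k. u j * ((C + of_nat k) * (X + of_nat k - of_nat j)))
        + ((\<Sum>i\<le>k. u i * ((A + of_nat i) * (B + of_nat i)))
        + (\<Sum>i\<le>k. of_nat i * u i * (X + of_nat k - of_nat i)))"
    unfolding split shift[symmetric] sum.distrib[symmetric]
    by (intro sum.cong refl) (simp only: sum.distrib[symmetric] atMost_iff g1 g2 cong: sum.cong)
  also have "\<dots> = (\<Sum>j\<le>k. u j * ((C - A + of_nat k) * (C - B + of_nat k)))"
    unfolding sum.distrib[symmetric]
    by (intro sum.cong refl) (simp add: X_def algebra_simps)
  also have "\<dots> = (\<Sum>j\<le>k. u j) * ((C - A + of_nat k) * (C - B + of_nat k))"
    by (simp add: sum_distrib_right)
  also have "(\<Sum>j\<le>k. u j) = pochhammer (C - A) k * pochhammer (C - B) k"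
    using Suc.IH by (simp add: u_def X_def)
  finally show ?case
    by (simp add: g_def X_def pochhammer_Suc algebra_simps)
qed

section \<open>Matrix inversion and terminating very-well-poised sums\<close>

lemma sum_triangle_swap:
  fixes f :: "nat \<Rightarrow> nat \<Rightarrow> 'a::comm_monoid_add"
  shows "(\<Sum>k\<le>n. \<Sum>j\<le>k. f k j) = (\<Sum>j\<le>n. \<Sum>i\<le>n - j. f (j + i) j)"
proof -
  have "(\<Sum>k\<le>n. \<Sum>j\<le>k. f k j) = (\<Sum>(k,j)\<in>(SIGMA k:{..n}. {..k}). f k j)"
    by (simp add: sum.Sigma)
  also have "\<dots> = (\<Sum>(j,i)\<in>(SIGMA j:{..n}. {..n - j}). f (j + i) j)"
    by (rule sum.reindex_bij_witness[of _ "\<lambda>(j,i). (j+i,j)" "\<lambda>(k,j). (j,k-j)"]) auto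
  also have "\<dots> = (\<Sum>j\<le>n. \<Sum>i\<le>n - j. f (j + i) j)"
    by (simp add: sum.Sigma)
  finally show ?thesis .
qed

text \<open>The very-well-poised factor of a series with upper parameter \<open>- of_nat n\<close>,
  divided by \<open>pochhammer (1 + a) n\<close>. In this normalization the weights form the inverse
  of the triangular matrix with entries
  \<open>of_nat (k choose j) * (-1) ^ j * pochhammer (a + of_nat k) j\<close>.\<close>

definition vwp_weight :: "'a::field_char_0 \<Rightarrow> nat \<Rightarrow> nat \<Rightarrow> 'a" where
  "vwp_weight a n k = (-1) ^ k * of_nat (n choose k) * (a + 2 * of_nat k) * pochhammer a k
     / pochhammer a (Suc (n + k))"

text \<open>The weights are summable in closed form. The factor \<open>of_nat (m choose s)\<close>
  vanishes at \<open>s = Suc m\<close>, so the complete sum is zero.\<close>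

lemma sum_vwp_weight_partial:
  assumes nz: "\<And>k. pochhammer a k \<noteq> (0::'a::field_char_0)"
  shows "(\<Sum>i\<le>s. vwp_weight a (Suc m) i)
    = (-1) ^ s * of_nat (m choose s) * pochhammer a (Suc s) / pochhammer a (Suc (Suc (m + s)))"
proof (induction s)
  case 0
  show ?case by (simp add: vwp_weight_def)
next
  case (Suc s)
  define P where "P = pochhammer a (Suc (Suc (m + s)))"
  define c where "c = a + of_nat m + of_nat s + 2"
  have c: "pochhammer a (Suc (Suc (m + Suc s))) = P * c"
    unfolding P_def c_def by (simp add: pochhammer_Suc algebra_simps)
  have P0: "P \<noteq> 0" "c \<noteq> 0"
    using nz[of "Suc (Suc (m + s))"] nz[of "Suc (Suc (m + Suc s))"] c by (auto simp: P_def)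
  have ab: "of_nat (Suc s) * of_nat (m choose Suc s) = (of_nat (m choose s) * (of_nat m - of_nat s) :: 'a)"
    by (rule choose_absorb)
  define x y where "x = (of_nat (m choose s) :: 'a)" and "y = (of_nat (m choose Suc s) :: 'a)"
  have ab': "(1 + of_nat s) * y = x * (of_nat m - of_nat s)"
    using ab by (simp add: x_def y_def algebra_simps)
  have key: "x * c - (x + y) * (a + 2 * of_nat (Suc s)) = - (y * (a + of_nat (Suc s)))"
  proof -
    have "x * c - (x + y) * (a + 2 * of_nat (Suc s)) + y * (a + of_nat (Suc s))
       = x * (of_nat m - of_nat s) - (1 + of_nat s) * y"
      unfolding c_def by (simp add: algebra_simps)
    then show ?thesis using ab' by (simp add: eq_neg_iff_add_eq_0)
  qed
  have w: "vwp_weight a (Suc m) (Suc s) = - ((-1) ^ s * (x + y) * (a + 2 * of_nat (Suc s)) *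
        pochhammer a (Suc s) / (P * c))"
    unfolding vwp_weight_def add_Suc c x_def y_def by simp
  have "(\<Sum>i\<le>Suc s. vwp_weight a (Suc m) i)
      = (-1) ^ s * x * pochhammer a (Suc s) / P - (-1) ^ s * (x + y) * (a + 2 * of_nat (Suc s)) *
        pochhammer a (Suc s) / (P * c)"
    unfolding sum.atMost_Suc Suc.IH w by (simp add: P_def x_def)
  also have "\<dots> = (-1) ^ s * pochhammer a (Suc s) * (x * c - (x + y) * (a + 2 * of_nat (Suc s))) / (P * c)"
    using P0 by (simp add: field_simps)
  also have "\<dots> = (-1) ^ Suc s * y * pochhammer a (Suc (Suc s)) / (P * c)"
    unfolding key by (simp add: pochhammer_Suc algebra_simps)
  finally show ?case using c y_def by simp
qed

lemma sum_vwp_weight: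
  assumes nz: "\<And>k. pochhammer a k \<noteq> (0::'a::field_char_0)"
  shows "(\<Sum>i\<le>m. vwp_weight a m i) = (if m = 0 then 1 else 0)"
proof (cases m)
  case 0
  then show ?thesis using nz[of 1] by (simp add: vwp_weight_def)
next
  case (Suc m')
  then show ?thesis using sum_vwp_weight_partial[OF nz, of m' m] by (simp add: binomial_eq_0)
qed

text \<open>The product of a weight with an entry of the inverse matrix is again a weight, with
  \<open>a\<close> moved to \<open>a + 2 * of_nat j\<close>. Hence the inner sums stay
  very-well-poised after the order of summation is exchanged.\<close>

lemma vwp_weight_shift:
  assumes nz: "\<And>k. pochhammer a k \<noteq> (0::'a::field_char_0)" and le: "j \<le> n" "i \<le> n - j"
  shows "vwp_weight a n (j + i) * (of_nat ((j + i) choose j) * (-1) ^ j * pochhammer (a + of_nat (j + i)) j)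
    = of_nat (n choose j) * vwp_weight (a + 2 * of_nat j) (n - j) i"
proof -
  obtain m where m: "n = j + m" using le by (metis le_iff_add)
  have b: "of_nat (n choose (j + i)) * of_nat ((j + i) choose j) = (of_nat (n choose j) * of_nat (m choose i) :: 'a)"
  proof -
    have "(n choose (j + i)) * ((j + i) choose j) = (n choose j) * ((n - j) choose (j + i - j))"
      by (rule choose_mult) (use le m in auto)
    then show ?thesis unfolding m by (simp flip: of_nat_mult)
  qed
  have e2: "a + of_nat (2 * j) = a + 2 * of_nat j" by simp
  have i1: "j + i + j = 2 * j + i" and i2: "Suc (n + (j + i)) = 2 * j + Suc (m + i)"
    using m by simp_all
  have p1: "pochhammer a (j + i) * pochhammer (a + of_nat (j + i)) j
      = pochhammer a (2 * j) * pochhammer (a + 2 * of_nat j) i"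
    using pochhammer_product'[of a "j + i" j] pochhammer_product'[of a "2 * j" i]
    unfolding i1 e2 by simp
  have p2: "pochhammer a (Suc (n + (j + i))) = pochhammer a (2 * j) * pochhammer (a + 2 * of_nat j) (Suc (m + i))"
    using pochhammer_product'[of a "2 * j" "Suc (m + i)"] unfolding i2 e2 .
  have s: "(-1) ^ (j + i) * (-1) ^ j = ((-1) ^ i :: 'a)"
    by (simp add: power_add mult_ac)
  have "vwp_weight a n (j + i) * (of_nat ((j + i) choose j) * (-1) ^ j * pochhammer (a + of_nat (j + i)) j)
     = ((-1) ^ (j + i) * (-1) ^ j) * (of_nat (n choose (j + i)) * of_nat ((j + i) choose j))
       * (a + 2 * of_nat (j + i)) * (pochhammer a (j + i) * pochhammer (a + of_nat (j + i)) j)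
       / pochhammer a (Suc (n + (j + i)))"
    by (simp add: vwp_weight_def)
  also have "\<dots> = (-1) ^ i * (of_nat (n choose j) * of_nat (m choose i))
       * (a + 2 * of_nat (j + i)) * (pochhammer (a + 2 * of_nat j) i)
       / pochhammer (a + 2 * of_nat j) (Suc (m + i))"
    unfolding s b p1 p2 using nz[of "2 * j"] by simp
  finally show ?thesis by (simp add: vwp_weight_def m algebra_simps)
qed

lemma vwp_interchange:
  assumes nz: "\<And>k. pochhammer a k \<noteq> (0::'a::field_char_0)"
  shows "(\<Sum>k\<le>n. vwp_weight a n k *
      (\<Sum>j\<le>k. of_nat (k choose j) * (-1) ^ j * pochhammer (a + of_nat k) j * \<alpha> j) * D k)
    = (\<Sum>j\<le>n. of_nat (n choose j) * \<alpha> j *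
        (\<Sum>i\<le>n - j. vwp_weight (a + 2 * of_nat j) (n - j) i * D (j + i)))"
proof -
  have "(\<Sum>k\<le>n. vwp_weight a n k *
      (\<Sum>j\<le>k. of_nat (k choose j) * (-1) ^ j * pochhammer (a + of_nat k) j * \<alpha> j) * D k)
     = (\<Sum>k\<le>n. \<Sum>j\<le>k. vwp_weight a n k *
        (of_nat (k choose j) * (-1) ^ j * pochhammer (a + of_nat k) j) * (\<alpha> j * D k))"
    by (simp add: sum_distrib_left sum_distrib_right mult_ac)
  also have "\<dots> = (\<Sum>j\<le>n. \<Sum>i\<le>n - j. vwp_weight a n (j + i) *
        (of_nat ((j + i) choose j) * (-1) ^ j * pochhammer (a + of_nat (j + i)) j) * (\<alpha> j * D (j + i)))"
    by (rule sum_triangle_swap)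
  also have "\<dots> = (\<Sum>j\<le>n. \<Sum>i\<le>n - j. of_nat (n choose j) * vwp_weight (a + 2 * of_nat j) (n - j) i
        * (\<alpha> j * D (j + i)))"
    by (intro sum.cong refl) (simp only: atMost_iff vwp_weight_shift[OF nz])
  also have "\<dots> = (\<Sum>j\<le>n. of_nat (n choose j) * \<alpha> j *
        (\<Sum>i\<le>n - j. vwp_weight (a + 2 * of_nat j) (n - j) i * D (j + i)))"
    by (simp add: sum_distrib_left mult_ac)
  finally show ?thesis .
qed

lemma pochhammer_shift_nonzero:
  assumes "\<And>k. pochhammer a k \<noteq> (0::'a::field_char_0)"
  shows "pochhammer (a + 2 * of_nat j) k \<noteq> 0"
  using assms[of "2 * j + k"] pochhammer_product'[of a "2 * j" k] by auto

lemma vwp_inversion: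
  assumes nz: "\<And>k. pochhammer a k \<noteq> (0::'a::field_char_0)"
  shows "(\<Sum>k\<le>n. vwp_weight a n k *
      (\<Sum>j\<le>k. of_nat (k choose j) * (-1) ^ j * pochhammer (a + of_nat k) j * \<alpha> j)) = \<alpha> n"
proof -
  have "(\<Sum>k\<le>n. vwp_weight a n k *
      (\<Sum>j\<le>k. of_nat (k choose j) * (-1) ^ j * pochhammer (a + of_nat k) j * \<alpha> j))
    = (\<Sum>j\<le>n. of_nat (n choose j) * \<alpha> j * (if n - j = 0 then 1 else 0))"
    using vwp_interchange[OF nz, where D = "\<lambda>_. 1"]
      sum_vwp_weight[OF pochhammer_shift_nonzero[OF nz]]
    by simp
  also have "\<dots> = (\<Sum>j\<le>n. if j = n then \<alpha> n else 0)"
    by (intro sum.cong refl) auto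
  finally show ?thesis by simp
qed

text \<open>Saalschuetz's sum for the upper parameters \<open>a + of_nat k\<close> and
  \<open>1 + a - d - e\<close>. It writes a well-poised pair as the triangular matrix applied to a
  sequence, which is the form that the weights invert.\<close>

lemma well_poised_pair_expansion:
  fixes a d e :: "'a::field_char_0"
  assumes "pochhammer (1 + a - d) k \<noteq> 0" "pochhammer (1 + a - e) k \<noteq> 0"
  shows "pochhammer d k * pochhammer e k / (pochhammer (1 + a - d) k * pochhammer (1 + a - e) k)
    = (\<Sum>j\<le>k. of_nat (k choose j) * (-1) ^ j * pochhammer (a + of_nat k) j *
        (pochhammer (1 + a - d - e) j / (pochhammer (1 + a - d) j * pochhammer (1 + a - e) j)))"
proof -
  have sq: "(-1) ^ k * (-1) ^ (k - j) = ((-1) ^ j :: 'a)" if "j \<le> k" for j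
  proof -
    have "(-1) ^ k = (-1) ^ j * ((-1) ^ (k - j) :: 'a)"
      using that by (simp flip: power_add)
    then show ?thesis by (simp only: mult.assoc minus_one_mult_self mult_1_right)
  qed
  have "(\<Sum>j\<le>k. of_nat (k choose j) * pochhammer (a + of_nat k) j * pochhammer (1 + a - d - e) j *
      pochhammer (1 + a - d + of_nat j) (k - j) * pochhammer (e - a - of_nat k) (k - j))
    = pochhammer (1 - d - of_nat k) k * pochhammer e k"
    using saalschuetz[of k "a + of_nat k" "1 + a - d - e" "1 + a - d"] by (simp add: algebra_simps)
  moreover have "pochhammer (e - a - of_nat k) (k - j)
      = (-1) ^ (k - j) * pochhammer (1 + a - e + of_nat j) (k - j)" if "j \<le> k" for j
    using pochhammer_reflect[of "1 + a - e + of_nat j" "k - j"] that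
    by (simp add: of_nat_diff algebra_simps)
  ultimately have "(\<Sum>j\<le>k. of_nat (k choose j) * pochhammer (a + of_nat k) j * pochhammer (1 + a - d - e) j *
      pochhammer (1 + a - d + of_nat j) (k - j) * ((-1) ^ (k - j) * pochhammer (1 + a - e + of_nat j) (k - j)))
    = (-1) ^ k * pochhammer d k * pochhammer e k"
    by (simp add: pochhammer_reflect)
  then have "(-1) ^ k * (\<Sum>j\<le>k. of_nat (k choose j) * pochhammer (a + of_nat k) j * pochhammer (1 + a - d - e) j *
      pochhammer (1 + a - d + of_nat j) (k - j) * ((-1) ^ (k - j) * pochhammer (1 + a - e + of_nat j) (k - j)))
    = ((-1) ^ k * (-1) ^ k) * (pochhammer d k * pochhammer e k)"
    by simp
  also have "(-1) ^ k * (-1) ^ k = (1 :: 'a)" by simp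
  finally have *: "pochhammer d k * pochhammer e k = (\<Sum>j\<le>k. of_nat (k choose j) * ((-1) ^ k * (-1) ^ (k - j)) *
      pochhammer (a + of_nat k) j * pochhammer (1 + a - d - e) j *
      pochhammer (1 + a - d + of_nat j) (k - j) * pochhammer (1 + a - e + of_nat j) (k - j))"
    by (simp add: sum_distrib_left mult_ac)
  show ?thesis unfolding * sum_divide_distrib
  proof (rule sum.cong[OF refl])
    fix j assume "j \<in> {..k}"
    then have j: "j \<le> k" by simp
    show "of_nat (k choose j) * ((-1) ^ k * (-1) ^ (k - j)) * pochhammer (a + of_nat k) j *
         pochhammer (1 + a - d - e) j * pochhammer (1 + a - d + of_nat j) (k - j) *
         pochhammer (1 + a - e + of_nat j) (k - j) / (pochhammer (1 + a - d) k * pochhammer (1 + a - e) k)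
       = of_nat (k choose j) * (-1) ^ j * pochhammer (a + of_nat k) j *
        (pochhammer (1 + a - d - e) j / (pochhammer (1 + a - d) j * pochhammer (1 + a - e) j))"
      using assms unfolding sq[OF j] pochhammer_product[OF j, of "1 + a - d"] pochhammer_product[OF j, of "1 + a - e"]
      by (simp add: field_simps)
  qed
qed

lemma pochhammer_nonzero_le: "pochhammer (z::'a::field_char_0) n \<noteq> 0 \<Longrightarrow> k \<le> n \<Longrightarrow> pochhammer z k \<noteq> 0"
  by (metis pochhammer_product mult_eq_0_iff)

text \<open>By \<open>well_poised_pair_expansion\<close> the pair is the transform of a known
  sequence, and the weights recover the \<open>n\<close>-th term of that sequence.\<close>

lemma vwp_5F4:
  fixes a d e :: "'a::field_char_0"
  assumes nz: "\<And>k. pochhammer a k \<noteq> 0"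
    and "pochhammer (1 + a - d) n \<noteq> 0" "pochhammer (1 + a - e) n \<noteq> 0"
  shows "(\<Sum>k\<le>n. vwp_weight a n k *
      (pochhammer d k * pochhammer e k / (pochhammer (1 + a - d) k * pochhammer (1 + a - e) k)))
    = pochhammer (1 + a - d - e) n / (pochhammer (1 + a - d) n * pochhammer (1 + a - e) n)"
proof -
  have "(\<Sum>k\<le>n. vwp_weight a n k *
      (pochhammer d k * pochhammer e k / (pochhammer (1 + a - d) k * pochhammer (1 + a - e) k)))
    = (\<Sum>k\<le>n. vwp_weight a n k *
      (\<Sum>j\<le>k. of_nat (k choose j) * (-1) ^ j * pochhammer (a + of_nat k) j *
        (pochhammer (1 + a - d - e) j / (pochhammer (1 + a - d) j * pochhammer (1 + a - e) j))))"
    using well_poised_pair_expansion[OF pochhammer_nonzero_le[OF assms(2)] pochhammer_nonzero_le[OF assms(3)]]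
    by (intro sum.cong refl) simp
  also have "\<dots> = pochhammer (1 + a - d - e) n / (pochhammer (1 + a - d) n * pochhammer (1 + a - e) n)"
    by (rule vwp_inversion[OF nz])
  finally show ?thesis .
qed

text \<open>Whipple's transformation of a terminating very-well-poised 7F6 into a balanced 4F3. Only
  the pair \<open>b\<close>, \<open>c\<close> is expanded; after the interchange the inner sum is
  the 5F4 sum with \<open>a\<close>, \<open>d\<close>, \<open>e\<close> shifted by
  \<open>2 * j\<close>, \<open>j\<close>, \<open>j\<close>.\<close>

lemma whipple:
  fixes a b c d e :: "'a::field_char_0"
  assumes nz: "\<And>k. pochhammer a k \<noteq> 0"
    and b: "pochhammer (1 + a - b) n \<noteq> 0" and c: "pochhammer (1 + a - c) n \<noteq> 0"
    and d: "pochhammer (1 + a - d) n \<noteq> 0" and e: "pochhammer (1 + a - e) n \<noteq> 0"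
  shows "(\<Sum>k\<le>n. vwp_weight a n k *
      (pochhammer b k * pochhammer c k / (pochhammer (1 + a - b) k * pochhammer (1 + a - c) k)) *
      (pochhammer d k * pochhammer e k / (pochhammer (1 + a - d) k * pochhammer (1 + a - e) k)))
    = (\<Sum>j\<le>n. of_nat (n choose j) *
        (pochhammer (1 + a - b - c) j / (pochhammer (1 + a - b) j * pochhammer (1 + a - c) j)) *
        (pochhammer d j * pochhammer e j * pochhammer (1 + a - d - e) (n - j)))
      / (pochhammer (1 + a - d) n * pochhammer (1 + a - e) n)"
proof -
  define D where "D k = pochhammer d k * pochhammer e k / (pochhammer (1 + a - d) k * pochhammer (1 + a - e) k)" for k
  define \<alpha> where "\<alpha> j = pochhammer (1 + a - b - c) j / (pochhammer (1 + a - b) j * pochhammer (1 + a - c) j)" for j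
  have "(\<Sum>k\<le>n. vwp_weight a n k *
      (pochhammer b k * pochhammer c k / (pochhammer (1 + a - b) k * pochhammer (1 + a - c) k)) * D k)
    = (\<Sum>k\<le>n. vwp_weight a n k *
      (\<Sum>j\<le>k. of_nat (k choose j) * (-1) ^ j * pochhammer (a + of_nat k) j * \<alpha> j) * D k)"
    unfolding \<alpha>_def
    using well_poised_pair_expansion[OF pochhammer_nonzero_le[OF b] pochhammer_nonzero_le[OF c]]
    by (intro sum.cong refl) simp
  also have "\<dots> = (\<Sum>j\<le>n. of_nat (n choose j) * \<alpha> j *
        (\<Sum>i\<le>n - j. vwp_weight (a + 2 * of_nat j) (n - j) i * D (j + i)))"
    by (rule vwp_interchange[OF nz])
  also have "\<dots> = (\<Sum>j\<le>n. of_nat (n choose j) * \<alpha> j *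
        (pochhammer d j * pochhammer e j * pochhammer (1 + a - d - e) (n - j)
         / (pochhammer (1 + a - d) n * pochhammer (1 + a - e) n)))"
  proof (rule sum.cong[OF refl])
    fix j assume "j \<in> {..n}"
    then have j: "j \<le> n" by simp
    have nzj: "pochhammer (1 + a - d) j \<noteq> 0" "pochhammer (1 + a - e) j \<noteq> 0"
      "pochhammer (1 + a - d + of_nat j) (n - j) \<noteq> 0" "pochhammer (1 + a - e + of_nat j) (n - j) \<noteq> 0"
      using d e pochhammer_product[OF j] by (metis mult_eq_0_iff)+
    have nzs: "pochhammer (a + 2 * of_nat j) k \<noteq> 0" for k
      by (rule pochhammer_shift_nonzero[OF nz])
    have s: "1 + (a + 2 * of_nat j) - (d + of_nat j) = 1 + a - d + of_nat j"
      "1 + (a + 2 * of_nat j) - (e + of_nat j) = 1 + a - e + of_nat j"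
      "1 + a - d + of_nat j - (e + of_nat j) = 1 + a - d - e" by simp_all
    have "(\<Sum>i\<le>n - j. vwp_weight (a + 2 * of_nat j) (n - j) i * D (j + i))
       = D j * (\<Sum>i\<le>n - j. vwp_weight (a + 2 * of_nat j) (n - j) i *
          (pochhammer (d + of_nat j) i * pochhammer (e + of_nat j) i /
           (pochhammer (1 + a - d + of_nat j) i * pochhammer (1 + a - e + of_nat j) i)))"
      unfolding sum_distrib_left D_def pochhammer_product' by (intro sum.cong refl) (simp add: mult_ac)
    also have "\<dots> = D j * (pochhammer (1 + a - d - e) (n - j) /
       (pochhammer (1 + a - d + of_nat j) (n - j) * pochhammer (1 + a - e + of_nat j) (n - j)))"
      using vwp_5F4[OF nzs, where n = "n - j" and
          d = "d + of_nat j" and e = "e + of_nat j", unfolded s, OF nzj(3,4)] by simp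
    also have "\<dots> = pochhammer d j * pochhammer e j * pochhammer (1 + a - d - e) (n - j)
         / (pochhammer (1 + a - d) n * pochhammer (1 + a - e) n)"
      unfolding D_def pochhammer_product[OF j, of "1 + a - d"] pochhammer_product[OF j, of "1 + a - e"] by simp
    finally show "of_nat (n choose j) * \<alpha> j *
        (\<Sum>i\<le>n - j. vwp_weight (a + 2 * of_nat j) (n - j) i * D (j + i)) = of_nat (n choose j) * \<alpha> j *
        (pochhammer d j * pochhammer e j * pochhammer (1 + a - d - e) (n - j)
         / (pochhammer (1 + a - d) n * pochhammer (1 + a - e) n))" by simp
  qed
  finally show ?thesis unfolding D_def \<alpha>_def sum_divide_distrib by simp
qed

text \<open>Sears' transformation with denominators cleared; the hypothesis on \<open>A\<close> is
  the balancing condition. Saalschuetz's sum expands \<open>pochhammer A j * pochhammer e j\<close>,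
  and after the interchange the inner sum is again of Saalschuetz type.\<close>

lemma sears:
  fixes A X B C d e M E :: "'a::field_char_0"
  assumes A: "A = B + C - X - d - e" and M: "M = 1 - X - of_nat n - A" and E: "E = 1 - X - of_nat n - e"
  shows "(\<Sum>j\<le>n. of_nat (n choose j) * pochhammer A j * pochhammer d j * pochhammer e j *
      pochhammer X (n - j) * pochhammer (B + of_nat j) (n - j) * pochhammer (C + of_nat j) (n - j))
    = (\<Sum>k\<le>n. of_nat (n choose k) * pochhammer M k * pochhammer d k * pochhammer E k *
      pochhammer X (n - k) * pochhammer (B - d) (n - k) * pochhammer (C - d) (n - k))"
proof -
  \<comment> \<open>The lower parameter that comes from reversing
    \<open>pochhammer X (n - j)\<close>; \<open>M\<close> and \<open>E\<close> are
    \<open>\<delta> - A\<close> and \<open>\<delta> - e\<close>.\<close>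
  define \<delta> where "\<delta> = 1 - X - of_nat n"
  define Z where "Z = A + e - \<delta>"
  have AE: "pochhammer A j * pochhammer e j = (\<Sum>i\<le>j. of_nat (j choose i) * pochhammer M i *
      pochhammer E i * pochhammer (\<delta> + of_nat i) (j - i) * pochhammer Z (j - i))" for j
    using saalschuetz[of j M E \<delta>] by (simp add: M E \<delta>_def Z_def algebra_simps)
  have X: "pochhammer (\<delta> + of_nat i) l * pochhammer X (n - (i + l)) = (-1) ^ l * pochhammer X (n - i)"
    if "i \<le> n" "l \<le> n - i" for i l
  proof -
    have "1 - (X + of_nat (n - (i + l))) - of_nat l = \<delta> + of_nat i"
      using that by (simp add: \<delta>_def of_nat_diff algebra_simps)
    then have "pochhammer (\<delta> + of_nat i) l = (-1) ^ l * pochhammer (X + of_nat (n - (i + l))) l"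
      using pochhammer_reflect[of "X + of_nat (n - (i + l))" l] by simp
    moreover have "n - i = n - (i + l) + l" using that by simp
    ultimately show ?thesis by (simp add: pochhammer_product')
  qed
  have ch: "of_nat (n choose (i + l)) * of_nat ((i + l) choose i)
      = (of_nat (n choose i) * of_nat ((n - i) choose l) :: 'a)" if "i \<le> n" "l \<le> n - i" for i l
  proof -
    have "(n choose (i + l)) * ((i + l) choose i) = (n choose i) * ((n - i) choose (i + l - i))"
      by (rule choose_mult) (use that in auto)
    then show ?thesis by (simp flip: of_nat_mult)
  qed
  have inner: "(\<Sum>l\<le>n - i. of_nat ((n - i) choose l) * (-1) ^ l * pochhammer Z l * pochhammer (d + of_nat i) l *
      pochhammer (B + of_nat i + of_nat l) (n - i - l) * pochhammer (C + of_nat i + of_nat l) (n - i - l))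
    = pochhammer (B - d) (n - i) * pochhammer (C - d) (n - i)" if i: "i \<le> n" for i
  proof -
    define m where "m = n - i"
    have n: "of_nat n = (of_nat m + of_nat i :: 'a)" using i by (simp add: m_def of_nat_diff)
    have r: "pochhammer (1 - C - of_nat n) (m - l) = (-1) ^ (m - l) * pochhammer (C + of_nat i + of_nat l) (m - l)"
      if "l \<le> m" for l
      using pochhammer_reflect[of "C + of_nat i + of_nat l" "m - l"] that
      by (simp add: n of_nat_diff algebra_simps)
    have sq: "(-1) ^ m * (-1) ^ (m - l) = ((-1) ^ l :: 'a)" if "l \<le> m" for l
    proof -
      have "(-1) ^ m = (-1) ^ l * ((-1) ^ (m - l) :: 'a)"
        using that by (simp flip: power_add)
      then show ?thesis by (simp only: mult.assoc minus_one_mult_self mult_1_right)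
    qed
    have z: "1 - (C - d) - of_nat m - (d + of_nat i) = 1 - C - of_nat n"
      "B + of_nat i - (d + of_nat i) = B - d"
      "B + of_nat i - Z = 1 - (C - d) - of_nat m"
      by (simp_all add: Z_def \<delta>_def A n algebra_simps)
    have "(\<Sum>l\<le>m. of_nat (m choose l) * (-1) ^ l * pochhammer Z l * pochhammer (d + of_nat i) l *
      pochhammer (B + of_nat i + of_nat l) (m - l) * pochhammer (C + of_nat i + of_nat l) (m - l))
      = (-1) ^ m * (\<Sum>l\<le>m. of_nat (m choose l) * pochhammer Z l * pochhammer (d + of_nat i) l *
      pochhammer (B + of_nat i + of_nat l) (m - l) * pochhammer (1 - C - of_nat n) (m - l))"
      unfolding sum_distrib_left
    proof (rule sum.cong[OF refl])
      fix l assume "l \<in> {..m}"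
      then have l: "l \<le> m" by simp
      show "of_nat (m choose l) * (-1) ^ l * pochhammer Z l * pochhammer (d + of_nat i) l *
          pochhammer (B + of_nat i + of_nat l) (m - l) * pochhammer (C + of_nat i + of_nat l) (m - l)
        = (-1) ^ m * (of_nat (m choose l) * pochhammer Z l * pochhammer (d + of_nat i) l *
          pochhammer (B + of_nat i + of_nat l) (m - l) * pochhammer (1 - C - of_nat n) (m - l))"
        unfolding r[OF l] sq[OF l, symmetric] by (simp only: mult_ac)
    qed
    also have "\<dots> = (-1) ^ m * (pochhammer (1 - (C - d) - of_nat m) m * pochhammer (B - d) m)"
      using saalschuetz[of m Z "d + of_nat i" "B + of_nat i"] unfolding z(2,3) z(1) by simp
    also have "\<dots> = ((-1) ^ m * (-1) ^ m) * (pochhammer (B - d) m * pochhammer (C - d) m)"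
      by (simp add: pochhammer_reflect)
    also have "(-1) ^ m * (-1) ^ m = (1 :: 'a)" by simp
    finally show ?thesis by (simp add: m_def)
  qed
  have "(\<Sum>j\<le>n. of_nat (n choose j) * pochhammer A j * pochhammer d j * pochhammer e j *
      pochhammer X (n - j) * pochhammer (B + of_nat j) (n - j) * pochhammer (C + of_nat j) (n - j))
    = (\<Sum>j\<le>n. of_nat (n choose j) * pochhammer d j * (pochhammer A j * pochhammer e j) *
      pochhammer X (n - j) * pochhammer (B + of_nat j) (n - j) * pochhammer (C + of_nat j) (n - j))"
    by (simp add: mult_ac)
  also have "\<dots> = (\<Sum>j\<le>n. \<Sum>i\<le>j. of_nat (n choose j) * of_nat (j choose i) * pochhammer d j *
      (pochhammer M i * pochhammer E i) * (pochhammer (\<delta> + of_nat i) (j - i) * pochhammer X (n - j)) *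
      pochhammer Z (j - i) * pochhammer (B + of_nat j) (n - j) * pochhammer (C + of_nat j) (n - j))"
    unfolding AE sum_distrib_left sum_distrib_right by (simp add: mult_ac)
  also have "\<dots> = (\<Sum>i\<le>n. \<Sum>l\<le>n - i. of_nat (n choose (i + l)) * of_nat ((i + l) choose i) * pochhammer d (i + l) *
      (pochhammer M i * pochhammer E i) * (pochhammer (\<delta> + of_nat i) (i + l - i) * pochhammer X (n - (i + l))) *
      pochhammer Z (i + l - i) * pochhammer (B + of_nat (i + l)) (n - (i + l)) * pochhammer (C + of_nat (i + l)) (n - (i + l)))"
    by (rule sum_triangle_swap)
  also have "\<dots> = (\<Sum>i\<le>n. (of_nat (n choose i) * pochhammer M i * pochhammer d i * pochhammer E i * pochhammer X (n - i)) *
    (\<Sum>l\<le>n - i. of_nat ((n - i) choose l) * (-1) ^ l * pochhammer Z l * pochhammer (d + of_nat i) l *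
      pochhammer (B + of_nat i + of_nat l) (n - i - l) * pochhammer (C + of_nat i + of_nat l) (n - i - l)))"
    unfolding sum_distrib_left
    by (intro sum.cong refl)
      (simp only: atMost_iff ch X add_diff_cancel_left', simp add: pochhammer_product' add.assoc mult_ac)
  also have "\<dots> = (\<Sum>i\<le>n. (of_nat (n choose i) * pochhammer M i * pochhammer d i * pochhammer E i * pochhammer X (n - i)) *
      (pochhammer (B - d) (n - i) * pochhammer (C - d) (n - i)))"
    by (intro sum.cong refl) (simp only: atMost_iff inner)
  finally show ?thesis by (simp add: mult_ac)
qed

text \<open>Whipple followed by Sears. In the application \<open>M\<close> is the negative integer
  \<open>- of_nat N\<close>, so the right-hand sum already stops at \<open>N\<close>.\<close>

lemma vwp_transformation:
  fixes a b c d e :: "'a::field_char_0"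
  assumes nz: "\<And>k. pochhammer a k \<noteq> 0"
    and b: "pochhammer (1 + a - b) n \<noteq> 0" and c: "pochhammer (1 + a - c) n \<noteq> 0"
    and d: "pochhammer (1 + a - d) n \<noteq> 0" and e: "pochhammer (1 + a - e) n \<noteq> 0"
    and M: "M = b + c + d + e - 1 - 2 * a - of_nat n"
  shows "(\<Sum>k\<le>n. vwp_weight a n k *
      (pochhammer b k * pochhammer c k * pochhammer d k * pochhammer e k /
       (pochhammer (1 + a - b) k * pochhammer (1 + a - c) k * pochhammer (1 + a - d) k * pochhammer (1 + a - e) k)))
    = (\<Sum>k\<le>n. of_nat (n choose k) * pochhammer M k * pochhammer d k * pochhammer (d - a - of_nat n) k *
        pochhammer (1 + a - d - e) (n - k) * pochhammer (1 + a - b - d) (n - k) * pochhammer (1 + a - c - d) (n - k))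
      / (pochhammer (1 + a - b) n * pochhammer (1 + a - c) n * pochhammer (1 + a - d) n * pochhammer (1 + a - e) n)"
proof -
  have "(\<Sum>k\<le>n. vwp_weight a n k *
      (pochhammer b k * pochhammer c k * pochhammer d k * pochhammer e k /
       (pochhammer (1 + a - b) k * pochhammer (1 + a - c) k * pochhammer (1 + a - d) k * pochhammer (1 + a - e) k)))
    = (\<Sum>k\<le>n. vwp_weight a n k *
      (pochhammer b k * pochhammer c k / (pochhammer (1 + a - b) k * pochhammer (1 + a - c) k)) *
      (pochhammer d k * pochhammer e k / (pochhammer (1 + a - d) k * pochhammer (1 + a - e) k)))"
    by (simp add: mult_ac)
  also have "\<dots> = (\<Sum>j\<le>n. of_nat (n choose j) *
        (pochhammer (1 + a - b - c) j / (pochhammer (1 + a - b) j * pochhammer (1 + a - c) j)) *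
        (pochhammer d j * pochhammer e j * pochhammer (1 + a - d - e) (n - j)))
      / (pochhammer (1 + a - d) n * pochhammer (1 + a - e) n)"
    by (rule whipple[OF nz b c d e])
  also have "(\<Sum>j\<le>n. of_nat (n choose j) *
        (pochhammer (1 + a - b - c) j / (pochhammer (1 + a - b) j * pochhammer (1 + a - c) j)) *
        (pochhammer d j * pochhammer e j * pochhammer (1 + a - d - e) (n - j)))
    = (\<Sum>j\<le>n. of_nat (n choose j) * pochhammer (1 + a - b - c) j * pochhammer d j * pochhammer e j *
      pochhammer (1 + a - d - e) (n - j) * pochhammer (1 + a - b + of_nat j) (n - j) * pochhammer (1 + a - c + of_nat j) (n - j))
      / (pochhammer (1 + a - b) n * pochhammer (1 + a - c) n)"
    unfolding sum_divide_distrib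
  proof (rule sum.cong[OF refl])
    fix j assume "j \<in> {..n}"
    then have j: "j \<le> n" by simp
    have "pochhammer (1 + a - b + of_nat j) (n - j) \<noteq> 0" "pochhammer (1 + a - c + of_nat j) (n - j) \<noteq> 0"
      using b c pochhammer_product[OF j] by (metis mult_eq_0_iff)+
    then show "of_nat (n choose j) *
        (pochhammer (1 + a - b - c) j / (pochhammer (1 + a - b) j * pochhammer (1 + a - c) j)) *
        (pochhammer d j * pochhammer e j * pochhammer (1 + a - d - e) (n - j))
      = of_nat (n choose j) * pochhammer (1 + a - b - c) j * pochhammer d j * pochhammer e j *
      pochhammer (1 + a - d - e) (n - j) * pochhammer (1 + a - b + of_nat j) (n - j) * pochhammer (1 + a - c + of_nat j) (n - j)
      / (pochhammer (1 + a - b) n * pochhammer (1 + a - c) n)"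
      unfolding pochhammer_product[OF j, of "1 + a - b"] pochhammer_product[OF j, of "1 + a - c"] by simp
  qed
  also have "(\<Sum>j\<le>n. of_nat (n choose j) * pochhammer (1 + a - b - c) j * pochhammer d j * pochhammer e j *
      pochhammer (1 + a - d - e) (n - j) * pochhammer (1 + a - b + of_nat j) (n - j) * pochhammer (1 + a - c + of_nat j) (n - j))
    = (\<Sum>k\<le>n. of_nat (n choose k) * pochhammer M k * pochhammer d k * pochhammer (d - a - of_nat n) k *
        pochhammer (1 + a - d - e) (n - k) * pochhammer (1 + a - b - d) (n - k) * pochhammer (1 + a - c - d) (n - k))"
    by (rule sears) (simp_all add: M)
  finally show ?thesis by (simp add: mult_ac)
qed

section \<open>Congruences between p-integral rationals\<close>

text \<open>The localization of the integers at \<open>p\<close>. All estimates take place in this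
  subring of the rationals, where division by units is ordinary division. The condition on
  \<open>b\<close> also excludes \<open>b = 0\<close>.\<close>

definition p_integral :: "nat \<Rightarrow> rat set" where
  "p_integral p = {x. \<exists>a b::int. \<not> int p dvd b \<and> x = of_int a / of_int b}"

definition rat_cong :: "nat \<Rightarrow> nat \<Rightarrow> rat \<Rightarrow> rat \<Rightarrow> bool" where
  "rat_cong p m x y \<longleftrightarrow> (\<exists>z\<in>p_integral p. x - y = of_nat p ^ m * z)"

definition p_unit :: "nat \<Rightarrow> rat \<Rightarrow> bool" where
  "p_unit p x \<longleftrightarrow> x \<noteq> 0 \<and> x \<in> p_integral p \<and> 1 / x \<in> p_integral p"

locale prime_localization =
  fixes p :: nat
  assumes prime_p: "prime p"
begin

abbreviation "Zp \<equiv> p_integral p"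
abbreviation pcong :: "rat \<Rightarrow> rat \<Rightarrow> nat \<Rightarrow> bool" (\<open>_ \<simeq> _ \<langle>_\<rangle>\<close> [51, 51, 0] 50)
  where "x \<simeq> y \<langle>m\<rangle> \<equiv> rat_cong p m x y"

lemma prime_int_p: "prime (int p)"
  using prime_p by simp

lemma p_pos: "p > 0"
  using prime_p prime_gt_0_nat by blast

lemma Zp_fraction: "\<not> int p dvd b \<Longrightarrow> of_int a / of_int b \<in> Zp"
  unfolding p_integral_def by blast

lemma Zp_of_int [simp]: "of_int a \<in> Zp"
  using Zp_fraction[of 1 a] prime_int_p not_prime_unit by auto

lemma Zp_of_nat [simp]: "of_nat a \<in> Zp"
  using Zp_of_int[of "int a"] by simp

lemma Zp_numeral [simp]: "numeral a \<in> Zp" "0 \<in> Zp" "1 \<in> Zp"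
  using Zp_of_nat[of "numeral a"] Zp_of_nat[of 0] Zp_of_nat[of 1] by simp_all

lemma Zp_add: assumes "x \<in> Zp" "y \<in> Zp" shows "x + y \<in> Zp"
proof -
  obtain a b c d where *: "\<not> int p dvd b" "x = of_int a / of_int b"
      "\<not> int p dvd d" "y = of_int c / of_int d"
    using assms unfolding p_integral_def by blast
  have "b \<noteq> 0" "d \<noteq> 0" using * by auto
  then have "x + y = of_int (a * d + c * b) / of_int (b * d)"
    using * by (simp add: field_simps)
  moreover have "\<not> int p dvd b * d" using * prime_int_p prime_dvd_mult_iff by blast
  ultimately show ?thesis using Zp_fraction by metis
qed

lemma Zp_mult: assumes "x \<in> Zp" "y \<in> Zp" shows "x * y \<in> Zp"
proof -
  obtain a b c d where *: "\<not> int p dvd b" "x = of_int a / of_int b"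
      "\<not> int p dvd d" "y = of_int c / of_int d"
    using assms unfolding p_integral_def by blast
  then have "x * y = of_int (a * c) / of_int (b * d)" by simp
  moreover have "\<not> int p dvd b * d" using * prime_int_p prime_dvd_mult_iff by blast
  ultimately show ?thesis using Zp_fraction by metis
qed

lemma Zp_minus: "x \<in> Zp \<Longrightarrow> - x \<in> Zp"
  using Zp_mult[OF Zp_of_int, of x "-1"] by simp

lemma Zp_minus_1 [simp]: "-1 \<in> Zp"
  using Zp_minus[of 1] by simp

lemma Zp_diff: "x \<in> Zp \<Longrightarrow> y \<in> Zp \<Longrightarrow> x - y \<in> Zp"
  using Zp_add[of x "- y"] Zp_minus[of y] by simp

lemma Zp_power: "x \<in> Zp \<Longrightarrow> x ^ k \<in> Zp"
  by (induction k) (auto intro: Zp_mult)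

lemma Zp_sum: "(\<And>i. i \<in> I \<Longrightarrow> f i \<in> Zp) \<Longrightarrow> sum f I \<in> Zp"
  by (induction I rule: infinite_finite_induct) (auto intro: Zp_add)

lemma Zp_prod: "(\<And>i. i \<in> I \<Longrightarrow> f i \<in> Zp) \<Longrightarrow> prod f I \<in> Zp"
  by (induction I rule: infinite_finite_induct) (auto intro: Zp_mult)

lemmas Zp_intros = Zp_add Zp_mult Zp_minus Zp_diff Zp_power Zp_sum Zp_prod

lemma Zp_pochhammer: "x \<in> Zp \<Longrightarrow> pochhammer x k \<in> Zp"
  unfolding pochhammer_prod by (intro Zp_intros) auto

lemma p_unit_Zp: "p_unit p x \<Longrightarrow> x \<in> Zp" "p_unit p x \<Longrightarrow> 1 / x \<in> Zp" "p_unit p x \<Longrightarrow> x \<noteq> 0"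
  by (auto simp: p_unit_def)

lemma p_unit_divide: "p_unit p x \<Longrightarrow> y \<in> Zp \<Longrightarrow> y / x \<in> Zp"
  using Zp_mult[of y "1 / x"] by (auto simp: p_unit_def)

lemma p_unit_of_int: "\<not> int p dvd a \<Longrightarrow> p_unit p (of_int a)"
  using Zp_fraction[of a 1] by (auto simp: p_unit_def)

lemma p_unit_of_nat: "\<not> p dvd a \<Longrightarrow> p_unit p (of_nat a)"
  using p_unit_of_int[of "int a"] by simp

lemma p_unit_fraction: "\<not> int p dvd a \<Longrightarrow> \<not> int p dvd b \<Longrightarrow> p_unit p (of_int a / of_int b)"
  using Zp_fraction[of b a] Zp_fraction[of a b] by (auto simp: p_unit_def)

lemma p_unit_1 [simp]: "p_unit p 1"
  by (simp add: p_unit_def)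

lemma p_unit_mult: "p_unit p x \<Longrightarrow> p_unit p y \<Longrightarrow> p_unit p (x * y)"
  using Zp_mult[of "1 / x" "1 / y"] by (auto simp: p_unit_def intro: Zp_mult)

lemma p_unit_inverse: "p_unit p x \<Longrightarrow> p_unit p (1 / x)"
  by (auto simp: p_unit_def)

lemma p_unit_minus: "p_unit p x \<Longrightarrow> p_unit p (- x)"
  using Zp_minus by (fastforce simp: p_unit_def)

lemma p_unit_power: "p_unit p x \<Longrightarrow> p_unit p (x ^ k)"
  by (induction k) (auto intro: p_unit_mult)

lemma p_unit_prod: "(\<And>i. i \<in> I \<Longrightarrow> p_unit p (f i)) \<Longrightarrow> p_unit p (prod f I)"
  by (induction I rule: infinite_finite_induct) (auto intro: p_unit_mult)

text \<open>Write \<open>y / u\<close> as a fraction with denominator \<open>b\<close>: the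
  numerator \<open>b + int p * a\<close> of \<open>1 + of_nat p * (y / u)\<close> is congruent to
  \<open>b\<close> modulo \<open>p\<close>, hence prime to \<open>p\<close>.\<close>

lemma p_unit_perturb:
  assumes "p_unit p u" "y \<in> Zp" shows "p_unit p (u + of_nat p * y)"
proof -
  have "y / u \<in> Zp" using assms by (rule p_unit_divide)
  then obtain a b where ab: "\<not> int p dvd b" "y / u = of_int a / of_int b"
    unfolding p_integral_def by blast
  have u: "u \<noteq> 0" using assms(1) by (simp add: p_unit_def)
  have "b \<noteq> 0" using ab by auto
  have "u + of_nat p * y = u * (1 + of_nat p * (y / u))"
    using u by (simp add: algebra_simps)
  also have "\<dots> = u * (of_int (b + int p * a) / of_int b)"
    unfolding ab(2) using \<open>b \<noteq> 0\<close> by (simp add: field_simps)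
  finally show ?thesis
    using p_unit_mult[OF assms(1) p_unit_fraction[of "b + int p * a" b]] ab(1)
    by (simp add: dvd_add_left_iff)
qed

lemma not_Zp_inverse_p: "\<not> p_unit p (of_nat p)"
proof
  assume "p_unit p (of_nat p)"
  then obtain a b where ab: "\<not> int p dvd b" "1 / of_nat p = (of_int a / of_int b :: rat)"
    unfolding p_unit_def p_integral_def by blast
  have "b \<noteq> 0" using ab by auto
  then have "of_int b = (of_int (a * int p) :: rat)" using ab(2) p_pos by (simp add: field_simps)
  then have "b = a * int p" using of_int_eq_iff by blast
  then show False using ab(1) by simp
qed

section \<open>Calculus of congruences modulo powers of p\<close>

lemma pcongI: "z \<in> Zp \<Longrightarrow> x - y = of_nat p ^ m * z \<Longrightarrow> x \<simeq> y \<langle>m\<rangle>"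
  unfolding rat_cong_def by blast

lemma pcong_refl [simp]: "x \<simeq> x \<langle>m\<rangle>"
  by (rule pcongI[of 0]) simp_all

lemma pcong_sym: "x \<simeq> y \<langle>m\<rangle> \<Longrightarrow> y \<simeq> x \<langle>m\<rangle>"
  unfolding rat_cong_def using Zp_minus by (metis minus_diff_eq mult_minus_right)

lemma pcong_add:
  assumes "x \<simeq> y \<langle>m\<rangle>" "z \<simeq> w \<langle>m\<rangle>" shows "x + z \<simeq> y + w \<langle>m\<rangle>"
proof -
  obtain u v where "u \<in> Zp" "v \<in> Zp" "x - y = of_nat p ^ m * u" "z - w = of_nat p ^ m * v"
    using assms unfolding rat_cong_def by blast
  then show ?thesis by (intro pcongI[of "u + v"] Zp_add) (auto simp: algebra_simps)
qed

lemma pcong_trans [trans]: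
  assumes "x \<simeq> y \<langle>m\<rangle>" "y \<simeq> z \<langle>m\<rangle>" shows "x \<simeq> z \<langle>m\<rangle>"
  using pcong_add[OF assms] unfolding rat_cong_def by simp

lemma pcong_eq_trans [trans]: "x \<simeq> y \<langle>m\<rangle> \<Longrightarrow> y = z \<Longrightarrow> x \<simeq> z \<langle>m\<rangle>"
  by simp

lemma eq_pcong_trans [trans]: "x = y \<Longrightarrow> y \<simeq> z \<langle>m\<rangle> \<Longrightarrow> x \<simeq> z \<langle>m\<rangle>"
  by simp

lemma pcong_lmult:
  assumes "x \<simeq> y \<langle>m\<rangle>" "z \<in> Zp" shows "z * x \<simeq> z * y \<langle>m\<rangle>"
proof -
  obtain u where "u \<in> Zp" "x - y = of_nat p ^ m * u" using assms unfolding rat_cong_def by blast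
  then show ?thesis
    by (intro pcongI[of "z * u"] Zp_mult assms(2)) (auto simp: algebra_simps simp flip: right_diff_distrib)
qed

lemma pcong_rmult: "x \<simeq> y \<langle>m\<rangle> \<Longrightarrow> z \<in> Zp \<Longrightarrow> x * z \<simeq> y * z \<langle>m\<rangle>"
  using pcong_lmult by (simp add: mult.commute)

lemma pcong_mult:
  assumes "x \<simeq> y \<langle>m\<rangle>" "z \<simeq> w \<langle>m\<rangle>" "z \<in> Zp" "y \<in> Zp" shows "x * z \<simeq> y * w \<langle>m\<rangle>"
  using pcong_trans[OF pcong_rmult[OF assms(1,3)] pcong_lmult[OF assms(2,4)]] .

lemma pcong_Zp: "x \<simeq> y \<langle>m\<rangle> \<Longrightarrow> y \<in> Zp \<Longrightarrow> x \<in> Zp"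
  unfolding rat_cong_def
  by (metis Zp_add Zp_mult Zp_of_nat Zp_power diff_add_cancel)

lemma pcong_minus: "x \<simeq> y \<langle>m\<rangle> \<Longrightarrow> - x \<simeq> - y \<langle>m\<rangle>"
  using pcong_lmult[OF _ Zp_of_int, of m x y "-1"] by simp

lemma pcong_diff: "x \<simeq> y \<langle>m\<rangle> \<Longrightarrow> z \<simeq> w \<langle>m\<rangle> \<Longrightarrow> x - z \<simeq> y - w \<langle>m\<rangle>"
  using pcong_add[OF _ pcong_minus] by fastforce

lemma pcong_sum: "(\<And>i. i \<in> I \<Longrightarrow> f i \<simeq> g i \<langle>m\<rangle>) \<Longrightarrow> sum f I \<simeq> sum g I \<langle>m\<rangle>"
  by (induction I rule: infinite_finite_induct) (auto intro: pcong_add)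

lemma pcong_prod:
  assumes "\<And>i. i \<in> I \<Longrightarrow> f i \<simeq> g i \<langle>m\<rangle>" "\<And>i. i \<in> I \<Longrightarrow> g i \<in> Zp"
  shows "prod f I \<simeq> prod g I \<langle>m\<rangle>"
  using assms
proof (induction I rule: infinite_finite_induct)
  case (insert x F)
  then have "prod f F \<simeq> prod g F \<langle>m\<rangle>" "prod g F \<in> Zp" by (auto intro: Zp_prod)
  then show ?case using insert by (auto intro!: pcong_mult dest: pcong_Zp)
qed auto

lemma pcong_power:
  assumes "x \<simeq> y \<langle>m\<rangle>" "y \<in> Zp" shows "x ^ k \<simeq> y ^ k \<langle>m\<rangle>"
  using pcong_prod[of "{..<k}" m "\<lambda>_. x" "\<lambda>_. y"] assms by simp

lemma pcong_mono:
  assumes "x \<simeq> y \<langle>m\<rangle>" "k \<le> m" shows "x \<simeq> y \<langle>k\<rangle>"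
proof -
  obtain u where "u \<in> Zp" "x - y = of_nat p ^ m * u" using assms unfolding rat_cong_def by blast
  then show ?thesis using assms(2)
    by (intro pcongI[of "of_nat p ^ (m - k) * u"] Zp_mult Zp_power)
      (auto simp: simp flip: power_add mult.assoc)
qed

lemma pcong_scale: "x \<simeq> y \<langle>m\<rangle> \<Longrightarrow> of_nat p ^ k * x \<simeq> of_nat p ^ k * y \<langle>k + m\<rangle>"
  unfolding rat_cong_def by (auto simp: power_add mult.assoc simp flip: right_diff_distrib)

lemma pcong_divide:
  assumes "x \<simeq> y \<langle>m\<rangle>" "p_unit p u" shows "x / u \<simeq> y / u \<langle>m\<rangle>"
  using pcong_lmult[OF assms(1) p_unit_Zp(2)[OF assms(2)]] by simp

lemma pcong_unit:
  assumes "x \<simeq> y \<langle>m\<rangle>" "p_unit p y" "m > 0" shows "p_unit p x"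
proof -
  obtain u where u: "u \<in> Zp" "x - y = of_nat p ^ m * u" using assms unfolding rat_cong_def by blast
  then have "x = y + of_nat p * (of_nat p ^ (m - 1) * u)"
    using assms(3) by (simp add: algebra_simps flip: power_eq_if)
     (metis One_nat_def Suc_pred add.commute diff_eq_eq power_Suc mult.left_commute)
  then show ?thesis
    using p_unit_perturb[OF assms(2), of "of_nat p ^ (m - 1) * u"] Zp_mult[OF Zp_power[OF Zp_of_nat] u(1)]
    by metis
qed

lemma pcong_inverse:
  assumes "x \<simeq> y \<langle>m\<rangle>" "p_unit p x" "p_unit p y" shows "1 / x \<simeq> 1 / y \<langle>m\<rangle>"
proof -
  have "(1 / x * (1 / y)) * y \<simeq> (1 / x * (1 / y)) * x \<langle>m\<rangle>"
    by (intro pcong_lmult pcong_sym[OF assms(1)] Zp_mult p_unit_Zp assms)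
  then show ?thesis using p_unit_Zp(3) assms by simp
qed

lemma pcong_cancel:
  assumes "u * x \<simeq> u * y \<langle>m\<rangle>" "p_unit p u" shows "x \<simeq> y \<langle>m\<rangle>"
  using pcong_divide[OF assms] p_unit_Zp(3)[OF assms(2)] by simp

lemma pcong_0_mult:
  assumes "x \<simeq> 0 \<langle>k\<rangle>" "y \<simeq> 0 \<langle>m\<rangle>" shows "x * y \<simeq> 0 \<langle>k + m\<rangle>"
proof -
  obtain u v where "u \<in> Zp" "v \<in> Zp" "x = of_nat p ^ k * u" "y = of_nat p ^ m * v"
    using assms unfolding rat_cong_def by auto
  then show ?thesis by (intro pcongI[of "u * v"] Zp_mult) (auto simp: power_add)
qed

lemma p_pcong_0: "y \<in> Zp \<Longrightarrow> of_nat p * y \<simeq> 0 \<langle>1\<rangle>"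
  by (intro pcongI) auto

section \<open>First-order expansions modulo the square of p\<close>

lemma prod_first_order:
  assumes "finite I" "\<And>i. i \<in> I \<Longrightarrow> p_unit p (u i)" "y \<simeq> 0 \<langle>1\<rangle>"
  shows "(\<Prod>i\<in>I. u i + y) \<simeq> (\<Prod>i\<in>I. u i) * (1 + y * (\<Sum>i\<in>I. 1 / u i)) \<langle>2\<rangle>"
  using assms(1,2)
proof (induction I)
  case (insert j I)
  have y: "y \<in> Zp" using assms(3) by (rule pcong_Zp) simp
  have yy: "y * y \<simeq> 0 \<langle>2\<rangle>" using pcong_0_mult[OF assms(3,3)] by (simp add: numeral_2_eq_2)
  define S P where "S = (\<Sum>i\<in>I. 1 / u i)" and "P = (\<Prod>i\<in>I. u i)"
  have S: "S \<in> Zp" and P: "P \<in> Zp" unfolding S_def P_def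
    using insert p_unit_Zp by (auto intro!: Zp_sum Zp_prod)
  have uj: "u j \<noteq> 0" "u j \<in> Zp" using insert p_unit_Zp by auto
  have "(u j + y) * (\<Prod>i\<in>I. u i + y) \<simeq> (u j + y) * (P * (1 + y * S)) \<langle>2\<rangle>"
    unfolding S_def P_def using insert uj y by (intro pcong_lmult Zp_add) auto
  also have "(u j + y) * (P * (1 + y * S)) = u j * P * (1 + y * (1 / u j + S)) + P * S * (y * y)"
    using uj by (simp add: field_simps)
  also have "\<dots> \<simeq> u j * P * (1 + y * (1 / u j + S)) + P * S * 0 \<langle>2\<rangle>"
    by (rule pcong_add[OF pcong_refl pcong_lmult[OF yy Zp_mult[OF P S]]])
  finally show ?case using insert by (simp add: S_def P_def)
qed simp

lemma pochhammer_first_order: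
  assumes "\<And>j. j < k \<Longrightarrow> p_unit p (z + of_nat j)" "y \<simeq> 0 \<langle>1\<rangle>"
  shows "pochhammer (z + y) k \<simeq> pochhammer z k * (1 + y * (\<Sum>j<k. 1 / (z + of_nat j))) \<langle>2\<rangle>"
  using prod_first_order[of "{..<k}" "\<lambda>j. z + of_nat j" y] assms
  by (simp add: pochhammer_prod lessThan_atLeast0 add_ac)

text \<open>\<open>first_order x A s\<close> records that \<open>x = A (1 + s)\<close> up to terms of second order in \<open>p\<close>.\<close>

definition first_order :: "rat \<Rightarrow> rat \<Rightarrow> rat \<Rightarrow> bool" where
  "first_order x A s \<longleftrightarrow> x \<simeq> A * (1 + s) \<langle>2\<rangle> \<and> A \<in> Zp \<and> s \<simeq> 0 \<langle>1\<rangle>"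

lemma first_order_mult:
  assumes "first_order x A s" "first_order y B t"
  shows "first_order (x * y) (A * B) (s + t)"
proof -
  have s: "s \<simeq> 0 \<langle>1\<rangle>" "t \<simeq> 0 \<langle>1\<rangle>" and AB: "A \<in> Zp" "B \<in> Zp"
    using assms by (auto simp: first_order_def)
  have Z: "s \<in> Zp" "t \<in> Zp" using s pcong_Zp by auto
  have "x * y \<simeq> (A * (1 + s)) * (B * (1 + t)) \<langle>2\<rangle>"
    using assms Z AB by (intro pcong_mult) (auto simp: first_order_def intro!: Zp_intros intro: pcong_Zp)
  also have "(A * (1 + s)) * (B * (1 + t)) = A * B * (1 + (s + t)) + A * B * (s * t)"
    by (simp add: algebra_simps)
  also have "\<dots> \<simeq> A * B * (1 + (s + t)) + A * B * 0 \<langle>2\<rangle>"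
    using pcong_0_mult[OF s] AB
    by (intro pcong_add[OF pcong_refl] pcong_lmult) (auto intro: Zp_intros simp: numeral_2_eq_2)
  finally show ?thesis
    using AB pcong_add[OF s] by (auto simp: first_order_def intro: Zp_intros)
qed

lemma first_order_const: "A \<in> Zp \<Longrightarrow> first_order A A 0"
  by (simp add: first_order_def)

lemma first_order_pochhammer:
  assumes "\<And>j. j < k \<Longrightarrow> p_unit p (z + of_nat j)" "z \<in> Zp" "y \<simeq> 0 \<langle>1\<rangle>"
  shows "first_order (pochhammer (z + y) k) (pochhammer z k) (y * (\<Sum>j<k. 1 / (z + of_nat j)))"
  unfolding first_order_def
proof (intro conjI)
  show "pochhammer z k \<in> Zp" by (rule Zp_pochhammer[OF assms(2)])
  have "(\<Sum>j<k. 1 / (z + of_nat j)) \<in> Zp" using assms(1) p_unit_Zp by (intro Zp_sum) auto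
  from pcong_rmult[OF assms(3) this] show "y * (\<Sum>j<k. 1 / (z + of_nat j)) \<simeq> 0 \<langle>1\<rangle>" by simp
qed (use pochhammer_first_order assms in auto)

lemma first_order_inverse:
  assumes "first_order x A s" "p_unit p A"
  shows "first_order (1 / x) (1 / A) (- s)" "p_unit p x"
proof -
  have s: "s \<simeq> 0 \<langle>1\<rangle>" and x: "x \<simeq> A * (1 + s) \<langle>2\<rangle>" using assms by (auto simp: first_order_def)
  have Z: "s \<in> Zp" using s pcong_Zp by auto
  have A0: "A \<noteq> 0" using assms(2) by (rule p_unit_Zp)
  have "1 + s \<simeq> 1 + 0 \<langle>1\<rangle>" by (intro pcong_add s) simp
  then have "A * (1 + s) \<simeq> A * 1 \<langle>1\<rangle>" using assms(2) p_unit_Zp by (intro pcong_lmult) auto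
  then have "x \<simeq> A \<langle>1\<rangle>" using pcong_trans[OF pcong_mono[OF x, of 1]] by simp
  from pcong_unit[OF this assms(2)] show u: "p_unit p x" by simp
  have "x * (1 / A * (1 - s)) \<simeq> (A * (1 + s)) * (1 / A * (1 - s)) \<langle>2\<rangle>"
    using Z p_unit_Zp(2)[OF assms(2)] by (intro pcong_rmult[OF x] Zp_intros) auto
  also have "(A * (1 + s)) * (1 / A * (1 - s)) = 1 - s * s" using A0 by (simp add: field_simps)
  also have "\<dots> \<simeq> 1 - 0 \<langle>2\<rangle>"
    using pcong_0_mult[OF s s] by (intro pcong_diff) (auto simp: numeral_2_eq_2)
  finally have "x * (1 / A * (1 - s)) \<simeq> x * (1 / x) \<langle>2\<rangle>" using p_unit_Zp(3)[OF u] by simp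
  from pcong_sym[OF pcong_cancel[OF this u]] show "first_order (1 / x) (1 / A) (- s)"
    using p_unit_Zp(2)[OF assms(2)] pcong_minus[OF s] by (simp add: first_order_def)
qed

end

section \<open>The deformed sum\<close>

locale perturbed_sum = prime_localization p for p +
  fixes r :: int and n :: nat
  assumes p_gt: "p > 3" and r_le: "r \<le> 1" and not3: "\<not> 3 dvd r"
    and n_eq: "3 * int n = 2 * int p - r" and p_ge: "int p \<ge> 3 - r"
begin

text \<open>With \<open>a = r / 3\<close> one has \<open>a = \<pi> - n\<close>: the upper parameter is a small perturbation of the
  negative integer \<open>-n\<close>.\<close>

definition a :: rat where "a = of_int r / 3"
definition \<pi> :: rat where "\<pi> = 2 * of_nat p / 3"

lemma a_plus_n: "a + of_nat n = \<pi>"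
proof -
  have "rat_of_int (3 * int n) = rat_of_int (2 * int p - r)" using n_eq by simp
  then show ?thesis by (simp add: a_def \<pi>_def field_simps)
qed

text \<open>These bounds make \<open>1\<close>, ..., \<open>n\<close> units and leave
  \<open>p\<close> itself as the only multiple of \<open>p\<close> between \<open>n + 1\<close> and
  \<open>2 * n\<close>.\<close>

lemma n_bounds: "n < p" "p < 2 * n" "2 * n < 2 * p" "n > 0"
  using n_eq p_ge r_le p_gt by auto

lemma p_unit_3: "p_unit p 3" and p_unit_2: "p_unit p 2"
proof -
  have "\<not> p dvd 3" "\<not> p dvd 2" using p_gt by (auto dest: dvd_imp_le)
  then show "p_unit p 3" "p_unit p 2" using p_unit_of_nat[of 3] p_unit_of_nat[of 2] by simp_all
qed

lemma \<pi>_small: "\<pi> \<simeq> 0 \<langle>1\<rangle>"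
  using p_pcong_0[OF p_unit_divide[OF p_unit_3, of 2]] by (simp add: \<pi>_def mult_ac)

lemma \<pi>_Zp: "\<pi> \<in> Zp"
  using \<pi>_small pcong_Zp by auto

lemma \<pi>_mult_small: "z \<in> Zp \<Longrightarrow> \<pi> * z \<simeq> 0 \<langle>1\<rangle>"
  using pcong_rmult[OF \<pi>_small] by simp

lemma a_Zp: "a \<in> Zp"
  using p_unit_divide[OF p_unit_3] by (simp add: a_def)

lemma p_unit_near: "p_unit p x \<Longrightarrow> y \<simeq> 0 \<langle>1\<rangle> \<Longrightarrow> p_unit p (x + y)"
  using pcong_unit[of 1 "x + y" x] pcong_add[OF pcong_refl[of 1 x]] by fastforce

lemma p_unit_a_plus: assumes "j < n" shows "p_unit p (a + of_nat j)"
proof -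
  have "a + of_nat j = - of_nat (n - j) + \<pi>"
    using a_plus_n assms by (simp add: of_nat_diff)
  moreover have "\<not> p dvd n - j" using assms n_bounds by (auto dest: dvd_imp_le)
  ultimately show ?thesis
    using p_unit_near[OF p_unit_minus[OF p_unit_of_nat] \<pi>_small] by simp
qed

lemma p_unit_1_plus: "j < n \<Longrightarrow> p_unit p (1 + of_nat j)"
proof -
  assume "j < n"
  then have "\<not> p dvd Suc j" using n_bounds by (auto dest: dvd_imp_le)
  from p_unit_of_nat[OF this] show "p_unit p (1 + of_nat j)" by simp
qed

text \<open>\<open>i0\<close> is the index of the only multiple of \<open>p\<close> among the factors of
  \<open>pochhammer (1 - a) (n - k)\<close>, for each \<open>k \<le> N\<close>.\<close>

definition N :: nat where "N = nat (1 - r)"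
definition i0 :: nat where "i0 = p - n - 1"

lemma int_N: "int N = 1 - r"
  using r_le by (simp add: N_def)

lemma N_le: "N \<le> n"
  using int_N n_eq p_ge p_gt by linarith

lemma i0_less: "k \<le> N \<Longrightarrow> i0 < n - k"
  using int_N n_eq p_ge p_gt n_bounds unfolding i0_def by linarith

lemma one_minus_a: "1 - a + of_nat i = of_nat (n + 1 + i) - \<pi>"
  using a_plus_n by (simp add: algebra_simps)

lemma one_minus_a_i0: "1 - a + of_nat i0 = of_nat p / 3"
  unfolding one_minus_a i0_def using n_bounds by (simp add: \<pi>_def field_simps of_nat_diff)

lemma p_unit_one_minus_a: assumes "i < n" "i \<noteq> i0" shows "p_unit p (1 - a + of_nat i)"
proof -
  have "\<not> p dvd n + 1 + i"
  proof
    assume "p dvd n + 1 + i"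
    then obtain q where q: "n + 1 + i = p * q" by auto
    then have "p * q < p * 2" using assms(1) n_bounds by linarith
    then have "q < 2" using p_pos by simp
    moreover have "q \<noteq> 0" using q by (intro notI) simp
    ultimately have "q = 1" by simp
    then show False using q assms n_bounds by (simp add: i0_def)
  qed
  from p_unit_near[OF p_unit_of_nat[OF this], of "- \<pi>"] show ?thesis
    unfolding one_minus_a using pcong_minus[OF \<pi>_small] by simp
qed

section \<open>The deformed sum and its closed form\<close>

text \<open>An upper parameter over its well-poised partner:
  \<open>1 + a - (a - x) = 1 + x\<close>.\<close>

definition \<phi> :: "nat \<Rightarrow> rat \<Rightarrow> rat" where
  "\<phi> k x = pochhammer (a - x) k / pochhammer (1 + x) k"

text \<open>The perturbed sum. One of the five parameters is \<open>\<pi>\<close>, so the summand vanishes for \<open>k > n\<close>;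
  the other four are integer multiples of \<open>\<pi>\<close>.\<close>

definition F :: "int \<Rightarrow> int \<Rightarrow> int \<Rightarrow> int \<Rightarrow> rat" where
  "F b c d e = (\<Sum>k\<le>n. (6 * of_nat k + of_int r) * pochhammer a k / pochhammer 1 k * \<phi> k \<pi> *
     \<phi> k (\<pi> * of_int b) * \<phi> k (\<pi> * of_int c) * \<phi> k (\<pi> * of_int d) * \<phi> k (\<pi> * of_int e))"

text \<open>The factors of \<open>pochhammer (1 - a + y) (n - k)\<close> that are units when
  \<open>y\<close> is divisible by \<open>p\<close>.\<close>

definition R :: "nat \<Rightarrow> rat \<Rightarrow> rat" where
  "R k y = (\<Prod>i\<in>{..<n - k} - {i0}. 1 - a + of_nat i + y)"

text \<open>The sum produced by \<open>vwp_transformation\<close> after the multiple of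
  \<open>p\<close> has been taken out of each of its three symbols of length
  \<open>n - k\<close>.\<close>

definition G :: "int \<Rightarrow> int \<Rightarrow> int \<Rightarrow> int \<Rightarrow> rat" where
  "G b c d e = (\<Sum>k\<le>N. of_nat (n choose k) * pochhammer (- of_nat N) k *
     pochhammer (a - \<pi> * of_int d) k * pochhammer (a - \<pi> * of_int (d + 1)) k *
     R k (\<pi> * of_int (d + e)) * R k (\<pi> * of_int (b + d)) * R k (\<pi> * of_int (c + d)))"

lemma pochhammer_a_nonzero: "pochhammer a k \<noteq> 0"
proof
  assume "pochhammer a k = 0"
  then obtain i where "a = - of_nat i" using pochhammer_eq_0_iff by metis
  then have "of_int r = (of_int (- 3 * int i) :: rat)" by (simp add: a_def field_simps)
  then have "r = - 3 * int i" using of_int_eq_iff by blast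
  then show False using not3 by simp
qed

lemma p_unit_pochhammer_1: assumes "y \<simeq> 0 \<langle>1\<rangle>" "k \<le> n" shows "p_unit p (pochhammer (1 + y) k)"
  unfolding pochhammer_prod
proof (rule p_unit_prod)
  fix i assume "i \<in> {0..<k}"
  then have "p_unit p (1 + of_nat i + y)" using assms by (intro p_unit_near p_unit_1_plus) auto
  then show "p_unit p (1 + y + of_nat i)" by (simp add: add_ac)
qed

lemma pochhammer_R:
  assumes "k \<le> N" shows "pochhammer (1 - a + y) (n - k) = (of_nat p / 3 + y) * R k y"
proof -
  have "pochhammer (1 - a + y) (n - k) = (\<Prod>i\<in>{..<n - k}. 1 - a + of_nat i + y)"
    by (simp add: pochhammer_prod lessThan_atLeast0 add_ac)
  also have "\<dots> = (1 - a + of_nat i0 + y) * R k y"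
    unfolding R_def using i0_less[OF assms] by (subst prod.remove[of _ i0]) auto
  finally show ?thesis by (simp only: one_minus_a_i0)
qed

lemma \<pi>_int_small: "\<pi> * of_int b \<simeq> 0 \<langle>1\<rangle>"
  by (rule \<pi>_mult_small) simp

text \<open>The four powers of \<open>p\<close> are the factor \<open>\<pi> = a + of_nat n\<close>
  of \<open>pochhammer a (Suc n)\<close> and one factor
  \<open>of_nat p / 3 + \<pi> * of_int i\<close> from each of the three symbols of length
  \<open>n - k\<close>.\<close>

lemma F_closed_form:
  assumes sum: "b + c + d + e = -1"
  shows "F b c d e = of_nat p ^ 4 * (2 / 27 * pochhammer a n) *
     of_int ((1 + 2 * (d + e)) * (1 + 2 * (b + d)) * (1 + 2 * (c + d))) * G b c d e /
     (pochhammer (1 + \<pi> * of_int b) n * pochhammer (1 + \<pi> * of_int c) n *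
      pochhammer (1 + \<pi> * of_int d) n * pochhammer (1 + \<pi> * of_int e) n)"
proof -
  define x where "x = (\<lambda>i::int. \<pi> * of_int i)"
  define D where "D = pochhammer (1 + x b) n * pochhammer (1 + x c) n * pochhammer (1 + x d) n * pochhammer (1 + x e) n"
  have nz: "pochhammer (1 + x i) k \<noteq> 0" if "k \<le> n" for i k
    using p_unit_pochhammer_1[OF \<pi>_int_small that] p_unit_Zp(3) unfolding x_def by blast
  have s: "1 + a - (a - x i) = 1 + x i" for i by simp
  have s3: "1 + x i - (a - x j) = 1 - a + \<pi> * of_int (i + j)" for i j
    by (simp add: x_def algebra_simps)
  have summand: "(6 * of_nat k + of_int r) * pochhammer a k / pochhammer 1 k * \<phi> k \<pi> * \<phi> k (x b) * \<phi> k (x c) * \<phi> k (x d) * \<phi> k (x e)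
    = 3 * pochhammer a n * \<pi> * (vwp_weight a n k *
      (pochhammer (a - x b) k * pochhammer (a - x c) k * pochhammer (a - x d) k * pochhammer (a - x e) k /
       (pochhammer (1 + x b) k * pochhammer (1 + x c) k * pochhammer (1 + x d) k * pochhammer (1 + x e) k)))"
    if k: "k \<le> n" for k
  proof -
    have p1: "pochhammer (a - \<pi>) k = (-1) ^ k * of_nat (n choose k) * fact k"
    proof -
      have "a - \<pi> = - of_nat n" using a_plus_n by simp
      moreover have "pochhammer (- of_nat n) k = (-1) ^ k * of_nat (n choose k) * (fact k :: rat)"
        by (simp add: binomial_gbinomial gbinomial_pochhammer)
      ultimately show ?thesis by simp
    qed
    have "pochhammer a (Suc (n + k)) = pochhammer a (Suc n) * pochhammer (a + of_nat (Suc n)) k"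
      using pochhammer_product'[of a "Suc n" k] by simp
    also have "\<dots> = pochhammer a n * \<pi> * pochhammer (1 + \<pi>) k"
      using a_plus_n by (simp add: pochhammer_Suc algebra_simps)
    finally have p2: "pochhammer a (Suc (n + k)) = pochhammer a n * \<pi> * pochhammer (1 + \<pi>) k" .
    define q where "q = a + 2 * of_nat k"
    have p3: "6 * of_nat k + of_int r = 3 * q" by (simp add: q_def a_def)
    have "\<pi> \<noteq> 0" using p_pos by (simp add: \<pi>_def)
    moreover have "pochhammer (1 + \<pi>) k \<noteq> 0" using nz[OF k, of 1] by (simp add: x_def)
    ultimately show ?thesis
      unfolding \<phi>_def p1 p3 vwp_weight_def p2 q_def[symmetric] using pochhammer_a_nonzero[of n]
      by (simp add: pochhammer_fact[symmetric] mult_ac)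
  qed
  \<comment> \<open>The zero-sum condition enters here: the parameter equals
    \<open>3 * a - 1\<close>, whatever the point.\<close>
  have M: "- of_nat N = (a - x b) + (a - x c) + (a - x d) + (a - x e) - 1 - 2 * a - of_nat n"
  proof -
    have "x b + x c + x d + x e = \<pi> * of_int (b + c + d + e)" by (simp add: x_def algebra_simps)
    then have "x b + x c + x d + x e = - \<pi>" unfolding sum by simp
    moreover have "of_nat N = 1 - 3 * a" using int_N a_def by (metis of_int_of_nat_eq of_int_diff of_int_1 nonzero_mult_div_cancel_left times_divide_eq_right zero_neq_numeral)
    ultimately show ?thesis using a_plus_n by (simp add: algebra_simps)
  qed
  have "F b c d e = 3 * pochhammer a n * \<pi> * (\<Sum>k\<le>n. vwp_weight a n k *
      (pochhammer (a - x b) k * pochhammer (a - x c) k * pochhammer (a - x d) k * pochhammer (a - x e) k /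
       (pochhammer (1 + x b) k * pochhammer (1 + x c) k * pochhammer (1 + x d) k * pochhammer (1 + x e) k)))"
    unfolding F_def sum_distrib_left
    by (intro sum.cong refl) (simp only: atMost_iff summand[unfolded x_def] x_def)
  also have "\<dots> = 3 * pochhammer a n * \<pi> * ((\<Sum>k\<le>n. of_nat (n choose k) * pochhammer (- of_nat N) k * pochhammer (a - x d) k * pochhammer (a - x d - a - of_nat n) k *
        pochhammer (1 - a + \<pi> * of_int (d + e)) (n - k) * pochhammer (1 - a + \<pi> * of_int (b + d)) (n - k) * pochhammer (1 - a + \<pi> * of_int (c + d)) (n - k)) / D)"
    using vwp_transformation[where a = a and b = "a - x b" and c = "a - x c" and d = "a - x d" and e = "a - x e" and n = n and M = "- of_nat N",
        OF pochhammer_a_nonzero _ _ _ _ M, unfolded s s3, OF nz nz nz nz]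
    unfolding D_def by simp
  also have "(\<Sum>k\<le>n. of_nat (n choose k) * pochhammer (- of_nat N) k * pochhammer (a - x d) k * pochhammer (a - x d - a - of_nat n) k *
        pochhammer (1 - a + \<pi> * of_int (d + e)) (n - k) * pochhammer (1 - a + \<pi> * of_int (b + d)) (n - k) * pochhammer (1 - a + \<pi> * of_int (c + d)) (n - k))
      = (\<Sum>k\<le>N. of_nat (n choose k) * pochhammer (- of_nat N) k * pochhammer (a - x d) k * pochhammer (a - x d - a - of_nat n) k *
        pochhammer (1 - a + \<pi> * of_int (d + e)) (n - k) * pochhammer (1 - a + \<pi> * of_int (b + d)) (n - k) * pochhammer (1 - a + \<pi> * of_int (c + d)) (n - k))"
    using N_le by (intro sum.mono_neutral_right) (auto simp: pochhammer_of_nat_eq_0_iff)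
  also have "\<dots> = (of_nat p / 3 + \<pi> * of_int (d + e)) * (of_nat p / 3 + \<pi> * of_int (b + d)) * (of_nat p / 3 + \<pi> * of_int (c + d)) * G b c d e"
    unfolding G_def sum_distrib_left
  proof (rule sum.cong[OF refl])
    fix k assume "k \<in> {..N}"
    then have k: "k \<le> N" by simp
    have "a - x d - a - of_nat n = a - \<pi> * of_int (d + 1)"
      using a_plus_n by (simp add: x_def algebra_simps)
    then show "of_nat (n choose k) * pochhammer (- of_nat N) k * pochhammer (a - x d) k * pochhammer (a - x d - a - of_nat n) k *
        pochhammer (1 - a + \<pi> * of_int (d + e)) (n - k) * pochhammer (1 - a + \<pi> * of_int (b + d)) (n - k) * pochhammer (1 - a + \<pi> * of_int (c + d)) (n - k)
      = (of_nat p / 3 + \<pi> * of_int (d + e)) * (of_nat p / 3 + \<pi> * of_int (b + d)) * (of_nat p / 3 + \<pi> * of_int (c + d)) *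
       (of_nat (n choose k) * pochhammer (- of_nat N) k *
     pochhammer (a - \<pi> * of_int d) k * pochhammer (a - \<pi> * of_int (d + 1)) k *
     R k (\<pi> * of_int (d + e)) * R k (\<pi> * of_int (b + d)) * R k (\<pi> * of_int (c + d)))"
      unfolding pochhammer_R[OF k] by (simp only: x_def mult_ac)
  qed
  also have "(of_nat p / 3 + \<pi> * of_int (d + e)) * (of_nat p / 3 + \<pi> * of_int (b + d)) * (of_nat p / 3 + \<pi> * of_int (c + d))
      = (of_nat p / 3) ^ 3 * of_int ((1 + 2 * (d + e)) * (1 + 2 * (b + d)) * (1 + 2 * (c + d)))"
  proof -
    have lin: "of_nat p / 3 + \<pi> * of_int i = of_nat p / 3 * of_int (1 + 2 * i)" for i
      by (simp add: \<pi>_def algebra_simps)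
    show ?thesis unfolding lin of_int_mult by (simp only: power3_eq_cube mult_ac)
  qed
  also have "3 * pochhammer a n * \<pi> * ((of_nat p / 3) ^ 3 * of_int ((1 + 2 * (d + e)) * (1 + 2 * (b + d)) * (1 + 2 * (c + d))) * G b c d e / D)
    = of_nat p ^ 4 * (2 / 27 * pochhammer a n) *
     of_int ((1 + 2 * (d + e)) * (1 + 2 * (b + d)) * (1 + 2 * (c + d))) * G b c d e / D"
    by (simp add: \<pi>_def power4_eq_xxxx power3_eq_cube del: of_int_mult of_int_add)
  finally show ?thesis by (simp only: D_def x_def)
qed

section \<open>First-order dependence of the closed form on the point\<close>

definition h :: "nat \<Rightarrow> rat" where "h k = (\<Sum>j<k. 1 / (a + of_nat j))"
definition H :: "nat \<Rightarrow> rat" where "H k = (\<Sum>i\<in>{..<n - k} - {i0}. 1 / (1 - a + of_nat i))"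
definition Hn :: rat where "Hn = (\<Sum>j<n. 1 / (1 + of_nat j))"
text \<open>The summand of \<open>G\<close> with all perturbations set to zero.\<close>

definition cc :: "nat \<Rightarrow> rat" where
  "cc k = of_nat (n choose k) * pochhammer (- of_nat N) k * (pochhammer a k)\<^sup>2 * R k 0 ^ 3"

lemma h_Zp: "k \<le> n \<Longrightarrow> h k \<in> Zp"
  unfolding h_def using p_unit_a_plus p_unit_Zp by (intro Zp_sum) auto

lemma H_Zp: "H k \<in> Zp"
  unfolding H_def using p_unit_one_minus_a p_unit_Zp by (intro Zp_sum) auto

lemma Hn_Zp: "Hn \<in> Zp"
  unfolding Hn_def using p_unit_1_plus p_unit_Zp by (intro Zp_sum) auto

lemma R_0_unit: "p_unit p (R k 0)"
  unfolding R_def using p_unit_one_minus_a by (intro p_unit_prod) auto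

lemma first_order_R:
  assumes "y \<simeq> 0 \<langle>1\<rangle>" shows "first_order (R k y) (R k 0) (y * H k)"
  unfolding first_order_def
proof (intro conjI)
  have "p_unit p (1 - a + of_nat i)" if "i \<in> {..<n - k} - {i0}" for i
    using that by (intro p_unit_one_minus_a) auto
  from prod_first_order[OF _ this assms, of "{..<n - k} - {i0}" "\<lambda>i. i"] show "R k y \<simeq> R k 0 * (1 + y * H k) \<langle>2\<rangle>"
    by (simp add: R_def H_def)
  show "R k 0 \<in> Zp" using R_0_unit p_unit_Zp by blast
  show "y * H k \<simeq> 0 \<langle>1\<rangle>" using pcong_rmult[OF assms H_Zp] by simp
qed

lemma first_order_a:
  assumes "y \<simeq> 0 \<langle>1\<rangle>" "k \<le> n" shows "first_order (pochhammer (a + y) k) (pochhammer a k) (y * h k)"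
  unfolding h_def using assms p_unit_a_plus a_Zp by (intro first_order_pochhammer) auto

lemma first_order_1:
  assumes "y \<simeq> 0 \<langle>1\<rangle>" shows "first_order (pochhammer (1 + y) n) (pochhammer 1 n) (y * Hn)"
  unfolding Hn_def using assms p_unit_1_plus by (intro first_order_pochhammer) auto

text \<open>By the zero-sum condition the arguments of the three \<open>R\<close> factors add up to
  \<open>\<pi> * of_int (2 * d - 1)\<close>, so only the distinguished parameter \<open>d\<close>
  survives to first order.\<close>

lemma G_expansion:
  assumes sum: "b + c + d + e = -1"
  shows "G b c d e \<simeq> (\<Sum>k\<le>N. cc k) + 2 * of_int d * (\<pi> * (\<Sum>k\<le>N. cc k * (H k - h k)))
     - \<pi> * (\<Sum>k\<le>N. cc k * (h k + H k)) \<langle>2\<rangle>"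
proof -
  have "G b c d e \<simeq> (\<Sum>k\<le>N. cc k * (1 + (2 * of_int d * (\<pi> * (H k - h k)) - \<pi> * (h k + H k)))) \<langle>2\<rangle>"
    unfolding G_def
  proof (rule pcong_sum)
    fix k assume "k \<in> {..N}"
    then have k: "k \<le> n" using N_le by simp
    have m: "- (\<pi> * of_int i) \<simeq> 0 \<langle>1\<rangle>" for i using pcong_minus[OF \<pi>_int_small] by simp
    have A: "first_order (pochhammer (a - \<pi> * of_int i) k) (pochhammer a k) (- (\<pi> * of_int i) * h k)" for i
      using first_order_a[OF m k, of i] by simp
    have C: "of_nat (n choose k) * pochhammer (- of_nat N) k \<in> Zp"
      by (intro Zp_mult Zp_pochhammer Zp_minus) auto
    have "first_order (of_nat (n choose k) * pochhammer (- of_nat N) k *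
       pochhammer (a - \<pi> * of_int d) k * pochhammer (a - \<pi> * of_int (d + 1)) k *
       R k (\<pi> * of_int (d + e)) * R k (\<pi> * of_int (b + d)) * R k (\<pi> * of_int (c + d)))
       (of_nat (n choose k) * pochhammer (- of_nat N) k * pochhammer a k * pochhammer a k * R k 0 * R k 0 * R k 0)
       (0 + - (\<pi> * of_int d) * h k + - (\<pi> * of_int (d + 1)) * h k + \<pi> * of_int (d + e) * H k +
         \<pi> * of_int (b + d) * H k + \<pi> * of_int (c + d) * H k)"
      by (intro first_order_mult first_order_const C A first_order_R \<pi>_int_small)
    moreover have "of_nat (n choose k) * pochhammer (- of_nat N) k * pochhammer a k * pochhammer a k * R k 0 * R k 0 * R k 0 = cc k"
      by (simp add: cc_def power2_eq_square power3_eq_cube)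
    moreover have "0 + - (\<pi> * of_int d) * h k + - (\<pi> * of_int (d + 1)) * h k + \<pi> * of_int (d + e) * H k +
         \<pi> * of_int (b + d) * H k + \<pi> * of_int (c + d) * H k
        = 2 * of_int d * (\<pi> * (H k - h k)) - \<pi> * (h k + H k)"
    proof -
      have "e = -1 - b - c - d" using sum by simp
      show ?thesis unfolding \<open>e = _\<close> by (simp add: algebra_simps)
    qed
    ultimately show "of_nat (n choose k) * pochhammer (- of_nat N) k *
       pochhammer (a - \<pi> * of_int d) k * pochhammer (a - \<pi> * of_int (d + 1)) k *
       R k (\<pi> * of_int (d + e)) * R k (\<pi> * of_int (b + d)) * R k (\<pi> * of_int (c + d)) \<simeq>
       cc k * (1 + (2 * of_int d * (\<pi> * (H k - h k)) - \<pi> * (h k + H k))) \<langle>2\<rangle>"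
      by (simp add: first_order_def)
  qed
  also have "(\<Sum>k\<le>N. cc k * (1 + (2 * of_int d * (\<pi> * (H k - h k)) - \<pi> * (h k + H k))))
    = (\<Sum>k\<le>N. cc k) + 2 * of_int d * (\<pi> * (\<Sum>k\<le>N. cc k * (H k - h k)))
     - \<pi> * (\<Sum>k\<le>N. cc k * (h k + H k))"
    unfolding sum_distrib_left sum.distrib[symmetric] sum_subtractf[symmetric]
    by (intro sum.cong refl) (simp add: algebra_simps)
  finally show ?thesis .
qed

definition Q :: "int \<Rightarrow> int \<Rightarrow> int \<Rightarrow> int \<Rightarrow> rat" where
  "Q b c d e = G b c d e *
     (1 / (pochhammer (1 + \<pi> * of_int b) n * pochhammer (1 + \<pi> * of_int c) n *
      pochhammer (1 + \<pi> * of_int d) n * pochhammer (1 + \<pi> * of_int e) n))"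

definition U :: rat where "U = 1 / pochhammer 1 n ^ 4 * (1 + \<pi> * Hn)"

lemma p_unit_pochhammer_1n: "p_unit p (pochhammer 1 n)"
  using p_unit_pochhammer_1[of 0 n] by simp

lemma U_unit: "p_unit p U"
  unfolding U_def using p_unit_pochhammer_1n p_unit_inverse[OF p_unit_power[OF p_unit_pochhammer_1n]]
  by (intro p_unit_mult p_unit_near p_unit_1 \<pi>_mult_small Hn_Zp) simp

lemma R_Zp: "y \<in> Zp \<Longrightarrow> R k y \<in> Zp"
  unfolding R_def by (intro Zp_prod Zp_add Zp_diff a_Zp) auto

lemma G_Zp: "G b c d e \<in> Zp"
  unfolding G_def
  by (intro Zp_sum Zp_mult Zp_pochhammer Zp_diff R_Zp a_Zp \<pi>_Zp Zp_minus Zp_of_int Zp_of_nat)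

text \<open>The first-order terms of the four denominators add up to \<open>- \<pi> * Hn\<close> at
  every zero-sum point, so the denominators contribute the same unit \<open>U\<close>
  everywhere.\<close>

lemma Q_expansion:
  assumes sum: "b + c + d + e = -1"
  shows "Q b c d e \<simeq> U * G b c d e \<langle>2\<rangle>"
proof -
  have f: "first_order (pochhammer (1 + \<pi> * of_int b) n * pochhammer (1 + \<pi> * of_int c) n *
      pochhammer (1 + \<pi> * of_int d) n * pochhammer (1 + \<pi> * of_int e) n)
      (pochhammer 1 n * pochhammer 1 n * pochhammer 1 n * pochhammer 1 n)
      (\<pi> * of_int b * Hn + \<pi> * of_int c * Hn + \<pi> * of_int d * Hn + \<pi> * of_int e * Hn)"
    by (intro first_order_mult first_order_1 \<pi>_int_small)
  have "e = -1 - b - c - d" using sum by simp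
  have s: "- (\<pi> * of_int b * Hn + \<pi> * of_int c * Hn + \<pi> * of_int d * Hn + \<pi> * of_int e * Hn) = \<pi> * Hn"
    unfolding \<open>e = _\<close> by (simp add: algebra_simps)
  have "p_unit p (pochhammer 1 n * pochhammer 1 n * pochhammer 1 n * pochhammer 1 n)"
    by (intro p_unit_mult p_unit_pochhammer_1n)
  from first_order_inverse(1)[OF f this]
  have "1 / (pochhammer (1 + \<pi> * of_int b) n * pochhammer (1 + \<pi> * of_int c) n *
      pochhammer (1 + \<pi> * of_int d) n * pochhammer (1 + \<pi> * of_int e) n) \<simeq> U \<langle>2\<rangle>"
    unfolding s by (simp only: first_order_def U_def power4_eq_xxxx)
  from pcong_lmult[OF this G_Zp] show ?thesis unfolding Q_def by (simp only: mult.commute)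
qed

lemma F_Q:
  assumes "b + c + d + e = -1"
  shows "F b c d e = of_nat p ^ 4 * (2 / 27 * pochhammer a n) *
     of_int ((1 + 2 * (d + e)) * (1 + 2 * (b + d)) * (1 + 2 * (c + d))) * Q b c d e"
  unfolding F_closed_form[OF assms] Q_def by simp

text \<open>The distinguished parameter \<open>d\<close> breaks the symmetry of the closed form, while the sum itself
  is symmetric; comparing two choices of \<open>d\<close> shows that the part of the first-order term depending
  on \<open>d\<close> vanishes.\<close>

lemma linear_term_vanishes: "\<pi> * (\<Sum>k\<le>N. cc k * (H k - h k)) \<simeq> 0 \<langle>2\<rangle>"
proof -
  define X where "X = \<pi> * (\<Sum>k\<le>N. cc k * (H k - h k))"
  define C where "C = (\<Sum>k\<le>N. cc k)"
  define D where "D = \<pi> * (\<Sum>k\<le>N. cc k * (h k + H k))"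
  have "F 0 0 (-1) 0 = F (-1) 0 0 0"
    unfolding F_def by (simp only: mult_ac)
  \<comment> \<open>At both points the product of the three linear factors in \<open>F_Q\<close> is
    \<open>-1\<close>, so equality of the sums passes to \<open>Q\<close>.\<close>
  then have eq: "Q 0 0 (-1) 0 = Q (-1) 0 0 0"
    using pochhammer_a_nonzero[of n] p_pos by (simp add: F_Q)
  have "Q 0 0 (-1) 0 \<simeq> U * G 0 0 (-1) 0 \<langle>2\<rangle>" "Q (-1) 0 0 0 \<simeq> U * G (-1) 0 0 0 \<langle>2\<rangle>"
    by (rule Q_expansion; simp)+
  from pcong_trans[OF pcong_sym[OF this(1)] this(2)[folded eq]]
  have "U * G 0 0 (-1) 0 \<simeq> U * G (-1) 0 0 0 \<langle>2\<rangle>" .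
  then have "G 0 0 (-1) 0 \<simeq> G (-1) 0 0 0 \<langle>2\<rangle>" by (rule pcong_cancel[OF _ U_unit])
  moreover have "G 0 0 (-1) 0 \<simeq> C + 2 * of_int (-1) * X - D \<langle>2\<rangle>" "G (-1) 0 0 0 \<simeq> C + 2 * of_int 0 * X - D \<langle>2\<rangle>"
    unfolding X_def C_def D_def by (rule G_expansion; simp)+
  ultimately have "C + 2 * of_int (-1) * X - D \<simeq> C + 2 * of_int 0 * X - D \<langle>2\<rangle>"
    using pcong_trans pcong_sym by blast
  from pcong_diff[OF this pcong_refl[of 2 "C - D"]] have "- 2 * X \<simeq> - 2 * 0 \<langle>2\<rangle>" by simp
  then show ?thesis unfolding X_def by (rule pcong_cancel[OF _ p_unit_minus[OF p_unit_2]])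
qed

section \<open>Identification of the short sum\<close>

text \<open>The product of \<open>l - 2 * \<pi>\<close> over \<open>n < l \<le> 2 * n\<close> with
  \<open>l \<noteq> p\<close>. Its cube becomes the common factor of the short sum.\<close>

definition Y :: rat where "Y = R 0 (- \<pi>)"
definition F0 :: rat where
  "F0 = (\<Sum>k\<le>N. pochhammer (- of_nat N) k * pochhammer a k ^ 3 / (pochhammer 1 k * pochhammer (2 * a) k ^ 3))"

lemma minus_\<pi>_small: "- \<pi> \<simeq> 0 \<langle>1\<rangle>"
  using pcong_minus[OF \<pi>_small] by simp

lemma p_unit_2a:
  assumes "j < N" shows "p_unit p (2 * a + of_nat j)"
proof -
  define i where "i = n - 1 - j"
  have i: "i < n" "i \<noteq> i0" using i0_less[of N] assms N_le by (auto simp: i_def)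
  have eq: "2 * a + of_nat j = - (1 - a + of_nat i + - \<pi>)"
    using assms N_le a_plus_n by (simp add: i_def of_nat_diff algebra_simps)
  from p_unit_minus[OF p_unit_near[OF p_unit_one_minus_a[OF i] minus_\<pi>_small]]
  show ?thesis unfolding eq .
qed

text \<open>The factors of \<open>Y\<close> that are missing from \<open>R k (- \<pi>)\<close> are,
  read from the top, the negatives of \<open>2 * a\<close>, \<open>2 * a + 1\<close>, and so on.
  This is the origin of the lower parameter \<open>2 * a\<close> on the right-hand side.\<close>

lemma R_neg_\<pi>: assumes "k \<le> N" shows "R k (- \<pi>) * ((-1) ^ k * pochhammer (2 * a) k) = Y"
proof -
  have kn: "k \<le> n" using assms N_le by simp
  have "(\<Prod>i\<in>{n - k..<n}. 1 - a + of_nat i - \<pi>) = (\<Prod>j\<in>{..<k}. - (2 * a + of_nat j))"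
  proof (rule prod.reindex_bij_witness[of _ "\<lambda>j. n - 1 - j" "\<lambda>i. n - 1 - i"])
    fix i assume i: "i \<in> {n - k..<n}"
    have "a + of_nat n - \<pi> = 0" using a_plus_n by simp
    then show "- (2 * a + of_nat (n - 1 - i)) = 1 - a + of_nat i - \<pi>"
      using i by (simp add: of_nat_diff algebra_simps)
  qed (use kn in auto)
  also have "\<dots> = (-1) ^ k * pochhammer (2 * a) k"
    by (simp only: prod_uminus card_lessThan pochhammer_prod lessThan_atLeast0 card_atLeastLessThan minus_nat.diff_0)
  finally have 1: "(\<Prod>i\<in>{n - k..<n}. 1 - a + of_nat i - \<pi>) = (-1) ^ k * pochhammer (2 * a) k" .
  have "{..<n} - {i0} = ({..<n - k} - {i0}) \<union> {n - k..<n}" using i0_less[OF assms] by auto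
  moreover have "({..<n - k} - {i0}) \<inter> {n - k..<n} = {}" by auto
  ultimately have "Y = R k (- \<pi>) * (\<Prod>i\<in>{n - k..<n}. 1 - a + of_nat i - \<pi>)"
    unfolding Y_def R_def by (simp add: prod.union_disjoint)
  then show ?thesis unfolding 1 by simp
qed

lemma pochhammer_1_unit_le: "k \<le> n \<Longrightarrow> p_unit p (pochhammer 1 k)"
  using p_unit_pochhammer_1[of 0 k] by simp

text \<open>The term with \<open>h\<close> turns the binomial coefficient into
  \<open>pochhammer a k / pochhammer 1 k\<close> up to sign, and the term with \<open>H\<close>
  turns each \<open>R k 0\<close> into \<open>R k (- \<pi>)\<close>.\<close>

lemma cc_corrected:
  assumes k: "k \<le> N"
  shows "cc k * (1 + (\<pi> * h k - 3 * (\<pi> * H k))) \<simeq>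
    Y ^ 3 * (pochhammer (- of_nat N) k * pochhammer a k ^ 3 / (pochhammer 1 k * pochhammer (2 * a) k ^ 3)) \<langle>2\<rangle>"
proof -
  have kn: "k \<le> n" using k N_le by simp
  have u1: "p_unit p (pochhammer 1 k)" by (rule pochhammer_1_unit_le[OF kn])
  have "a - \<pi> = - of_nat n" using a_plus_n by simp
  then have ch: "of_nat (n choose k) = (-1) ^ k / pochhammer 1 k * pochhammer (a + - \<pi>) k"
    by (simp add: binomial_gbinomial gbinomial_pochhammer pochhammer_fact)
  have c1: "(-1) ^ k / pochhammer 1 k \<in> Zp"
    by (intro p_unit_divide[OF u1] Zp_power) simp
  have f1: "first_order (of_nat (n choose k)) ((-1) ^ k / pochhammer 1 k * pochhammer a k) (0 + - \<pi> * h k)"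
    unfolding ch by (intro first_order_mult first_order_const c1 first_order_a minus_\<pi>_small kn)
  have small: "\<pi> * h k - 3 * (\<pi> * H k) \<simeq> 0 \<langle>1\<rangle>"
    using pcong_diff[OF \<pi>_mult_small[OF h_Zp[OF kn]] pcong_lmult[OF \<pi>_mult_small[OF H_Zp[of k]], of 3]] by simp
  have f2: "first_order (1 + (\<pi> * h k - 3 * (\<pi> * H k))) 1 (\<pi> * h k - 3 * (\<pi> * H k))"
    using small by (simp add: first_order_def)
  have C: "pochhammer (- of_nat N) k * (pochhammer a k)\<^sup>2 * R k 0 ^ 3 \<in> Zp"
    using R_0_unit p_unit_Zp a_Zp by (auto intro!: Zp_mult Zp_power Zp_pochhammer Zp_minus)
  have "first_order (of_nat (n choose k) * (1 + (\<pi> * h k - 3 * (\<pi> * H k))) *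
      (pochhammer (- of_nat N) k * (pochhammer a k)\<^sup>2 * R k 0 ^ 3))
      ((-1) ^ k / pochhammer 1 k * pochhammer a k * 1 * (pochhammer (- of_nat N) k * (pochhammer a k)\<^sup>2 * R k 0 ^ 3))
      (0 + - \<pi> * h k + (\<pi> * h k - 3 * (\<pi> * H k)) + 0)"
    by (intro first_order_mult f1 f2 first_order_const C)
  moreover have "of_nat (n choose k) * (1 + (\<pi> * h k - 3 * (\<pi> * H k))) *
      (pochhammer (- of_nat N) k * (pochhammer a k)\<^sup>2 * R k 0 ^ 3) = cc k * (1 + (\<pi> * h k - 3 * (\<pi> * H k)))"
    by (simp only: cc_def mult_ac)
  moreover have "(-1) ^ k / pochhammer 1 k * pochhammer a k * 1 * (pochhammer (- of_nat N) k * (pochhammer a k)\<^sup>2 * R k 0 ^ 3)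
      = ((-1) ^ k / pochhammer 1 k * pochhammer (- of_nat N) k * pochhammer a k ^ 3) * R k 0 ^ 3"
  proof -
    have "v * P * 1 * (M * P\<^sup>2 * S) = v * M * P ^ 3 * S" for v P M S :: rat
      by (simp add: power2_eq_square power3_eq_cube)
    then show ?thesis .
  qed
  moreover have "0 + - \<pi> * h k + (\<pi> * h k - 3 * (\<pi> * H k)) + 0 = - 3 * (\<pi> * H k)" by simp
  ultimately have "cc k * (1 + (\<pi> * h k - 3 * (\<pi> * H k))) \<simeq>
     ((-1) ^ k / pochhammer 1 k * pochhammer (- of_nat N) k * pochhammer a k ^ 3) *
       (R k 0 ^ 3 * (1 - 3 * (\<pi> * H k))) \<langle>2\<rangle>"
    by (simp only: first_order_def) (simp add: mult.assoc)
  also have "\<dots> \<simeq> ((-1) ^ k / pochhammer 1 k * pochhammer (- of_nat N) k * pochhammer a k ^ 3) * R k (- \<pi>) ^ 3 \<langle>2\<rangle>"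
  proof (intro pcong_lmult)
    have "first_order (R k (- \<pi>) * R k (- \<pi>) * R k (- \<pi>)) (R k 0 * R k 0 * R k 0) (- \<pi> * H k + - \<pi> * H k + - \<pi> * H k)"
      by (intro first_order_mult first_order_R minus_\<pi>_small)
    moreover have "1 + (- \<pi> * H k + - \<pi> * H k + - \<pi> * H k) = 1 - 3 * (\<pi> * H k)" by simp
    ultimately have "R k (- \<pi>) ^ 3 \<simeq> R k 0 ^ 3 * (1 - 3 * (\<pi> * H k)) \<langle>2\<rangle>"
      by (simp only: first_order_def power3_eq_cube)
    then show "R k 0 ^ 3 * (1 - 3 * (\<pi> * H k)) \<simeq> R k (- \<pi>) ^ 3 \<langle>2\<rangle>"
      by (rule pcong_sym)
  next
    show "(-1) ^ k / pochhammer 1 k * pochhammer (- of_nat N) k * pochhammer a k ^ 3 \<in> Zp"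
      using c1 a_Zp by (intro Zp_mult Zp_power Zp_pochhammer Zp_minus) auto
  qed
  also have "((-1) ^ k / pochhammer 1 k * pochhammer (- of_nat N) k * pochhammer a k ^ 3) * R k (- \<pi>) ^ 3
     = Y ^ 3 * (pochhammer (- of_nat N) k * pochhammer a k ^ 3 / (pochhammer 1 k * pochhammer (2 * a) k ^ 3))"
  proof -
    have "pochhammer (2 * a) k \<noteq> 0"
      unfolding pochhammer_prod using p_unit_Zp(3)[OF p_unit_2a] k by (auto simp: prod_zero_iff)
    moreover have "(-1) ^ k * (-1) ^ k * (-1) ^ k = ((-1) ^ k :: rat)" by simp
    ultimately show ?thesis
      unfolding R_neg_\<pi>[OF k, symmetric] by (simp add: power_mult_distrib power3_eq_cube mult_ac)
  qed
  finally show ?thesis .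
qed

lemma G_cong:
  assumes sum: "b + c + d + e = -1" shows "G b c d e \<simeq> Y ^ 3 * F0 \<langle>2\<rangle>"
proof -
  define X where "X = \<pi> * (\<Sum>k\<le>N. cc k * (H k - h k))"
  define C where "C = (\<Sum>k\<le>N. cc k)"
  define D where "D = \<pi> * (\<Sum>k\<le>N. cc k * (h k + H k))"
  have X: "X \<simeq> 0 \<langle>2\<rangle>" unfolding X_def by (rule linear_term_vanishes)
  have "G b c d e \<simeq> C + 2 * of_int d * X - D \<langle>2\<rangle>"
    unfolding X_def C_def D_def by (rule G_expansion[OF sum])
  also have "C + 2 * of_int d * X - D \<simeq> C + 2 * of_int d * 0 - D \<langle>2\<rangle>"
    by (intro pcong_diff pcong_add pcong_lmult X Zp_mult pcong_refl) simp_all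
  \<comment> \<open>As \<open>X\<close> vanishes modulo \<open>p ^ 2\<close>, \<open>2 * X\<close>
    may be subtracted; this changes the correction \<open>- \<pi> * (h k + H k)\<close> into the one
    required by \<open>cc_corrected\<close>.\<close>
  also have "C + 2 * of_int d * 0 - D = C + 2 * of_int d * 0 - D - 2 * 0" by simp
  also have "C + 2 * of_int d * 0 - D - 2 * 0 \<simeq> C + 2 * of_int d * 0 - D - 2 * X \<langle>2\<rangle>"
    by (intro pcong_diff pcong_lmult pcong_sym[OF X]) auto
  also have "C + 2 * of_int d * 0 - D - 2 * X = (\<Sum>k\<le>N. cc k * (1 + (\<pi> * h k - 3 * (\<pi> * H k))))"
    unfolding X_def C_def D_def mult_zero_right add_0_right sum_distrib_left sum_subtractf[symmetric]
    by (intro sum.cong refl) (simp add: algebra_simps)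
  also have "\<dots> \<simeq> (\<Sum>k\<le>N. Y ^ 3 * (pochhammer (- of_nat N) k * pochhammer a k ^ 3 / (pochhammer 1 k * pochhammer (2 * a) k ^ 3))) \<langle>2\<rangle>"
    by (intro pcong_sum cc_corrected) auto
  finally show ?thesis by (simp add: F0_def sum_distrib_left)
qed

definition W :: rat where "W = 2 / 27 * ((-1) ^ n * (Y / pochhammer 1 n) ^ 3 * F0)"

lemma p_unit_Y: "p_unit p Y"
  unfolding Y_def using first_order_R[OF minus_\<pi>_small, of 0] R_0_unit first_order_inverse(2) by blast

lemma F0_Zp: "F0 \<in> Zp"
  unfolding F0_def
proof (intro Zp_sum p_unit_divide p_unit_mult p_unit_power Zp_mult Zp_power Zp_pochhammer Zp_minus a_Zp)
  fix k assume k: "k \<in> {..N}"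
  then show "p_unit p (pochhammer 1 k)" using pochhammer_1_unit_le N_le by auto
  show "p_unit p (pochhammer (2 * a) k)"
    unfolding pochhammer_prod using p_unit_2a k by (intro p_unit_prod) auto
qed auto

lemma p_unit_27: "p_unit p 27"
  using p_unit_power[OF p_unit_3, of 3] by simp

lemma W_Zp: "W \<in> Zp"
  unfolding W_def
  by (intro Zp_mult Zp_power p_unit_divide p_unit_27 p_unit_pochhammer_1n p_unit_Zp(1)[OF p_unit_Y] F0_Zp Zp_minus) auto

lemma F_cong:
  assumes sum: "b + c + d + e = -1"
  shows "F b c d e \<simeq> of_nat p ^ 4 * (W * of_int ((1 + 2 * (d + e)) * (1 + 2 * (b + d)) * (1 + 2 * (c + d)))) \<langle>6\<rangle>"
proof -
  define P :: rat where "P = of_int ((1 + 2 * (d + e)) * (1 + 2 * (b + d)) * (1 + 2 * (c + d)))"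
  \<comment> \<open>Reversal brings in \<open>pochhammer (1 + - \<pi>) n\<close>, whose first-order
    term cancels the one in \<open>U\<close>.\<close>
  have an: "pochhammer a n = (-1) ^ n * pochhammer (1 + - \<pi>) n"
  proof -
    have "1 - a - of_nat n = 1 + - \<pi>" using a_plus_n by simp
    then have "pochhammer (1 + - \<pi>) n = (-1) ^ n * pochhammer a n"
      using pochhammer_reflect[of a n] by metis
    then show ?thesis by simp
  qed
  have f2: "first_order (1 + \<pi> * Hn) 1 (\<pi> * Hn)"
    using \<pi>_mult_small[OF Hn_Zp] by (simp add: first_order_def)
  have "first_order (pochhammer (1 + - \<pi>) n * (1 + \<pi> * Hn)) (pochhammer 1 n * 1) (- \<pi> * Hn + \<pi> * Hn)"
    by (intro first_order_mult first_order_1 minus_\<pi>_small f2)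
  then have t: "pochhammer (1 + - \<pi>) n * (1 + \<pi> * Hn) \<simeq> pochhammer 1 n \<langle>2\<rangle>"
    by (simp add: first_order_def)
  have c27: "2 / 27 * (-1) ^ n * P \<in> Zp"
    unfolding P_def by (intro Zp_mult Zp_power p_unit_divide p_unit_27 Zp_of_int Zp_minus_1) simp
  have pc4: "1 / pochhammer 1 n ^ 4 \<in> Zp"
    by (intro p_unit_divide p_unit_power p_unit_pochhammer_1n) auto
  have YF: "Y ^ 3 * F0 \<in> Zp" using p_unit_Y p_unit_Zp F0_Zp by (intro Zp_mult Zp_power) auto
  have "2 / 27 * pochhammer a n * P * Q b c d e \<simeq> 2 / 27 * pochhammer a n * P * (U * (Y ^ 3 * F0)) \<langle>2\<rangle>"
  proof (rule pcong_lmult)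
    show "Q b c d e \<simeq> U * (Y ^ 3 * F0) \<langle>2\<rangle>"
      using pcong_trans[OF Q_expansion[OF sum] pcong_lmult[OF G_cong[OF sum] p_unit_Zp(1)[OF U_unit]]] .
    show "2 / 27 * pochhammer a n * P \<in> Zp"
      unfolding P_def by (intro Zp_mult p_unit_divide p_unit_27 Zp_pochhammer a_Zp Zp_of_int) simp
  qed
  also have "2 / 27 * pochhammer a n * P * (U * (Y ^ 3 * F0))
     = (2 / 27 * (-1) ^ n * P * (1 / pochhammer 1 n ^ 4) * (Y ^ 3 * F0)) * (pochhammer (1 + - \<pi>) n * (1 + \<pi> * Hn))"
    unfolding an U_def by (simp only: mult_ac)
  also have "\<dots> \<simeq> (2 / 27 * (-1) ^ n * P * (1 / pochhammer 1 n ^ 4) * (Y ^ 3 * F0)) * pochhammer 1 n \<langle>2\<rangle>"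
    by (intro pcong_lmult t Zp_mult[OF Zp_mult[OF c27 pc4] YF])
  also have "(2 / 27 * (-1) ^ n * P * (1 / pochhammer 1 n ^ 4) * (Y ^ 3 * F0)) * pochhammer 1 n = W * P"
    using p_unit_Zp(3)[OF p_unit_pochhammer_1n]
    by (simp add: W_def power4_eq_xxxx power3_eq_cube field_simps)
  finally have "2 / 27 * pochhammer a n * P * Q b c d e \<simeq> W * P \<langle>2\<rangle>" .
  from pcong_scale[OF this, of 4] show ?thesis
    unfolding F_Q[OF sum] P_def[symmetric] by (simp add: mult_ac)
qed

end

section \<open>Averaging the deformed sum\<close>

text \<open>A point \<open>(b, c, d, e)\<close> stands for the parameters \<open>\<pi>, \<pi> b, \<pi> c, \<pi> d, \<pi> e\<close>. Accordingly \<open>E2\<close>, ..., \<open>E5\<close>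
  below are the elementary symmetric polynomials of \<open>1, b, c, d, e\<close>.\<close>

type_synonym point = "int \<times> int \<times> int \<times> int"

context perturbed_sum
begin

definition E2 :: "point \<Rightarrow> rat" where
  "E2 = (\<lambda>(b, c, d, e). of_int (b + c + d + e + b*c + b*d + b*e + c*d + c*e + d*e))"
definition E3 :: "point \<Rightarrow> rat" where
  "E3 = (\<lambda>(b, c, d, e). of_int (b*c + b*d + b*e + c*d + c*e + d*e + b*c*d + b*c*e + b*d*e + c*d*e))"
definition E4 :: "point \<Rightarrow> rat" where
  "E4 = (\<lambda>(b, c, d, e). of_int (b*c*d + b*c*e + b*d*e + c*d*e + b*c*d*e))"
definition E5 :: "point \<Rightarrow> rat" where
  "E5 = (\<lambda>(b, c, d, e). of_int (b*c*d*e))"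

definition sum_zero :: "point \<Rightarrow> bool" where
  "sum_zero = (\<lambda>(b, c, d, e). b + c + d + e = -1)"

lemma E_Zp: "E2 t \<in> Zp" "E3 t \<in> Zp" "E4 t \<in> Zp" "E5 t \<in> Zp"
  by (auto simp: E2_def E3_def E4_def E5_def split: prod.splits simp del: of_int_add of_int_mult)

section \<open>Expansions in elementary symmetric polynomials\<close>

definition linear_product :: "rat \<Rightarrow> point \<Rightarrow> rat" where
  "linear_product s = (\<lambda>(b, c, d, e). (1 - s) * (1 - of_int b * s) * (1 - of_int c * s) * (1 - of_int d * s) * (1 - of_int e * s))"

lemma linear_product_expand:
  assumes "sum_zero t"
  shows "linear_product s t = 1 + s ^ 2 * E2 t - s ^ 3 * E3 t + s ^ 4 * E4 t - s ^ 5 * E5 t"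
proof -
  obtain b c d e where t: "t = (b, c, d, e)" by (cases t) auto
  have e: "e = -1 - b - c - d" using assms by (simp add: t sum_zero_def)
  show ?thesis
    unfolding t E2_def E3_def E4_def E5_def linear_product_def e
    by (simp add: eval_nat_numeral algebra_simps)
qed

text \<open>Expansions modulo \<open>p ^ 6\<close> of functions of five small parameters, symmetric in the parameters
  and normalised to 1 at the origin. Only the coefficient \<open>D\<close> of the top elementary symmetric
  polynomial matters, because all other monomials are cancelled by a suitable average of points.\<close>

definition degree5 :: "rat \<Rightarrow> rat \<Rightarrow> rat \<Rightarrow> rat \<Rightarrow> rat \<Rightarrow> rat \<Rightarrow> point \<Rightarrow> rat" where
  "degree5 A2 A3 A4 B C D t = 1 + \<pi> ^ 2 * (E2 t * A2) + \<pi> ^ 3 * (E3 t * A3) +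
     \<pi> ^ 4 * (E4 t * A4 + E2 t ^ 2 * B) + \<pi> ^ 5 * (E2 t * E3 t * C + E5 t * D)"

definition expands :: "(point \<Rightarrow> rat) \<Rightarrow> rat \<Rightarrow> bool" where
  "expands g D \<longleftrightarrow> D \<in> Zp \<and> (\<exists>A2\<in>Zp. \<exists>A3\<in>Zp. \<exists>A4\<in>Zp. \<exists>B\<in>Zp. \<exists>C\<in>Zp.
     \<forall>t. sum_zero t \<longrightarrow> g t \<simeq> degree5 A2 A3 A4 B C D t \<langle>6\<rangle>)"

lemma \<pi>_power_6: "z \<in> Zp \<Longrightarrow> \<pi> ^ 6 * z \<simeq> 0 \<langle>6\<rangle>"
proof -
  assume z: "z \<in> Zp"
  have "2 / 3 \<in> Zp" by (intro p_unit_divide p_unit_3) simp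
  then have "(2 / 3) ^ 6 * z \<in> Zp" using z by (intro Zp_mult Zp_power)
  then show ?thesis by (rule pcongI) (simp add: \<pi>_def power_mult_distrib power_divide)
qed

lemma truncated_product:
  fixes X p2 p3 p4 p5 q2 q3 q4 q5 :: rat
  shows "(1 + X^2 * p2 + X^3 * p3 + X^4 * p4 + X^5 * p5) * (1 + X^2 * q2 + X^3 * q3 + X^4 * q4 + X^5 * q5)
    = 1 + X^2 * (p2 + q2) + X^3 * (p3 + q3) + X^4 * (p4 + q4 + p2 * q2) + X^5 * (p5 + q5 + p2 * q3 + p3 * q2) +
      X^6 * (p3 * q3 + p2 * q4 + p4 * q2 + X * (p2 * q5 + p5 * q2 + p3 * q4 + p4 * q3) +
        X ^ 2 * (p3 * q5 + p5 * q3 + p4 * q4) + X ^ 3 * (p4 * q5 + p5 * q4) + X ^ 4 * (p5 * q5))"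
proof -
  have m: "X ^ i * x * (X ^ j * y) = X ^ (i + j) * (x * y)" "X ^ i * (X ^ j * x) = X ^ (i + j) * x"
    "X ^ i * (X * x) = X ^ (i + 1) * x" for i j x y
    by (simp_all add: power_add)
  show ?thesis by (simp add: distrib_left distrib_right m)
qed

lemma degree5_mult:
  assumes "A2 \<in> Zp" "A3 \<in> Zp" "A4 \<in> Zp" "B \<in> Zp" "C \<in> Zp" "D \<in> Zp"
    "A2' \<in> Zp" "A3' \<in> Zp" "A4' \<in> Zp" "B' \<in> Zp" "C' \<in> Zp" "D' \<in> Zp"
  shows "degree5 A2 A3 A4 B C D t * degree5 A2' A3' A4' B' C' D' t \<simeq>
    degree5 (A2 + A2') (A3 + A3') (A4 + A4') (B + B' + A2 * A2') (C + C' + A2 * A3' + A3 * A2') (D + D') t \<langle>6\<rangle>"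
proof -
  define p2 p3 p4 p5 where "p2 = E2 t * A2" and "p3 = E3 t * A3" and "p4 = E4 t * A4 + E2 t ^ 2 * B"
    and "p5 = E2 t * E3 t * C + E5 t * D"
  define q2 q3 q4 q5 where "q2 = E2 t * A2'" and "q3 = E3 t * A3'" and "q4 = E4 t * A4' + E2 t ^ 2 * B'"
    and "q5 = E2 t * E3 t * C' + E5 t * D'"
  define z where "z = p3 * q3 + p2 * q4 + p4 * q2 + \<pi> * (p2 * q5 + p5 * q2 + p3 * q4 + p4 * q3) +
    \<pi> ^ 2 * (p3 * q5 + p5 * q3 + p4 * q4) + \<pi> ^ 3 * (p4 * q5 + p5 * q4) + \<pi> ^ 4 * (p5 * q5)"
  have "p2 \<in> Zp" "p3 \<in> Zp" "p4 \<in> Zp" "p5 \<in> Zp" "q2 \<in> Zp" "q3 \<in> Zp" "q4 \<in> Zp" "q5 \<in> Zp"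
    unfolding p2_def p3_def p4_def p5_def q2_def q3_def q4_def q5_def
    using assms by (auto intro!: Zp_add Zp_mult Zp_power E_Zp)
  then have z: "z \<in> Zp" unfolding z_def by (intro Zp_add Zp_mult Zp_power \<pi>_Zp)
  have "degree5 A2 A3 A4 B C D t * degree5 A2' A3' A4' B' C' D' t
    = (1 + \<pi>^2 * p2 + \<pi>^3 * p3 + \<pi>^4 * p4 + \<pi>^5 * p5) * (1 + \<pi>^2 * q2 + \<pi>^3 * q3 + \<pi>^4 * q4 + \<pi>^5 * q5)"
    by (simp only: degree5_def p2_def p3_def p4_def p5_def q2_def q3_def q4_def q5_def)
  also have "\<dots> = 1 + \<pi>^2 * (p2 + q2) + \<pi>^3 * (p3 + q3) + \<pi>^4 * (p4 + q4 + p2 * q2) +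
      \<pi>^5 * (p5 + q5 + p2 * q3 + p3 * q2) + \<pi>^6 * z"
    unfolding z_def by (rule truncated_product)
  also have "\<dots> \<simeq> 1 + \<pi>^2 * (p2 + q2) + \<pi>^3 * (p3 + q3) + \<pi>^4 * (p4 + q4 + p2 * q2) +
      \<pi>^5 * (p5 + q5 + p2 * q3 + p3 * q2) + 0 \<langle>6\<rangle>"
    by (intro pcong_add[OF pcong_refl] \<pi>_power_6 z)
  also have "1 + \<pi>^2 * (p2 + q2) + \<pi>^3 * (p3 + q3) + \<pi>^4 * (p4 + q4 + p2 * q2) +
      \<pi>^5 * (p5 + q5 + p2 * q3 + p3 * q2) + 0 = 
    degree5 (A2 + A2') (A3 + A3') (A4 + A4') (B + B' + A2 * A2') (C + C' + A2 * A3' + A3 * A2') (D + D') t"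
  proof -
    have "E2 t * (A2 + A2') = p2 + q2" "E3 t * (A3 + A3') = p3 + q3"
      "E4 t * (A4 + A4') + E2 t ^ 2 * (B + B' + A2 * A2') = p4 + q4 + p2 * q2"
      "E2 t * E3 t * (C + C' + A2 * A3' + A3 * A2') + E5 t * (D + D') = p5 + q5 + p2 * q3 + p3 * q2"
      unfolding p2_def p3_def p4_def p5_def q2_def q3_def q4_def q5_def
      by (simp_all add: power2_eq_square algebra_simps)
    from this[symmetric] show ?thesis unfolding degree5_def add_0_right by metis
  qed
  finally show ?thesis .
qed

lemma degree5_Zp:
  "A2 \<in> Zp \<Longrightarrow> A3 \<in> Zp \<Longrightarrow> A4 \<in> Zp \<Longrightarrow> B \<in> Zp \<Longrightarrow> C \<in> Zp \<Longrightarrow> D \<in> Zp \<Longrightarrow> degree5 A2 A3 A4 B C D t \<in> Zp"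
  unfolding degree5_def by (intro Zp_add Zp_mult Zp_power \<pi>_Zp E_Zp) simp_all

text \<open>\<open>D\<close> is additive because two factors of positive degree below five meet in
  degree five only in multiples of \<open>E2 * E3\<close>.\<close>

lemma expands_mult:
  assumes "expands f D" "expands g D'"
  shows "expands (\<lambda>t. f t * g t) (D + D')"
proof -
  obtain A2 A3 A4 B C where 1: "A2 \<in> Zp" "A3 \<in> Zp" "A4 \<in> Zp" "B \<in> Zp" "C \<in> Zp" "D \<in> Zp"
    and f: "\<And>t. sum_zero t \<Longrightarrow> f t \<simeq> degree5 A2 A3 A4 B C D t \<langle>6\<rangle>"
    using assms(1) unfolding expands_def by blast
  obtain A2' A3' A4' B' C' where 2: "A2' \<in> Zp" "A3' \<in> Zp" "A4' \<in> Zp" "B' \<in> Zp" "C' \<in> Zp" "D' \<in> Zp"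
    and g: "\<And>t. sum_zero t \<Longrightarrow> g t \<simeq> degree5 A2' A3' A4' B' C' D' t \<langle>6\<rangle>"
    using assms(2) unfolding expands_def by blast
  have "f t * g t \<simeq> degree5 (A2 + A2') (A3 + A3') (A4 + A4') (B + B' + A2 * A2') (C + C' + A2 * A3' + A3 * A2') (D + D') t \<langle>6\<rangle>"
    if t: "sum_zero t" for t
    by (rule pcong_trans[OF pcong_mult[OF f[OF t] g[OF t]
          pcong_Zp[OF g[OF t] degree5_Zp[OF 2]] degree5_Zp[OF 1]] degree5_mult[OF 1 2]])
  moreover have "A2 + A2' \<in> Zp" "A3 + A3' \<in> Zp" "A4 + A4' \<in> Zp" "B + B' + A2 * A2' \<in> Zp"
    "C + C' + A2 * A3' + A3 * A2' \<in> Zp" "D + D' \<in> Zp"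
    using 1 2 by (auto intro!: Zp_add Zp_mult)
  ultimately show ?thesis unfolding expands_def by blast
qed

lemma expands_prod:
  assumes "finite I" "\<And>i. i \<in> I \<Longrightarrow> expands (f i) (D i)"
  shows "expands (\<lambda>t. \<Prod>i\<in>I. f i t) (\<Sum>i\<in>I. D i)"
  using assms
proof (induction I)
  case empty
  have "degree5 0 0 0 0 0 0 t = 1" for t by (simp add: degree5_def)
  then show ?case unfolding expands_def using Zp_numeral(2) pcong_refl by (metis prod.empty sum.empty)
next
  case (insert i I)
  then have "expands (\<lambda>t. f i t * (\<Prod>i\<in>I. f i t)) (D i + (\<Sum>i\<in>I. D i))"
    by (intro expands_mult) auto
  then show ?case using insert by simp
qed

lemma linear_product_degree5:
  assumes "sum_zero t"
  shows "linear_product (\<pi> * v) t = degree5 (v ^ 2) (- (v ^ 3)) (v ^ 4) 0 0 (- (v ^ 5)) t"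
  unfolding linear_product_expand[OF assms] degree5_def by (simp add: power_mult_distrib mult_ac)

lemma expands_linear_product:
  assumes "v \<in> Zp" shows "expands (linear_product (\<pi> * v)) (- (v ^ 5))"
  unfolding expands_def
proof (intro conjI bexI allI impI)
  fix t assume "sum_zero t"
  then show "linear_product (\<pi> * v) t \<simeq> degree5 (v ^ 2) (- (v ^ 3)) (v ^ 4) 0 0 (- (v ^ 5)) t \<langle>6\<rangle>"
    by (simp add: linear_product_degree5)
qed (use assms in \<open>auto intro!: Zp_power Zp_minus\<close>)

lemma linear_product_unit:
  assumes "v \<in> Zp" shows "p_unit p (linear_product (\<pi> * v) t)"
proof -
  have "p_unit p (1 - of_int b * (\<pi> * v))" for b
  proof -
    have "- (\<pi> * (of_int b * v)) \<simeq> 0 \<langle>1\<rangle>"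
      using pcong_minus[OF \<pi>_mult_small[OF Zp_mult[OF Zp_of_int assms]]] by simp
    from p_unit_near[OF p_unit_1 this] show ?thesis by (simp add: mult_ac)
  qed
  from this this[of 1] show ?thesis
    unfolding linear_product_def by (auto split: prod.splits intro!: p_unit_mult)
qed

text \<open>With powers of \<open>\<pi>\<close> suppressed, the coefficients are those of the formal
  reciprocal of \<open>1 + w^2 E2 + w^3 E3 + w^4 E4 + w^5 E5\<close>, verified by multiplying
  back.\<close>

lemma expands_inverse_linear_product:
  assumes w: "w \<in> Zp" shows "expands (\<lambda>t. 1 / linear_product (\<pi> * - w) t) (- (w ^ 5))"
  unfolding expands_def
proof (intro conjI bexI allI impI)
  fix t assume t: "sum_zero t"
  have u: "p_unit p (linear_product (\<pi> * - w) t)" by (intro linear_product_unit Zp_minus w)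
  have "linear_product (\<pi> * - w) t * degree5 (- (w ^ 2)) (- (w ^ 3)) (- (w ^ 4)) (w ^ 4) (2 * w ^ 5) (- (w ^ 5)) t
     = degree5 ((- w) ^ 2) (- ((- w) ^ 3)) ((- w) ^ 4) 0 0 (- ((- w) ^ 5)) t *
       degree5 (- (w ^ 2)) (- (w ^ 3)) (- (w ^ 4)) (w ^ 4) (2 * w ^ 5) (- (w ^ 5)) t"
    by (simp only: linear_product_degree5[OF t])
  also have "\<dots> \<simeq> degree5 ((- w) ^ 2 + - (w ^ 2)) (- ((- w) ^ 3) + - (w ^ 3)) ((- w) ^ 4 + - (w ^ 4))
      (0 + w ^ 4 + (- w) ^ 2 * (- (w ^ 2))) (0 + 2 * w ^ 5 + (- w) ^ 2 * (- (w ^ 3)) + (- ((- w) ^ 3)) * (- (w ^ 2)))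
      (- ((- w) ^ 5) + - (w ^ 5)) t \<langle>6\<rangle>"
    using w by (intro degree5_mult) (auto intro!: Zp_power Zp_minus Zp_mult)
  also have "degree5 ((- w) ^ 2 + - (w ^ 2)) (- ((- w) ^ 3) + - (w ^ 3)) ((- w) ^ 4 + - (w ^ 4))
      (0 + w ^ 4 + (- w) ^ 2 * (- (w ^ 2))) (0 + 2 * w ^ 5 + (- w) ^ 2 * (- (w ^ 3)) + (- ((- w) ^ 3)) * (- (w ^ 2)))
      (- ((- w) ^ 5) + - (w ^ 5)) t = 1"
  proof -
    have "(- w) ^ 2 + - (w ^ 2) = 0" "- ((- w) ^ 3) + - (w ^ 3) = 0" "(- w) ^ 4 + - (w ^ 4) = 0"
      "- ((- w) ^ 5) + - (w ^ 5) = 0"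
      by simp_all
    moreover have "0 + w ^ 4 + (- w) ^ 2 * (- (w ^ 2)) = 0"
      "0 + 2 * w ^ 5 + (- w) ^ 2 * (- (w ^ 3)) + (- ((- w) ^ 3)) * (- (w ^ 2)) = 0"
      by (simp_all add: eval_nat_numeral)
    ultimately show ?thesis unfolding degree5_def by (simp only:) simp
  qed
  also have "1 = linear_product (\<pi> * - w) t * (1 / linear_product (\<pi> * - w) t)"
    using p_unit_Zp(3)[OF u] by simp
  finally show "1 / linear_product (\<pi> * - w) t \<simeq>
      degree5 (- (w ^ 2)) (- (w ^ 3)) (- (w ^ 4)) (w ^ 4) (2 * w ^ 5) (- (w ^ 5)) t \<langle>6\<rangle>"
    by (rule pcong_sym[OF pcong_cancel[OF _ u]])
qed (use w in \<open>auto intro!: Zp_power Zp_minus Zp_mult\<close>)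

text \<open>The five points and weights below satisfy \<open>average 1 = 1\<close> while \<open>E2\<close>, \<open>E2\<^sup>2\<close>, \<open>E3\<close>, \<open>E4\<close>,
  \<open>E2 * E3\<close> average to zero, and the denominators of the weights only contain the primes 2 and 3.
  They replace the evaluation at the five fifth roots of unity.\<close>

definition average :: "(point \<Rightarrow> rat) \<Rightarrow> rat" where
  "average f = 2 / 27 * f (-3, -1, 0, 3) + 299 / 216 * f (-1, 0, 0, 0) + (-1) / 72 * f (-4, 0, 1, 2)
     + (-35) / 72 * f (-2, -1, 0, 2) + 1 / 24 * f (-3, -2, 2, 2)"

lemma average_cong:
  assumes "\<And>t. sum_zero t \<Longrightarrow> f t \<simeq> g t \<langle>m\<rangle>"
  shows "average f \<simeq> average g \<langle>m\<rangle>"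
proof -
  have u: "p_unit p 27" "p_unit p 216" "p_unit p 72" "p_unit p 24"
    using p_unit_power[OF p_unit_3, of 3] p_unit_power[OF p_unit_mult[OF p_unit_2 p_unit_3], of 3]
      p_unit_mult[OF p_unit_power[OF p_unit_2, of 3] p_unit_power[OF p_unit_3, of 2]]
      p_unit_mult[OF p_unit_power[OF p_unit_2, of 3] p_unit_3] by simp_all
  have "- 35 \<in> Zp" using Zp_minus[OF Zp_numeral(1)] by simp
  then show ?thesis
    unfolding average_def using u
    by (intro pcong_add pcong_lmult assms p_unit_divide) (auto simp: sum_zero_def)
qed

text \<open>Only \<open>(-3, -2, 2, 2)\<close> has a nonzero product of coordinates, namely 24, and
  its weight is \<open>1 / 24\<close>; hence \<open>E5\<close> averages to 1.\<close>

lemma average_degree5: "average (degree5 A2 A3 A4 B C D) = 1 + \<pi> ^ 5 * D"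
  unfolding average_def degree5_def E2_def E3_def E4_def E5_def by (simp add: field_simps)

lemma average_expands: "expands g D \<Longrightarrow> average g \<simeq> 1 + \<pi> ^ 5 * D \<langle>6\<rangle>"
  unfolding expands_def by (metis average_cong average_degree5)

lemma average_sum: "average (\<lambda>t. \<Sum>k\<in>K. f k t) = (\<Sum>k\<in>K. average (f k))"
  unfolding average_def by (simp only: sum_distrib_left sum.distrib)

lemma average_cmult: "average (\<lambda>t. c * f t) = c * average f"
  unfolding average_def by (simp add: algebra_simps)

section \<open>The averaged sum modulo the sixth power of p\<close>

definition v :: "nat \<Rightarrow> rat" where "v j = 1 / (a + of_nat j)"
definition w :: "nat \<Rightarrow> rat" where "w j = 1 / (1 + of_nat j)"
definition \<tau> :: "nat \<Rightarrow> rat" where "\<tau> k = (6 * of_nat k + of_int r) * (pochhammer a k / pochhammer 1 k) ^ 6"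
text \<open>The coefficient of \<open>\<pi> ^ 5 * E5\<close> in the \<open>k\<close>-th deformed
  summand, relative to \<open>\<tau> k\<close>.\<close>

definition \<delta> :: "nat \<Rightarrow> rat" where "\<delta> k = (\<Sum>j<k. - (v j ^ 5) + - (w j ^ 5))"

lemma v_Zp: "j < n \<Longrightarrow> v j \<in> Zp"
  unfolding v_def using p_unit_a_plus p_unit_Zp by blast

lemma w_Zp: "j < n \<Longrightarrow> w j \<in> Zp"
  unfolding w_def using p_unit_1_plus p_unit_Zp by blast

lemma \<phi>_factor:
  assumes "k \<le> n"
  shows "\<phi> k x = pochhammer a k / pochhammer 1 k * (\<Prod>j<k. (1 - x * v j) / (1 + x * w j))"
proof -
  have "pochhammer (a - x) k = (\<Prod>j<k. (a + of_nat j) * (1 - x * v j))"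
    unfolding pochhammer_prod lessThan_atLeast0
    using p_unit_Zp(3)[OF p_unit_a_plus] assms
    by (intro prod.cong) (auto simp: v_def field_simps)
  moreover have "pochhammer (1 + x) k = (\<Prod>j<k. (1 + of_nat j) * (1 + x * w j))"
    unfolding pochhammer_prod lessThan_atLeast0
    using p_unit_Zp(3)[OF p_unit_1_plus] assms
    by (intro prod.cong) (auto simp: w_def field_simps)
  ultimately show ?thesis
    unfolding \<phi>_def by (simp add: prod.distrib prod_dividef pochhammer_prod lessThan_atLeast0)
qed

text \<open>Grouping the factors by \<open>j\<close> instead of by parameter makes each of them
  symmetric in the five parameters, as the expansion requires.\<close>

lemma F_expansion:
  "F b c d e = (\<Sum>k\<le>n. \<tau> k * (\<Prod>j<k. linear_product (\<pi> * v j) (b, c, d, e) * (1 / linear_product (\<pi> * - w j) (b, c, d, e))))"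
  unfolding F_def
proof (rule sum.cong[OF refl])
  fix k assume "k \<in> {..n}"
  then have k: "k \<le> n" by simp
  define q where "q = pochhammer a k / pochhammer 1 k"
  have "(6 * of_nat k + of_int r) * pochhammer a k / pochhammer 1 k * \<phi> k \<pi> * \<phi> k (\<pi> * of_int b) * \<phi> k (\<pi> * of_int c) * \<phi> k (\<pi> * of_int d) * \<phi> k (\<pi> * of_int e)
    = (6 * of_nat k + of_int r) * q ^ 6 *
     ((\<Prod>j<k. (1 - \<pi> * v j) / (1 + \<pi> * w j)) *
     (\<Prod>j<k. (1 - \<pi> * of_int b * v j) / (1 + \<pi> * of_int b * w j)) *
     (\<Prod>j<k. (1 - \<pi> * of_int c * v j) / (1 + \<pi> * of_int c * w j)) *
     (\<Prod>j<k. (1 - \<pi> * of_int d * v j) / (1 + \<pi> * of_int d * w j)) *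
     (\<Prod>j<k. (1 - \<pi> * of_int e * v j) / (1 + \<pi> * of_int e * w j)))"
  proof -
    have s: "(6 * of_nat k + of_int r) * pochhammer a k / pochhammer 1 k = (6 * of_nat k + of_int r) * q"
      by (simp add: q_def)
    have "u * q * (q * A) * (q * B) * (q * C) * (q * D) * (q * E) = u * q ^ 6 * (A * B * C * D * E)" for u A B C D E
      by (simp add: eval_nat_numeral)
    then show ?thesis unfolding \<phi>_factor[OF k] q_def[symmetric] s .
  qed
  also have "(\<Prod>j<k. (1 - \<pi> * v j) / (1 + \<pi> * w j)) *
     (\<Prod>j<k. (1 - \<pi> * of_int b * v j) / (1 + \<pi> * of_int b * w j)) *
     (\<Prod>j<k. (1 - \<pi> * of_int c * v j) / (1 + \<pi> * of_int c * w j)) *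
     (\<Prod>j<k. (1 - \<pi> * of_int d * v j) / (1 + \<pi> * of_int d * w j)) *
     (\<Prod>j<k. (1 - \<pi> * of_int e * v j) / (1 + \<pi> * of_int e * w j))
    = (\<Prod>j<k. linear_product (\<pi> * v j) (b, c, d, e) * (1 / linear_product (\<pi> * - w j) (b, c, d, e)))"
    unfolding prod.distrib[symmetric] linear_product_def
    by (intro prod.cong refl) (simp add: mult_ac)
  finally show "(6 * of_nat k + of_int r) * pochhammer a k / pochhammer 1 k * \<phi> k \<pi> * \<phi> k (\<pi> * of_int b) * \<phi> k (\<pi> * of_int c) * \<phi> k (\<pi> * of_int d) * \<phi> k (\<pi> * of_int e)
    = \<tau> k * (\<Prod>j<k. linear_product (\<pi> * v j) (b, c, d, e) * (1 / linear_product (\<pi> * - w j) (b, c, d, e)))"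
    by (simp add: \<tau>_def q_def)
qed

lemma \<tau>_Zp: "k \<le> n \<Longrightarrow> \<tau> k \<in> Zp"
  unfolding \<tau>_def
  by (intro Zp_mult Zp_power Zp_add p_unit_divide pochhammer_1_unit_le Zp_pochhammer a_Zp Zp_of_int Zp_of_nat) simp_all

lemma average_F: "average (\<lambda>(b, c, d, e). F b c d e) \<simeq> (\<Sum>k\<le>n. \<tau> k) + \<pi> ^ 5 * (\<Sum>k\<le>n. \<tau> k * \<delta> k) \<langle>6\<rangle>"
proof -
  define g where "g = (\<lambda>k t. \<Prod>j<k. linear_product (\<pi> * v j) t * (1 / linear_product (\<pi> * - w j) t))"
  have "average (\<lambda>(b, c, d, e). F b c d e) = (\<Sum>k\<le>n. \<tau> k * average (g k))"
    unfolding F_expansion average_cmult[symmetric] average_sum[symmetric] g_def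
    by (rule arg_cong[where f = average]) (auto simp: fun_eq_iff)
  also have "\<dots> \<simeq> (\<Sum>k\<le>n. \<tau> k * (1 + \<pi> ^ 5 * \<delta> k)) \<langle>6\<rangle>"
  proof (intro pcong_sum pcong_lmult average_expands)
    fix k assume "k \<in> {..n}"
    then show "expands (g k) (\<delta> k)" unfolding g_def \<delta>_def
      by (intro expands_prod expands_mult expands_linear_product expands_inverse_linear_product v_Zp w_Zp) auto
  qed (auto intro: \<tau>_Zp)
  also have "(\<Sum>k\<le>n. \<tau> k * (1 + \<pi> ^ 5 * \<delta> k)) = (\<Sum>k\<le>n. \<tau> k) + \<pi> ^ 5 * (\<Sum>k\<le>n. \<tau> k * \<delta> k)"
    by (simp add: sum_distrib_left sum.distrib[symmetric] algebra_simps)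
  finally show ?thesis .
qed

lemma sum_antisymmetric:
  fixes g :: "nat \<Rightarrow> rat"
  assumes "\<And>k. k \<le> m \<Longrightarrow> g (m - k) = - g k" shows "(\<Sum>k\<le>m. g k) = 0"
proof -
  have "(\<Sum>k\<le>m. g k) = (\<Sum>k\<le>m. g (m - k))"
    by (rule sum.reindex_bij_witness[of _ "\<lambda>k. m - k" "\<lambda>k. m - k"]) auto
  also have "\<dots> = - (\<Sum>k\<le>m. g k)" unfolding sum_negf[symmetric] using assms by (intro sum.cong) auto
  finally show ?thesis by simp
qed

text \<open>Modulo \<open>p\<close> the number \<open>a\<close> may be replaced by
  \<open>- of_nat n\<close>. Then the quotient of Pochhammer symbols becomes a signed binomial
  coefficient and \<open>\<delta> k\<close> becomes
  \<open>\<kappa> n - \<kappa> (n - k) - \<kappa> k\<close>; both the sixth power and this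
  difference are symmetric, whereas \<open>2 * of_nat k - of_nat n\<close> changes sign.\<close>

lemma top_coefficient: "(\<Sum>k\<le>n. \<tau> k * \<delta> k) \<simeq> 0 \<langle>1\<rangle>"
proof -
  define \<kappa> where "\<kappa> m = (\<Sum>j<m. w j ^ 5)" for m
  define T where "T k = 3 * (2 * of_nat k - of_nat n) * of_nat (n choose k) ^ 6 * (\<kappa> n - \<kappa> (n - k) - \<kappa> k)" for k
  have an: "a \<simeq> - of_nat n \<langle>1\<rangle>"
  proof -
    have "a = - of_nat n + \<pi>" using a_plus_n by simp
    then show ?thesis using pcong_add[OF pcong_refl[of 1 "- of_nat n"] \<pi>_small] by simp
  qed
  have "\<tau> k * \<delta> k \<simeq> T k \<langle>1\<rangle>" if k: "k \<le> n" for k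
  proof -
    have 1: "6 * of_nat k + of_int r \<simeq> 3 * (2 * of_nat k - of_nat n) \<langle>1\<rangle>"
    proof -
      have "6 * of_nat k + of_int r = 3 * (2 * of_nat k + a)" by (simp add: a_def)
      moreover have "3 * (2 * of_nat k + a) \<simeq> 3 * (2 * of_nat k + - of_nat n) \<langle>1\<rangle>"
        by (intro pcong_lmult pcong_add pcong_refl an) simp
      ultimately show ?thesis by simp
    qed
    have "pochhammer a k \<simeq> pochhammer (- of_nat n) k \<langle>1\<rangle>"
      unfolding pochhammer_prod
      by (intro pcong_prod pcong_add an pcong_refl Zp_add Zp_minus Zp_of_nat)
    from pcong_divide[OF this pochhammer_1_unit_le[OF k]]
    have "pochhammer a k / pochhammer 1 k \<simeq> (-1) ^ k * of_nat (n choose k) \<langle>1\<rangle>"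
      by (simp add: binomial_gbinomial gbinomial_pochhammer pochhammer_fact)
    then have "(pochhammer a k / pochhammer 1 k) ^ 6 \<simeq> ((-1) ^ k * of_nat (n choose k)) ^ 6 \<langle>1\<rangle>"
      by (rule pcong_power) (intro Zp_mult Zp_power Zp_minus_1 Zp_of_nat)
    moreover have "((-1) ^ k * of_nat (n choose k)) ^ 6 = (of_nat (n choose k) ^ 6 :: rat)"
      by (simp add: power_mult_distrib flip: power_mult)
    ultimately have 2: "(pochhammer a k / pochhammer 1 k) ^ 6 \<simeq> of_nat (n choose k) ^ 6 \<langle>1\<rangle>" by simp
    have 3: "\<delta> k \<simeq> (\<Sum>j<k. - ((- (1 / of_nat (n - j))) ^ 5) + - (w j ^ 5)) \<langle>1\<rangle>"
      unfolding \<delta>_def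
    proof (intro pcong_sum pcong_add pcong_minus pcong_power pcong_refl)
      fix j assume "j \<in> {..<k}"
      then have j: "j < n" using k by simp
      have u: "p_unit p (of_nat (n - j))" using j n_bounds by (intro p_unit_of_nat) (auto dest: dvd_imp_le)
      have "a + of_nat j \<simeq> - of_nat n + of_nat j \<langle>1\<rangle>" by (intro pcong_add an pcong_refl)
      then have "a + of_nat j \<simeq> - of_nat (n - j) \<langle>1\<rangle>" using j by (simp add: of_nat_diff)
      from pcong_inverse[OF this p_unit_a_plus[OF j] p_unit_minus[OF u]]
      show "v j \<simeq> - (1 / of_nat (n - j)) \<langle>1\<rangle>" by (simp add: v_def)
      show "- (1 / of_nat (n - j)) \<in> Zp" using p_unit_Zp(2)[OF u] by (rule Zp_minus)
    qed (use k in \<open>auto intro: w_Zp\<close>)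
    have "(\<Sum>j<k. 1 / of_nat (n - j) ^ 5) = \<kappa> n - \<kappa> (n - k)"
      using k
    proof (induction k)
      case (Suc k)
      then have "n - k = Suc (n - Suc k)" by simp
      then have "\<kappa> (n - k) = \<kappa> (n - Suc k) + 1 / of_nat (n - k) ^ 5"
        by (simp add: \<kappa>_def w_def power_one_over)
      then show ?case using Suc by simp
    qed simp
    then have "(\<Sum>j<k. - ((- (1 / of_nat (n - j))) ^ 5) + - (w j ^ 5)) = \<kappa> n - \<kappa> (n - k) - \<kappa> k"
      unfolding sum.distrib by (simp add: \<kappa>_def sum_negf power_one_over)
    with 3 have 3: "\<delta> k \<simeq> \<kappa> n - \<kappa> (n - k) - \<kappa> k \<langle>1\<rangle>" by simp
    have \<kappa>: "\<kappa> m \<in> Zp" if "m \<le> n" for m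
      unfolding \<kappa>_def using that by (intro Zp_sum Zp_power w_Zp) auto
    have z: "\<kappa> n - \<kappa> (n - k) - \<kappa> k \<in> Zp" using k by (intro Zp_diff \<kappa>) auto
    show ?thesis unfolding \<tau>_def T_def
    proof (intro pcong_mult 1 2 3)
      show "(pochhammer a k / pochhammer 1 k) ^ 6 \<in> Zp"
        by (intro Zp_power p_unit_divide pochhammer_1_unit_le[OF k] Zp_pochhammer a_Zp)
      show "\<delta> k \<in> Zp" by (rule pcong_Zp[OF 3 z])
    qed (intro Zp_mult Zp_diff Zp_power Zp_of_nat Zp_numeral)+
  qed
  then have "(\<Sum>k\<le>n. \<tau> k * \<delta> k) \<simeq> (\<Sum>k\<le>n. T k) \<langle>1\<rangle>" by (intro pcong_sum) auto
  also have "(\<Sum>k\<le>n. T k) = 0"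
  proof (rule sum_antisymmetric)
    fix k assume k: "k \<le> n"
    then show "T (n - k) = - T k"
      by (simp add: T_def binomial_symmetric[OF k, symmetric] of_nat_diff algebra_simps)
  qed
  finally show ?thesis .
qed

text \<open>At zero-sum points the product of the three linear factors equals
  \<open>-5 - 4 * E2 + 8 * E3\<close>. This explains the constant: \<open>E2\<close> and
  \<open>E3\<close> average to zero.\<close>

lemma average_F_closed: "average (\<lambda>(b, c, d, e). F b c d e) \<simeq> of_nat p ^ 4 * (- 5 * W) \<langle>6\<rangle>"
proof -
  have "average (\<lambda>(b, c, d, e). F b c d e) \<simeq> average (\<lambda>(b, c, d, e). of_nat p ^ 4 *
      (W * of_int ((1 + 2 * (d + e)) * (1 + 2 * (b + d)) * (1 + 2 * (c + d))))) \<langle>6\<rangle>"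
  proof (rule average_cong)
    fix t :: point assume t: "sum_zero t"
    obtain b c d e where "t = (b, c, d, e)" by (cases t) auto
    with t F_cong[of b c d e] show "(case t of (b, c, d, e) \<Rightarrow> F b c d e) \<simeq> (case t of (b, c, d, e) \<Rightarrow> of_nat p ^ 4 *
      (W * of_int ((1 + 2 * (d + e)) * (1 + 2 * (b + d)) * (1 + 2 * (c + d))))) \<langle>6\<rangle>"
      by (simp only: sum_zero_def prod.case)
  qed
  also have "average (\<lambda>(b, c, d, e). of_nat p ^ 4 *
      (W * of_int ((1 + 2 * (d + e)) * (1 + 2 * (b + d)) * (1 + 2 * (c + d))))) = of_nat p ^ 4 * (- 5 * W)"
    by (simp add: average_def)
  finally show ?thesis .
qed

lemma truncated_sum_cong:
  "(\<Sum>k = 0..p - 1. (6 * of_nat k + of_int r) * (pochhammer a k ^ 6 / pochhammer 1 k ^ 6))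
     \<simeq> of_nat p ^ 4 * (- 5 * W) \<langle>6\<rangle>"
proof -
  \<comment> \<open>For \<open>k > n\<close> the factor \<open>a + of_nat n = \<pi>\<close> occurs
    in \<open>pochhammer a k\<close>, and the summand contains its sixth power.\<close>
  have tail: "\<tau> k \<simeq> 0 \<langle>6\<rangle>" if k: "n < k" "k < p" for k
  proof -
    obtain m where m: "k = Suc n + m" using k less_imp_Suc_add by (metis add_Suc)
    have "pochhammer a k = \<pi> * (pochhammer a n * pochhammer (a + of_nat (Suc n)) m)"
      unfolding m pochhammer_product' pochhammer_Suc[of a n] a_plus_n by (simp add: mult_ac)
    moreover have u: "p_unit p (pochhammer 1 k)"
      unfolding pochhammer_prod
    proof (rule p_unit_prod)
      fix i assume "i \<in> {0..<k}"
      then have "\<not> p dvd Suc i" using k by (auto dest: dvd_imp_le)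
      from p_unit_of_nat[OF this] show "p_unit p (1 + of_nat i)" by simp
    qed
    ultimately have "\<tau> k = \<pi> ^ 6 * ((6 * of_nat k + of_int r) *
        ((pochhammer a n * pochhammer (a + of_nat (Suc n)) m) / pochhammer 1 k) ^ 6)"
      by (simp add: \<tau>_def power_mult_distrib power_divide)
    then show ?thesis
      using u by (auto intro!: \<pi>_power_6 Zp_mult Zp_power Zp_add p_unit_divide Zp_pochhammer a_Zp simp del: of_nat_Suc)
  qed
  have "(\<Sum>k = 0..p - 1. (6 * of_nat k + of_int r) * (pochhammer a k ^ 6 / pochhammer 1 k ^ 6)) = (\<Sum>k = 0..p - 1. \<tau> k)"
    by (simp add: \<tau>_def power_divide)
  also have "\<dots> = (\<Sum>k\<le>n. \<tau> k) + (\<Sum>k\<in>{n<..<p}. \<tau> k)"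
  proof -
    have "{0..p - 1} = {..n} \<union> {n<..<p}" using n_bounds by auto
    then show ?thesis by (simp only:) (intro sum.union_disjoint; auto)
  qed
  also have "\<dots> \<simeq> (\<Sum>k\<le>n. \<tau> k) + (\<Sum>k\<in>{n<..<p}. 0) \<langle>6\<rangle>"
    by (intro pcong_add pcong_refl pcong_sum tail) auto
  also have "(\<Sum>k\<le>n. \<tau> k) + (\<Sum>k\<in>{n<..<p}. 0) = (\<Sum>k\<le>n. \<tau> k) + 0" by simp
  also have "\<dots> \<simeq> (\<Sum>k\<le>n. \<tau> k) + \<pi> ^ 5 * (\<Sum>k\<le>n. \<tau> k * \<delta> k) \<langle>6\<rangle>"
  proof (rule pcong_add[OF pcong_refl pcong_sym])
    have "\<pi> ^ 5 \<simeq> 0 \<langle>5\<rangle>"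
    proof (rule pcongI)
      show "(2 / 3) ^ 5 \<in> Zp" by (intro Zp_power p_unit_divide p_unit_3) simp
    qed (simp add: \<pi>_def power_mult_distrib power_divide)
    from pcong_0_mult[OF this top_coefficient]
    show "\<pi> ^ 5 * (\<Sum>k\<le>n. \<tau> k * \<delta> k) \<simeq> 0 \<langle>6\<rangle>" by simp
  qed
  also have "\<dots> \<simeq> of_nat p ^ 4 * (- 5 * W) \<langle>6\<rangle>"
    using pcong_trans[OF pcong_sym[OF average_F] average_F_closed] .
  finally show ?thesis .
qed

end

section \<open>Components of p-adic integers\<close>

context prime_localization
begin

abbreviation "Zring \<equiv> padic_ring p"

lemma padic_cring: "cring Zring"
  by (rule cring_padic_ring[OF p_pos])

lemma padic_carrier:
  "x \<in> carrier Zring \<longleftrightarrow> (\<forall>n. 0 \<le> x n \<and> x n < int p ^ n \<and> x (Suc n) mod int p ^ n = x n)"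
  by (simp add: padic_ring_def)

lemma padic_range: "x \<in> carrier Zring \<Longrightarrow> x n mod int p ^ n = x n"
  by (simp add: padic_carrier)

lemma padic_reduce: "x \<in> carrier Zring \<Longrightarrow> x (m + n) mod int p ^ m = x m"
proof (induction n)
  case (Suc n)
  have "x (m + Suc n) mod int p ^ m = (x (Suc (m + n)) mod int p ^ (m + n)) mod int p ^ m"
    by (simp add: mod_mod_cancel power_add)
  then show ?case using Suc by (simp add: padic_carrier)
qed (simp add: padic_range)

lemma padic_mult_at: "(x \<otimes>\<^bsub>Zring\<^esub> y) n = (x n * y n) mod int p ^ n"
  by (simp add: padic_ring_def)

lemma padic_pow_at: "(x [^]\<^bsub>Zring\<^esub> (k::nat)) n = (x n) ^ k mod int p ^ n"
proof (induction k)
  case 0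
  then show ?case by (simp add: nat_pow_def) (simp add: padic_ring_def)
next
  case (Suc k)
  then show ?case by (simp add: nat_pow_def padic_mult_at mod_mult_right_eq mult.commute)
qed

lemma padic_minus_at:
  assumes "x \<in> carrier Zring" "y \<in> carrier Zring"
  shows "(x \<ominus>\<^bsub>Zring\<^esub> y) n = (x n - y n) mod int p ^ n"
proof -
  interpret cring Zring by (rule padic_cring)
  define z where "z = x \<ominus>\<^bsub>Zring\<^esub> y"
  have z: "z \<in> carrier Zring" using assms by (simp add: z_def)
  have "z \<oplus>\<^bsub>Zring\<^esub> y = x" unfolding z_def using assms by algebra
  then have "x n = (z n + y n) mod int p ^ n" by (auto simp: padic_ring_def)
  then have "(x n - y n) mod int p ^ n = (z n + y n - y n) mod int p ^ n"
    by (metis mod_diff_left_eq)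
  then show ?thesis using padic_range[OF z, of n] by (simp add: z_def)
qed

lemma padic_eq_iff:
  assumes "x \<in> carrier Zring" "y \<in> carrier Zring"
  shows "x n = y n \<longleftrightarrow> (x n - y n) mod int p ^ n = 0"
  using assms padic_range by (metis mod_eq_dvd_iff mod_0_imp_dvd dvd_imp_mod_0)

text \<open>A sequence whose \<open>n\<close>-th component vanishes is divided by
  \<open>p ^ n\<close> by shifting it \<open>n\<close> places and dividing each entry.\<close>

lemma padic_cong_iff:
  assumes x: "x \<in> carrier Zring" and y: "y \<in> carrier Zring"
  shows "padic_cong p n x y \<longleftrightarrow> x n = y n"
proof
  interpret cring Zring by (rule padic_cring)
  define z where "z = x \<ominus>\<^bsub>Zring\<^esub> y"
  have z: "z \<in> carrier Zring" using assms by (simp add: z_def)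
  {
    assume "padic_cong p n x y"
    then obtain w where "z = padic_of_int p (int p ^ n) \<otimes>\<^bsub>Zring\<^esub> w"
      unfolding padic_cong_def factor_def z_def by auto
    then have "z n = 0" by (simp add: padic_mult_at padic_of_int_def)
    then show "x n = y n" using padic_eq_iff[OF x y] padic_minus_at[OF x y] by (simp add: z_def)
  }
  assume "x n = y n"
  then have zn: "z n = 0" using padic_minus_at[OF x y, of n] by (simp add: z_def)
  define w where "w m = z (n + m) div int p ^ n" for m
  have dvd: "int p ^ n dvd z (n + m)" for m
    using padic_reduce[OF z, of n m] zn by auto
  have "w \<in> carrier Zring"
    unfolding padic_carrier
  proof (intro allI conjI)
    fix m
    have r: "0 \<le> z (n + m)" "z (n + m) < int p ^ (n + m)" using z unfolding padic_carrier by blast+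
    show "0 \<le> w m" unfolding w_def using r p_pos by (simp add: pos_imp_zdiv_nonneg_iff)
    have "w m * int p ^ n < int p ^ m * int p ^ n"
      using r dvd[of m] by (simp add: w_def power_add mult.commute)
    then show "w m < int p ^ m" using p_pos by simp
    have "z (n + m) = z (n + Suc m) mod (int p ^ n * int p ^ m)"
      using z[unfolded padic_carrier, rule_format, of "n + m"] by (simp add: power_add)
    also have "\<dots> = int p ^ n * (z (n + Suc m) div int p ^ n mod int p ^ m) + z (n + Suc m) mod int p ^ n"
      by (rule zmod_zmult2_eq) simp
    also have "z (n + Suc m) mod int p ^ n = 0" using dvd[of "Suc m"] by simp
    finally show "w (Suc m) mod int p ^ m = w m" using p_pos by (simp add: w_def)
  qed
  moreover have "z = padic_of_int p (int p ^ n) \<otimes>\<^bsub>Zring\<^esub> w"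
  proof
    fix k
    have "(padic_of_int p (int p ^ n) \<otimes>\<^bsub>Zring\<^esub> w) k = (int p ^ n * w k) mod int p ^ k"
      by (simp add: padic_mult_at padic_of_int_def mod_mult_left_eq)
    also have "int p ^ n * w k = z (n + k)" using dvd[of k] by (simp add: w_def)
    also have "\<dots> mod int p ^ k = z k" using padic_reduce[OF z, of k n] by (simp add: add.commute)
    finally show "z k = (padic_of_int p (int p ^ n) \<otimes>\<^bsub>Zring\<^esub> w) k" by simp
  qed
  ultimately show "padic_cong p n x y"
    unfolding padic_cong_def factor_def z_def[symmetric] by blast
qed

text \<open>An element that is a unit modulo \<open>p\<close> has an inverse at every level, and
  uniqueness of inverses makes these compatible.\<close>

lemma padic_Units:
  assumes x: "x \<in> carrier Zring" and unit: "\<not> int p dvd x 1"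
  shows "x \<in> Units Zring"
proof -
  interpret cring Zring by (rule padic_cring)
  have cop: "coprime (x n) (int p ^ n)" for n
  proof (cases n)
    case (Suc m)
    have "x n mod int p = x 1" using padic_reduce[OF x, of 1 m] Suc by simp
    then have "\<not> int p dvd x n" using unit by (metis dvd_mod_iff dvd_refl)
    then show ?thesis using prime_int_p prime_imp_coprime coprime_commute by (metis coprime_power_right_iff)
  qed simp
  have "\<exists>w. 0 \<le> w \<and> w < int p ^ n \<and> [x n * w = 1] (mod int p ^ n)" for n
  proof -
    obtain w where "[x n * w = 1] (mod int p ^ n)" using cong_solve_coprime_int[OF cop] by blast
    then have "[x n * (w mod int p ^ n) = 1] (mod int p ^ n)" by (simp add: cong_def mod_mult_right_eq)
    then show ?thesis using p_pos by (intro exI[of _ "w mod int p ^ n"]) simp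
  qed
  then obtain w where w: "\<And>n. 0 \<le> w n \<and> w n < int p ^ n \<and> [x n * w n = 1] (mod int p ^ n)" by metis
  have "w \<in> carrier Zring"
    unfolding padic_carrier
  proof (intro allI conjI)
    fix n
    have "[x (Suc n) * w (Suc n) = 1] (mod int p ^ n)"
      using w[of "Suc n"] by (rule_tac cong_dvd_modulus[of _ _ "int p ^ Suc n"]) auto
    moreover have "[x (Suc n) = x n] (mod int p ^ n)" using padic_reduce[OF x, of n 1] padic_range[OF x] by (simp add: cong_def)
    ultimately have "[x n * w (Suc n) = x n * w n] (mod int p ^ n)"
      using w[of n] by (meson cong_scalar_right cong_sym cong_trans)
    then have "[w (Suc n) = w n] (mod int p ^ n)" using cop by (simp add: cong_mult_lcancel coprime_commute)
    then show "w (Suc n) mod int p ^ n = w n" using w[of n] by (simp add: cong_def)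
  qed (use w in auto)
  moreover have "x \<otimes>\<^bsub>Zring\<^esub> w = \<one>\<^bsub>Zring\<^esub>"
    using w by (auto simp: fun_eq_iff padic_ring_def cong_def)
  ultimately show ?thesis using x m_comm unfolding Units_def by force
qed

lemma padic_inv_at:
  assumes "x \<in> Units Zring"
  shows "inv\<^bsub>Zring\<^esub> x \<in> carrier Zring" "[x n * (inv\<^bsub>Zring\<^esub> x) n = 1] (mod int p ^ n)"
proof -
  interpret cring Zring by (rule padic_cring)
  show "inv\<^bsub>Zring\<^esub> x \<in> carrier Zring" using assms by simp
  have "x \<otimes>\<^bsub>Zring\<^esub> inv\<^bsub>Zring\<^esub> x = \<one>\<^bsub>Zring\<^esub>" using assms by simp
  then have "(x \<otimes>\<^bsub>Zring\<^esub> inv\<^bsub>Zring\<^esub> x) n = 1 mod int p ^ n" by (simp add: padic_ring_def)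
  then show "[x n * (inv\<^bsub>Zring\<^esub> x) n = 1] (mod int p ^ n)" by (simp add: padic_mult_at cong_def)
qed

text \<open>Transfers congruences between components, which are integers, to rationals, where units
  can be divided out.\<close>

lemma pcong_of_int: "of_int a \<simeq> of_int b \<langle>n\<rangle> \<longleftrightarrow> [a = b] (mod int p ^ n)"
proof
  assume "[a = b] (mod int p ^ n)"
  then obtain c where "a - b = int p ^ n * c" by (metis cong_iff_dvd_diff dvdE)
  then have "(of_int a - of_int b :: rat) = of_nat p ^ n * of_int c"
    by (metis of_int_diff of_int_mult of_int_power of_int_of_nat_eq)
  then show "of_int a \<simeq> of_int b \<langle>n\<rangle>" by (rule pcongI[rotated]) simp
next
  assume "of_int a \<simeq> of_int b \<langle>n\<rangle>"
  then obtain u v :: int where v: "\<not> int p dvd v" and "of_int a - of_int b = of_nat p ^ n * (of_int u / of_int v :: rat)"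
    unfolding rat_cong_def p_integral_def by blast
  moreover have "v \<noteq> 0" using v by auto
  ultimately have "(of_int a - of_int b) * of_int v = of_nat p ^ n * (of_int u :: rat)" by simp
  then have "of_int ((a - b) * v) = (of_int (int p ^ n * u) :: rat)" by simp
  then have "(a - b) * v = int p ^ n * u" using of_int_eq_iff by blast
  then have "int p ^ n dvd (a - b) * v" by simp
  moreover have "coprime (int p ^ n) v" using prime_imp_coprime[OF prime_int_p v] by simp
  ultimately have "int p ^ n dvd a - b" by (simp add: coprime_dvd_mult_left_iff)
  then show "[a = b] (mod int p ^ n)" by (simp add: cong_iff_dvd_diff)
qed

lemma padic_of_rat_at:
  assumes q: "q \<in> Zp"
  shows "padic_of_rat p q \<in> carrier Zring" "of_int (padic_of_rat p q n) \<simeq> q \<langle>n\<rangle>"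
proof -
  interpret cring Zring by (rule padic_cring)
  obtain u v where uv: "quotient_of q = (u, v)" by (cases "quotient_of q")
  have v: "v > 0" "coprime u v" and quv: "q = of_int u / of_int v"
    using quotient_of_denom_pos[OF uv] quotient_of_coprime[OF uv] quotient_of_div[OF uv] by auto
  \<comment> \<open>Membership in \<open>Zp\<close> supplies some fraction with denominator prime to
    \<open>p\<close>; \<open>padic_of_rat\<close> uses the reduced one.\<close>
  have nv: "\<not> int p dvd v"
  proof
    assume pv: "int p dvd v"
    obtain c d :: int where d: "\<not> int p dvd d" "q = of_int c / of_int d"
      using q unfolding p_integral_def by blast
    have "d \<noteq> 0" using d by auto
    then have "(of_int (u * d) :: rat) = of_int (c * v)" using d(2) quv v by (simp add: field_simps)
    then have "u * d = c * v" using of_int_eq_iff by blast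
    then have "int p dvd u * d" using pv by simp
    then have "int p dvd u" using d prime_int_p prime_dvd_mult_iff by blast
    then show False using pv v prime_int_p by (meson coprime_common_divisor not_prime_unit)
  qed
  define x where "x = padic_of_int p v"
  have xc: "x \<in> carrier Zring" unfolding x_def using padic_of_int_closed[OF p_pos] .
  have "\<not> int p dvd x 1" using nv by (simp add: x_def padic_of_int_def dvd_mod_iff)
  then have x: "x \<in> Units Zring" using padic_Units[OF xc] by blast
  have def: "padic_of_rat p q = padic_of_int p u \<otimes>\<^bsub>Zring\<^esub> inv\<^bsub>Zring\<^esub> x"
    by (simp add: padic_of_rat_def uv x_def)
  show "padic_of_rat p q \<in> carrier Zring" unfolding def using padic_of_int_closed[OF p_pos] x by simp
  have "[v * padic_of_rat p q n = x n * (u * (inv\<^bsub>Zring\<^esub> x) n)] (mod int p ^ n)"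
  proof (rule cong_mult)
    show "[v = x n] (mod int p ^ n)" by (simp add: x_def padic_of_int_def cong_def)
    show "[padic_of_rat p q n = u * (inv\<^bsub>Zring\<^esub> x) n] (mod int p ^ n)"
      unfolding def padic_mult_at by (simp add: padic_of_int_def cong_def mod_mult_left_eq)
  qed
  also have "x n * (u * (inv\<^bsub>Zring\<^esub> x) n) = u * (x n * (inv\<^bsub>Zring\<^esub> x) n)" by simp
  also have "[u * (x n * (inv\<^bsub>Zring\<^esub> x) n) = u * 1] (mod int p ^ n)"
    by (intro cong_mult cong_refl padic_inv_at x)
  finally have "of_int (v * padic_of_rat p q n) \<simeq> of_int (u * 1) \<langle>n\<rangle>" unfolding pcong_of_int .
  then have "of_int v * of_int (padic_of_rat p q n) \<simeq> of_int v * q \<langle>n\<rangle>" using quv v by simp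
  then show "of_int (padic_of_rat p q n) \<simeq> q \<langle>n\<rangle>" by (rule pcong_cancel[OF _ p_unit_of_int[OF nv]])
qed

section \<open>Wilson's theorem for prime powers and Morita's function\<close>

text \<open>Replacing multiples of \<open>p\<close> by 1 lets Morita's product run over a full
  interval, which can be split and shifted.\<close>

definition prime_to_p :: "nat \<Rightarrow> int" where
  "prime_to_p k = (if p dvd k then 1 else int k)"

lemma padic_Gamma_nat_prod: "padic_Gamma_nat p m = (-1) ^ m * (\<Prod>k<m. prime_to_p k)"
proof -
  have "(\<Prod>k | 0 < k \<and> k < m \<and> \<not> p dvd k. int k) = (\<Prod>k\<in>{..<m} \<inter> {k. \<not> p dvd k}. int k)"
    by (rule prod.cong) (auto intro: Nat.gr0I)
  also have "\<dots> = (\<Prod>k<m. prime_to_p k)"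
    unfolding prime_to_p_def by (subst prod.inter_restrict) (auto intro!: prod.cong)
  finally show ?thesis by (simp add: padic_Gamma_nat_def)
qed

lemma prod_arith_progression:
  fixes u q :: int
  shows "[(\<Prod>t<Suc s. u + int t * q) = u ^ Suc s + u ^ s * q * (\<Sum>t<Suc s. int t)] (mod q * q)"
proof (induction s)
  case (Suc s)
  define S where "S = (\<Sum>t<Suc s. int t)"
  have "[(\<Prod>t<Suc s. u + int t * q) * (u + int (Suc s) * q) = (u ^ Suc s + u ^ s * q * S) * (u + int (Suc s) * q)] (mod q * q)"
    unfolding S_def by (intro cong_mult Suc cong_refl)
  also have "(u ^ Suc s + u ^ s * q * S) * (u + int (Suc s) * q) =
      u ^ Suc (Suc s) + u ^ Suc s * q * (S + int (Suc s)) + (u ^ s * S * int (Suc s)) * (q * q)"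
    by (simp add: algebra_simps)
  also have "[\<dots> = u ^ Suc (Suc s) + u ^ Suc s * q * (S + int (Suc s))] (mod q * q)"
    by (simp add: cong_def)
  finally show ?case unfolding S_def prod.lessThan_Suc[of _ "Suc s"] sum.lessThan_Suc[of _ "Suc s"] .
qed simp

text \<open>The cofactor of \<open>x - y\<close> in \<open>x ^ p - y ^ p\<close> is congruent modulo
  \<open>p\<close> to \<open>p\<close> copies of \<open>y ^ (p - 1)\<close>, which supplies the
  extra factor \<open>p\<close>.\<close>

lemma power_p_lift:
  fixes x y :: int
  assumes "[x = y] (mod int p ^ Suc n)"
  shows "[x ^ p = y ^ p] (mod int p ^ Suc (Suc n))"
proof -
  have "[x = y] (mod int p)" using assms by (rule cong_dvd_modulus) simp
  then have "[(\<Sum>i<p. x ^ i * y ^ (p - Suc i)) = (\<Sum>i<p. y ^ i * y ^ (p - Suc i))] (mod int p)"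
    by (intro cong_sum cong_mult cong_pow cong_refl)
  also have "(\<Sum>i<p. y ^ i * y ^ (p - Suc i)) = (\<Sum>i<p. y ^ (p - 1))"
    by (intro sum.cong) (auto simp flip: power_add)
  also have "[(\<Sum>i<p. y ^ (p - 1)) = 0] (mod int p)" by (simp add: cong_def)
  finally have "int p dvd (\<Sum>i<p. y ^ (p - Suc i) * x ^ i)" by (simp add: cong_0_iff mult.commute)
  moreover have "int p ^ Suc n dvd x - y" using assms by (simp add: cong_iff_dvd_diff)
  ultimately have "int p ^ Suc n * int p dvd (x - y) * (\<Sum>i<p. y ^ (p - Suc i) * x ^ i)"
    by (intro mult_dvd_mono)
  then show ?thesis by (simp add: cong_iff_dvd_diff power_diff_sumr2 mult_ac)
qed

text \<open>Gauss's extension of Wilson's theorem. Residues for the next exponent are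
  \<open>u + t * q\<close>; for \<open>u\<close> prime to \<open>p\<close> the product over
  \<open>t\<close> is congruent to \<open>u ^ p\<close>. So the new product is the
  \<open>p\<close>-th power of the old one, and \<open>power_p_lift\<close> gains the missing power
  of \<open>p\<close>.\<close>

lemma prod_residues_mod_prime_power:
  assumes odd: "p > 2"
  shows "[(\<Prod>k<p ^ Suc n. prime_to_p k) = -1] (mod int p ^ Suc n)"
proof (induction n)
  case 0
  have "(\<Prod>k<p. prime_to_p k) = (\<Prod>k\<in>{1..p - 1}. int k)"
  proof -
    have "{..<p} = insert 0 {1..p - 1}" using p_pos by auto
    moreover have "prime_to_p k = int k" if "k \<in> {1..p - 1}" for k
      using that p_pos by (auto simp: prime_to_p_def dest!: dvd_imp_le)
    ultimately show ?thesis by (simp add: prime_to_p_def)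
  qed
  also have "\<dots> = fact (p - 1)" by (simp add: fact_prod)
  finally show ?case using wilson_theorem[OF prime_p] by simp
next
  case (Suc n)
  define q where "q = p ^ Suc n"
  have q: "int q * int p = int p ^ Suc (Suc n)" by (simp add: q_def)
  have "p dvd q" by (simp add: q_def)
  have "(\<Prod>k<p ^ Suc (Suc n). prime_to_p k) = (\<Prod>k<q * p. prime_to_p k)" by (simp add: q_def mult.commute)
  also have "\<dots> = (\<Prod>u<q. \<Prod>t<p. prime_to_p (u + t * q))"
  proof -
    have "(\<Prod>k<q * p. prime_to_p k) = (\<Prod>t<p. prod prime_to_p {t * q..<t * q + q})"
      by (simp add: prod.nat_group mult.commute)
    also have "\<dots> = (\<Prod>t<p. \<Prod>u<q. prime_to_p (u + t * q))"
    proof (rule prod.cong[OF refl])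
      fix t
      show "prod prime_to_p {t * q..<t * q + q} = (\<Prod>u<q. prime_to_p (u + t * q))"
        using prod.shift_bounds_nat_ivl[of prime_to_p 0 "t * q" q] by (simp add: lessThan_atLeast0 add.commute)
    qed
    also have "\<dots> = (\<Prod>u<q. \<Prod>t<p. prime_to_p (u + t * q))" by (rule prod.swap)
    finally show ?thesis .
  qed
  also have "[\<dots> = (\<Prod>u<q. prime_to_p u ^ p)] (mod int p ^ Suc (Suc n))"
  proof (rule cong_prod)
    fix u
    have d: "p dvd u + t * q \<longleftrightarrow> p dvd u" for t using \<open>p dvd q\<close> by (simp add: dvd_add_left_iff)
    show "[(\<Prod>t<p. prime_to_p (u + t * q)) = prime_to_p u ^ p] (mod int p ^ Suc (Suc n))"
    proof (cases "p dvd u")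
      case False
      obtain s where s: "p = Suc s" using p_pos gr0_implies_Suc by blast
      have "[(\<Prod>t<Suc s. int u + int t * int q) = int u ^ Suc s + int u ^ s * int q * (\<Sum>t<Suc s. int t)] (mod int q * int q)"
        by (rule prod_arith_progression)
      moreover have "int p ^ Suc (Suc n) dvd int q * int q" unfolding q[symmetric] by (simp add: q_def)
      ultimately have "[(\<Prod>t<p. int u + int t * int q) = int u ^ p + int u ^ s * int q * (\<Sum>t<p. int t)] (mod int p ^ Suc (Suc n))"
        unfolding s by (metis cong_dvd_modulus)
      moreover have "[int u ^ p + int u ^ s * int q * (\<Sum>t<p. int t) = int u ^ p + 0] (mod int p ^ Suc (Suc n))"
      proof (intro cong_add cong_refl)
        \<comment> \<open>The linear term carries the sum of all \<open>t\<close>, which is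
          divisible by \<open>p\<close> because \<open>p\<close> is odd.\<close>
        have "2 * (\<Sum>t<p. int t) = int p * (int p - 1)"
          by (induction p) (simp_all add: algebra_simps)
        then have "int p dvd 2 * (\<Sum>t<p. int t)" by simp
        moreover have "\<not> int p dvd 2" using odd by (auto dest: zdvd_imp_le)
        ultimately have "int p dvd (\<Sum>t<p. int t)" using prime_int_p prime_dvd_mult_iff by blast
        then have "int q * int p dvd int q * (\<Sum>t<p. int t)" by simp
        then have "int q * int p dvd int u ^ s * (int q * (\<Sum>t<p. int t))" by (rule dvd_mult)
        then show "[int u ^ s * int q * (\<Sum>t<p. int t) = 0] (mod int p ^ Suc (Suc n))"
          unfolding q by (simp add: cong_0_iff mult.assoc)
      qed
      ultimately have "[(\<Prod>t<p. int u + int t * int q) = int u ^ p] (mod int p ^ Suc (Suc n))"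
        using cong_trans by fastforce
      then show ?thesis using False by (simp add: prime_to_p_def d)
    qed (simp add: prime_to_p_def d)
  qed
  also have "(\<Prod>u<q. prime_to_p u ^ p) = (\<Prod>u<q. prime_to_p u) ^ p" by (simp add: prod_power_distrib)
  also have "[\<dots> = (-1) ^ p] (mod int p ^ Suc (Suc n))"
    unfolding q_def by (intro power_p_lift Suc)
  also have "(-1) ^ p = (-1 :: int)" using odd prime_p prime_odd_nat by simp
  finally show ?case .
qed

text \<open>Modulo \<open>p ^ n\<close>, the additional factors multiply to \<open>-1\<close>, which
  cancels the additional sign \<open>(-1) ^ (p ^ n) = -1\<close>.\<close>

lemma padic_Gamma_nat_period:
  assumes odd: "p > 2"
  shows "[padic_Gamma_nat p (m + p ^ n) = padic_Gamma_nat p m] (mod int p ^ n)"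
proof (cases n)
  case (Suc n')
  define q where "q = p ^ n"
  have pq: "p dvd q" by (simp add: q_def Suc)
  \<comment> \<open>Moving the window by one place trades a factor for a congruent one, and the unit
    \<open>prime_to_p m\<close> can be cancelled.\<close>
  have block: "[(\<Prod>k\<in>{m..<m + q}. prime_to_p k) = -1] (mod int q)" for m
  proof (induction m)
    case 0
    then show ?case using prod_residues_mod_prime_power[OF odd, of n'] by (simp add: q_def Suc lessThan_atLeast0)
  next
    case (Suc m)
    have "q > 0" using p_pos by (simp add: q_def)
    have "prime_to_p m * (\<Prod>k\<in>{Suc m..<Suc m + q}. prime_to_p k) = (\<Prod>k\<in>{m..<Suc m + q}. prime_to_p k)"
      by (simp add: prod.atLeast_Suc_lessThan)
    also have "\<dots> = (\<Prod>k\<in>{m..<m + q}. prime_to_p k) * prime_to_p (m + q)" by simp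
    also have "[\<dots> = (-1) * prime_to_p m] (mod int q)"
    proof (intro cong_mult Suc)
      have "p dvd m + q \<longleftrightarrow> p dvd m" using pq by (simp add: dvd_add_left_iff)
      then show "[prime_to_p (m + q) = prime_to_p m] (mod int q)" by (simp add: prime_to_p_def cong_def)
    qed
    finally have "[prime_to_p m * (\<Prod>k\<in>{Suc m..<Suc m + q}. prime_to_p k) = prime_to_p m * (-1)] (mod int q)"
      by (simp add: mult.commute)
    moreover have "coprime (prime_to_p m) (int q)"
    proof -
      have "coprime (int m) (int p)" if "\<not> p dvd m"
        using that prime_int_p by (metis coprime_commute int_dvd_int_iff prime_imp_coprime)
      then show ?thesis by (auto simp: prime_to_p_def q_def)
    qed
    ultimately show ?case using cong_mult_lcancel by blast
  qed
  have "(\<Prod>k<m + q. prime_to_p k) = (\<Prod>k<m. prime_to_p k) * (\<Prod>k\<in>{m..<m + q}. prime_to_p k)"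
    by (simp add: lessThan_atLeast0 prod.atLeastLessThan_concat)
  then have "padic_Gamma_nat p (m + q) = (-1) ^ q * (padic_Gamma_nat p m * (\<Prod>k\<in>{m..<m + q}. prime_to_p k))"
    by (simp add: padic_Gamma_nat_prod power_add)
  also have "[\<dots> = (-1) ^ q * (padic_Gamma_nat p m * (-1))] (mod int q)"
    by (intro cong_mult cong_refl block)
  also have "odd q" using odd prime_p prime_odd_nat by (simp add: q_def)
  then have "(-1) ^ q * (padic_Gamma_nat p m * (-1)) = padic_Gamma_nat p m" by simp
  finally show ?thesis by (simp add: q_def)
qed (simp add: cong_def)

lemma padic_Gamma_nat_cong:
  assumes odd: "p > 2" and mm: "[int m = int m'] (mod int p ^ n)"
  shows "[padic_Gamma_nat p m = padic_Gamma_nat p m'] (mod int p ^ n)"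
proof -
  have step: "[padic_Gamma_nat p (m + p ^ n * j) = padic_Gamma_nat p m] (mod int p ^ n)" for m j
  proof (induction j)
    case (Suc j)
    have "[padic_Gamma_nat p (m + p ^ n * j + p ^ n) = padic_Gamma_nat p (m + p ^ n * j)] (mod int p ^ n)"
      by (rule padic_Gamma_nat_period[OF odd])
    from cong_trans[OF this Suc] show ?case by (simp add: add_ac)
  qed simp
  have "[m = m'] (mod p ^ n)" using mm by (metis cong_int_iff of_nat_power)
  show ?thesis
  proof (cases "m \<le> m'")
    case True
    then obtain j where "m' = m + p ^ n * j"
      using \<open>[m = m'] (mod p ^ n)\<close> by (metis cong_le_nat cong_sym mult.commute add.commute)
    then show ?thesis using cong_sym[OF step] by simp
  next
    case False
    then obtain j where "m = m' + p ^ n * j"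
      using \<open>[m = m'] (mod p ^ n)\<close> by (metis cong_le_nat nat_le_linear mult.commute add.commute)
    then show ?thesis using step by simp
  qed
qed

text \<open>Periodicity shows that \<open>N = n\<close> works in the definition of the limit, so the
  limit exists and each of its components can be read off from any representative
  \<open>m\<close>.\<close>

lemma padic_Gamma_at:
  assumes odd: "p > 2" and x: "x \<in> carrier Zring"
  shows "padic_Gamma p x \<in> carrier Zring"
    and "\<And>n m. [int m = x n] (mod int p ^ n) \<Longrightarrow> [padic_Gamma p x n = padic_Gamma_nat p m] (mod int p ^ n)"
proof -
  \<comment> \<open>The summand \<open>p ^ n\<close> keeps the residue and makes the representative
    positive, as the definition of the limit demands.\<close>
  define M where "M n = nat (x n) + p ^ n" for n
  have M: "[int (M n) = x k] (mod int p ^ k)" "M n > 0" if "k \<le> n" for n k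
  proof -
    have x0: "0 \<le> x n" using x unfolding padic_carrier by blast
    have "int p ^ n mod int p ^ k = 0" using that by (simp add: le_imp_power_dvd)
    then have "int (M n) mod int p ^ k = x n mod int p ^ k" using x0 by (simp add: M_def mod_add_eq[symmetric])
    then show "[int (M n) = x k] (mod int p ^ k)"
      using padic_reduce[OF x, of k "n - k"] padic_range[OF x] that by (simp add: cong_def)
    show "M n > 0" using p_pos by (simp add: M_def)
  qed
  define y where "y n = padic_Gamma_nat p (M n) mod int p ^ n" for n
  have y_at: "[y n = padic_Gamma_nat p m] (mod int p ^ n)" if "[int m = x n] (mod int p ^ n)" for m n
  proof -
    have "[int (M n) = int m] (mod int p ^ n)" using M[of n n] that cong_sym cong_trans by blast
    from padic_Gamma_nat_cong[OF odd this] show ?thesis by (simp add: y_def cong_def)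
  qed
  have y: "y \<in> carrier Zring"
    unfolding padic_carrier
  proof (intro allI conjI)
    fix n
    show "0 \<le> y n" "y n < int p ^ n" using p_pos by (simp_all add: y_def)
    have "y (Suc n) mod int p ^ n = padic_Gamma_nat p (M (Suc n)) mod int p ^ n"
      unfolding y_def by (rule mod_mod_cancel) simp
    also have "\<dots> = y n mod int p ^ n" using y_at[OF M(1)[of n "Suc n"]] by (simp add: cong_def)
    finally show "y (Suc n) mod int p ^ n = y n" by (simp add: y_def)
  qed
  have cong_iff: "padic_cong p n (padic_of_int p b) z \<longleftrightarrow> [b = z n] (mod int p ^ n)" if "z \<in> carrier Zring" for b z n
    unfolding padic_cong_iff[OF padic_of_int_closed[OF p_pos] that]
    using padic_range[OF that, of n] by (simp add: padic_of_int_def cong_def)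
  have "padic_Gamma p x = y"
    unfolding padic_Gamma_def
  proof (rule the_equality)
    show "y \<in> carrier Zring \<and> (\<forall>n. \<exists>N. \<forall>m>0. padic_cong p N (padic_of_int p (int m)) x \<longrightarrow>
          padic_cong p n (padic_of_int p (padic_Gamma_nat p m)) y)"
      using y y_at cong_iff x by (metis cong_sym)
  next
    fix y'
    assume y': "y' \<in> carrier Zring \<and> (\<forall>n. \<exists>N. \<forall>m>0. padic_cong p N (padic_of_int p (int m)) x \<longrightarrow>
          padic_cong p n (padic_of_int p (padic_Gamma_nat p m)) y')"
    show "y' = y"
    proof
      fix n
      obtain N where N: "\<And>m. m > 0 \<Longrightarrow> [int m = x N] (mod int p ^ N) \<Longrightarrow> [padic_Gamma_nat p m = y' n] (mod int p ^ n)"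
        using y' cong_iff x by metis
      \<comment> \<open>A representative at a level beyond both \<open>N\<close> and
        \<open>n\<close> determines \<open>y'\<close> and \<open>y\<close> at once.\<close>
      have "[padic_Gamma_nat p (M (max N n)) = y' n] (mod int p ^ n)"
        by (rule N) (use M[of N "max N n"] in auto)
      moreover have "[y n = padic_Gamma_nat p (M (max N n))] (mod int p ^ n)"
        by (rule y_at) (use M[of n "max N n"] in auto)
      ultimately have "[y n = y' n] (mod int p ^ n)" using cong_trans by blast
      then show "y' n = y n" using padic_range y y' by (metis cong_def)
    qed
  qed
  then show "padic_Gamma p x \<in> carrier Zring"
    and "\<And>n m. [int m = x n] (mod int p ^ n) \<Longrightarrow> [padic_Gamma p x n = padic_Gamma_nat p m] (mod int p ^ n)"
    using y y_at by auto
qed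

end

section \<open>The p-adic Gamma function modulo the square of p\<close>

context prime_localization
begin

lemma p_unit_iff_not_dvd: "p_unit p (of_int b) \<longleftrightarrow> \<not> int p dvd b"
proof
  assume u: "p_unit p (of_int b)"
  show "\<not> int p dvd b"
  proof
    assume "int p dvd b"
    then obtain c where b: "b = int p * c" by blast
    have "of_int c * (1 / of_int b) \<in> Zp" by (intro Zp_mult Zp_of_int p_unit_Zp(2)[OF u])
    moreover have "of_int c * (1 / of_int b) = (1 / of_nat p :: rat)"
      using p_unit_Zp(3)[OF u] unfolding b by simp
    ultimately have "p_unit p (of_nat p)" using p_pos by (simp add: p_unit_def)
    then show False using not_Zp_inverse_p by blast
  qed
qed (rule p_unit_of_int)

text \<open>Modulo \<open>p\<^sup>2\<close> the \<open>p\<close>-adic Gamma function at \<open>z\<close> may be computed at any nonnegative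
  representative of \<open>z\<close>; adding \<open>p\<^sup>2\<close> makes it positive.\<close>

definition \<gamma> :: "int \<Rightarrow> rat" where
  "\<gamma> z = of_int (padic_Gamma_nat p (nat (z mod int p ^ 2) + p ^ 2))"

text \<open>Up to sign, the quotient of the Gamma values at \<open>z + 1\<close> and
  \<open>z\<close>; passing a multiple of \<open>p\<close> only changes the sign.\<close>

definition \<gamma>_factor :: "int \<Rightarrow> rat" where
  "\<gamma>_factor z = (if int p dvd z then 1 else of_int z)"

lemma \<gamma>_representative: "[z = int (nat (z mod int p ^ 2) + p ^ 2)] (mod int p ^ 2)"
  using p_pos by (simp add: cong_def)

lemma \<gamma>_nat:
  assumes "p > 2" "[z = int m] (mod int p ^ 2)"
  shows "of_int (padic_Gamma_nat p m) \<simeq> \<gamma> z \<langle>2\<rangle>"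
  unfolding \<gamma>_def pcong_of_int
  by (rule padic_Gamma_nat_cong[OF assms(1) cong_trans[OF cong_sym[OF assms(2)] \<gamma>_representative]])

lemma \<gamma>_0: "p > 2 \<Longrightarrow> \<gamma> 0 \<simeq> 1 \<langle>2\<rangle>"
  using \<gamma>_nat[of 0 0] by (intro pcong_sym[of 2 1]) (simp add: padic_Gamma_nat_prod)

lemma \<gamma>_unit: "p_unit p (\<gamma> z)"
proof -
  have u: "p_unit p (of_int (prime_to_p k))" for k
    using p_unit_of_nat[of k] by (simp add: prime_to_p_def)
  have "p_unit p ((-1) ^ m * (\<Prod>k<m. of_int (prime_to_p k)))" for m
    using p_unit_minus[OF p_unit_1] by (intro p_unit_mult p_unit_power p_unit_prod u)
  then show ?thesis by (simp add: \<gamma>_def padic_Gamma_nat_prod)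
qed

lemma \<gamma>_Zp: "\<gamma> z \<in> Zp"
  by (rule p_unit_Zp(1)[OF \<gamma>_unit])

lemma \<gamma>_Suc:
  assumes "p > 2" shows "\<gamma> (z + 1) \<simeq> - \<gamma>_factor z * \<gamma> z \<langle>2\<rangle>"
proof -
  define m where "m = nat (z mod int p ^ 2) + p ^ 2"
  have m: "[z = int m] (mod int p ^ 2)" unfolding m_def by (rule \<gamma>_representative)
  have "[z = int m] (mod int p)" using m by (rule cong_dvd_modulus) simp
  then have d: "int p dvd z \<longleftrightarrow> p dvd m" by (metis cong_dvd_iff int_dvd_int_iff)
  have "[z + 1 = int (Suc m)] (mod int p ^ 2)" using cong_add[OF m cong_refl[of 1]] by (simp add: add.commute)
  from pcong_sym[OF \<gamma>_nat[OF assms this]]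
  have "\<gamma> (z + 1) \<simeq> of_int (padic_Gamma_nat p (Suc m)) \<langle>2\<rangle>" .
  also have "of_int (padic_Gamma_nat p (Suc m)) = - of_int (prime_to_p m) * \<gamma> z"
    by (simp add: padic_Gamma_nat_prod \<gamma>_def m_def[symmetric])
  also have "\<dots> \<simeq> - \<gamma>_factor z * \<gamma> z \<langle>2\<rangle>"
  proof (rule pcong_rmult[OF pcong_minus \<gamma>_Zp])
    have "of_int (int m) \<simeq> of_int z \<langle>2\<rangle>" unfolding pcong_of_int by (rule cong_sym[OF m])
    then show "of_int (prime_to_p m) \<simeq> \<gamma>_factor z \<langle>2\<rangle>" by (simp add: prime_to_p_def \<gamma>_factor_def d)
  qed
  finally show ?thesis .
qed

lemma \<gamma>_factor_Zp: "\<gamma>_factor z \<in> Zp"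
  by (simp add: \<gamma>_factor_def)

lemma \<gamma>_descend:
  assumes "p > 2"
  shows "\<gamma> z \<simeq> \<gamma> (z - int L) * (\<Prod>l\<in>{1..L}. - \<gamma>_factor (z - int l)) \<langle>2\<rangle>"
proof (induction L)
  case (Suc L)
  have "\<gamma> z \<simeq> \<gamma> (z - int (Suc L) + 1) * (\<Prod>l\<in>{1..L}. - \<gamma>_factor (z - int l)) \<langle>2\<rangle>"
    using Suc by (simp add: algebra_simps)
  also have "\<dots> \<simeq> (- \<gamma>_factor (z - int (Suc L)) * \<gamma> (z - int (Suc L))) * (\<Prod>l\<in>{1..L}. - \<gamma>_factor (z - int l)) \<langle>2\<rangle>"
    by (intro pcong_rmult \<gamma>_Suc assms Zp_prod Zp_minus \<gamma>_factor_Zp)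
  finally show ?case by (simp add: prod.nat_ivl_Suc' mult_ac)
qed simp

text \<open>The first step leaves a multiple of \<open>p\<close> and contributes only a sign; hence
  \<open>L + 1\<close> signs but \<open>L\<close> factors.\<close>

lemma \<gamma>_ascend:
  assumes "p > 2" "int p dvd z" "L < p"
  shows "\<gamma> (z + 1 + int L) \<simeq> (-1) ^ Suc L * (\<Prod>j\<in>{1..L}. of_nat j + of_int z) * \<gamma> z \<langle>2\<rangle>"
  using assms(3)
proof (induction L)
  case 0
  then show ?case using \<gamma>_Suc[OF assms(1), of z] assms(2) by (simp add: \<gamma>_factor_def)
next
  case (Suc L)
  have "\<not> int p dvd int (Suc L)" using Suc.prems by (auto simp del: of_nat_Suc dest: dvd_imp_le)
  then have nd: "\<not> int p dvd z + 1 + int L" using assms(2) by (simp add: add.assoc dvd_add_right_iff)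
  have "\<gamma> (z + 1 + int L + 1) \<simeq> - \<gamma>_factor (z + 1 + int L) * \<gamma> (z + 1 + int L) \<langle>2\<rangle>"
    by (rule \<gamma>_Suc[OF assms(1)])
  also have "\<dots> \<simeq> - \<gamma>_factor (z + 1 + int L) * ((-1) ^ Suc L * (\<Prod>j\<in>{1..L}. of_nat j + of_int z) * \<gamma> z) \<langle>2\<rangle>"
    using Suc by (intro pcong_lmult Zp_minus \<gamma>_factor_Zp) auto
  also have "\<dots> = (-1) ^ Suc (Suc L) * (\<Prod>j\<in>{1..Suc L}. of_nat j + of_int z) * \<gamma> z"
    using nd by (simp add: \<gamma>_factor_def algebra_simps)
  finally show ?case by (simp add: add.assoc)
qed

text \<open>The reciprocals of \<open>j\<close> and \<open>p - j\<close> add up to \<open>p\<close>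
  times a \<open>p\<close>-integral number.\<close>

lemma harmonic_cong:
  assumes "p > 2" shows "(\<Sum>j\<in>{1..p - 1}. 1 / of_nat j) \<simeq> 0 \<langle>1\<rangle>"
proof -
  define S :: rat where "S = (\<Sum>j\<in>{1..p - 1}. 1 / of_nat j)"
  have u: "p_unit p (of_nat j)" "p_unit p (of_nat (p - j))" if "j \<in> {1..p - 1}" for j
    using that by (auto intro!: p_unit_of_nat dest!: dvd_imp_le)
  have "S = (\<Sum>j\<in>{1..p - 1}. 1 / of_nat (p - j))"
    unfolding S_def by (rule sum.reindex_bij_witness[of _ "\<lambda>j. p - j" "\<lambda>j. p - j"]) auto
  then have "2 * S = (\<Sum>j\<in>{1..p - 1}. 1 / of_nat j + 1 / of_nat (p - j))"
    by (simp add: S_def sum.distrib)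
  also have "\<dots> = (\<Sum>j\<in>{1..p - 1}. of_nat p * (1 / of_nat j * (1 / of_nat (p - j))))"
  proof (rule sum.cong[OF refl])
    fix j assume j: "j \<in> {1..p - 1}"
    have "p = j + (p - j)" using j by auto
    then have "of_nat p = (of_nat j + of_nat (p - j) :: rat)" by (metis of_nat_add)
    then show "1 / of_nat j + 1 / of_nat (p - j) = of_nat p * (1 / of_nat j * (1 / of_nat (p - j)) :: rat)"
      using u[OF j, THEN p_unit_Zp(3)] by (simp add: field_simps)
  qed
  also have "\<dots> = of_nat p * (\<Sum>j\<in>{1..p - 1}. 1 / of_nat j * (1 / of_nat (p - j)))"
    by (simp only: sum_distrib_left)
  also have "\<dots> \<simeq> 0 \<langle>1\<rangle>"
    using u by (intro p_pcong_0 Zp_sum Zp_mult p_unit_Zp(2)) auto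
  finally have "2 * S \<simeq> 2 * 0 \<langle>1\<rangle>" by (simp only: mult_zero_right)
  moreover have "\<not> p dvd 2" using assms by (auto dest: dvd_imp_le)
  then have "p_unit p 2" using p_unit_of_nat[of 2] by simp
  ultimately show ?thesis unfolding S_def by (rule pcong_cancel)
qed

text \<open>The first-order term of the product is \<open>p * k\<close> times a harmonic sum that is
  itself divisible by \<open>p\<close>. Hence the factor does not depend on \<open>k\<close> modulo
  \<open>p ^ 2\<close>, and values at multiples of \<open>p\<close> are powers of one unit.\<close>

lemma \<gamma>_step:
  assumes "p > 2"
  shows "\<gamma> (int p * (k + 1)) \<simeq> - fact (p - 1) * \<gamma> (int p * k) \<langle>2\<rangle>"
proof -
  have p1: "int p * k + 1 + int (p - 1) = int p * (k + 1)" "Suc (p - 1) = p"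
    using assms by (simp_all add: algebra_simps of_nat_diff)
  have odd: "(-1) ^ p = (-1 :: rat)" using assms prime_p prime_odd_nat by simp
  have "\<gamma> (int p * (k + 1)) \<simeq> (-1) * (\<Prod>j\<in>{1..p - 1}. of_nat j + of_int (int p * k)) * \<gamma> (int p * k) \<langle>2\<rangle>"
    using \<gamma>_ascend[OF assms, of "int p * k" "p - 1"] assms unfolding p1 odd by simp
  also have "\<dots> \<simeq> (-1) * fact (p - 1) * \<gamma> (int p * k) \<langle>2\<rangle>"
  proof (intro pcong_rmult pcong_lmult \<gamma>_Zp Zp_minus)
    have small: "of_int (int p * k) \<simeq> 0 \<langle>1\<rangle>" using p_pcong_0[of "of_int k"] by simp
    have u: "p_unit p (of_nat j)" if "j \<in> {1..p - 1}" for j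
      using that by (auto intro!: p_unit_of_nat dest!: dvd_imp_le)
    have "(\<Prod>j\<in>{1..p - 1}. of_nat j + of_int (int p * k)) \<simeq>
        (\<Prod>j\<in>{1..p - 1}. of_nat j) * (1 + of_int (int p * k) * (\<Sum>j\<in>{1..p - 1}. 1 / of_nat j)) \<langle>2\<rangle>"
      by (intro prod_first_order small u) auto
    also have "\<dots> \<simeq> (\<Prod>j\<in>{1..p - 1}. of_nat j) * (1 + 0) \<langle>2\<rangle>"
      using pcong_0_mult[OF small harmonic_cong[OF assms]]
      by (intro pcong_lmult pcong_add pcong_refl Zp_prod Zp_of_nat) (simp add: numeral_2_eq_2)
    also have "\<dots> = fact (p - 1)" by (simp add: fact_prod)
    finally show "(\<Prod>j\<in>{1..p - 1}. of_nat j + of_int (int p * k)) \<simeq> fact (p - 1) \<langle>2\<rangle>" .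
  qed simp
  finally show ?thesis by simp
qed

lemma fact_unit: "p_unit p (- fact (p - 1))"
proof -
  have "p_unit p (of_nat (fact (p - 1)))"
    using prime_p p_pos by (intro p_unit_of_nat) (simp add: prime_dvd_fact_iff)
  then show ?thesis using p_unit_minus by simp
qed

lemma \<gamma>_multiple:
  assumes "p > 2"
  shows "\<gamma> (int p * (k + int s)) \<simeq> (- fact (p - 1)) ^ s * \<gamma> (int p * k) \<langle>2\<rangle>"
proof (induction s)
  case (Suc s)
  have "\<gamma> (int p * (k + int s + 1)) \<simeq> - fact (p - 1) * \<gamma> (int p * (k + int s)) \<langle>2\<rangle>"
    by (rule \<gamma>_step[OF assms])
  also have "\<dots> \<simeq> - fact (p - 1) * ((- fact (p - 1)) ^ s * \<gamma> (int p * k)) \<langle>2\<rangle>"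
    by (rule pcong_lmult[OF Suc p_unit_Zp(1)[OF fact_unit]])
  finally show ?case by (simp add: algebra_simps)
qed simp

text \<open>Bundling the unit property with the congruence makes the relation compatible with
  division.\<close>

definition unit_cong :: "rat \<Rightarrow> rat \<Rightarrow> bool" (infix \<open>\<approx>\<close> 50) where
  "x \<approx> y \<longleftrightarrow> p_unit p x \<and> p_unit p y \<and> x \<simeq> y \<langle>2\<rangle>"

lemma unit_congI: "x \<simeq> y \<langle>2\<rangle> \<Longrightarrow> p_unit p y \<Longrightarrow> x \<approx> y"
  unfolding unit_cong_def using pcong_unit[of 2 x y] by auto

lemma unit_cong_mult: "x \<approx> y \<Longrightarrow> z \<approx> w \<Longrightarrow> x * z \<approx> y * w"
  unfolding unit_cong_def by (auto intro: p_unit_mult pcong_mult p_unit_Zp)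

lemma unit_cong_power: "x \<approx> y \<Longrightarrow> x ^ k \<approx> y ^ k"
  unfolding unit_cong_def by (auto intro: p_unit_power pcong_power p_unit_Zp)

lemma unit_cong_divide: "x \<approx> y \<Longrightarrow> z \<approx> w \<Longrightarrow> x / z \<approx> y / w"
  using unit_cong_mult[of x y "1 / z" "1 / w"]
  unfolding unit_cong_def by (auto intro: p_unit_inverse pcong_inverse)

lemma unit_cong_trans [trans]: "x \<approx> y \<Longrightarrow> y \<approx> z \<Longrightarrow> x \<approx> z"
  unfolding unit_cong_def using pcong_trans by blast

lemma unit_cong_refl: "p_unit p x \<Longrightarrow> x \<approx> x"
  unfolding unit_cong_def by simp

end

section \<open>The supercongruence\<close>

context perturbed_sum
begin

text \<open>The integer \<open>\<rho>\<close> stands for \<open>a\<close> modulo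
  \<open>p ^ 2\<close>. Walking from \<open>z\<close>, \<open>2 * z\<close> and \<open>- z\<close>,
  where \<open>z\<close> represents \<open>\<pi>\<close>, to the three arguments expresses each
  Gamma value by a power of \<open>u\<close> and an explicit product.\<close>

lemma \<gamma>_cong_ratio:
  obtains \<rho> :: int where "of_int \<rho> \<simeq> a \<langle>2\<rangle>"
    and "80 * of_int r / 81 * (\<gamma> (1 + \<rho>) ^ 2 / (\<gamma> (1 + 2 * \<rho>) ^ 3 * \<gamma> (1 - \<rho>) ^ 4)) \<simeq>
      10 / 27 * (Y / pochhammer 1 n) ^ 3 \<langle>2\<rangle>"
proof -
  have p2: "p > 2" using p_gt by simp
  have "\<not> p dvd 3" using p_gt by (auto dest: dvd_imp_le)
  then have "coprime 3 p" using prime_p by (metis coprime_commute prime_imp_coprime)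
  \<comment> \<open>As \<open>t\<close> inverts 3 modulo \<open>p\<close>, the integer
    \<open>p * (2 * t)\<close> represents \<open>\<pi> = 2 * p / 3\<close> modulo
    \<open>p ^ 2\<close>.\<close>
  then obtain t :: nat where t: "[3 * t = 1] (mod p)" using cong_solve_coprime_nat by auto
  define q :: rat where "q = of_nat p * of_nat (2 * t)"
  define z :: int where "z = int p * int (2 * t)"
  have zq: "of_int z = q" by (simp add: z_def q_def)
  have q_cong: "q \<simeq> \<pi> \<langle>2\<rangle>"
  proof -
    have "[int (3 * t) = int 1] (mod int p ^ 1)" using t unfolding power_one_right by (simp only: cong_int_iff)
    then have "of_int (int (3 * t)) \<simeq> of_int (int 1) \<langle>1\<rangle>" unfolding pcong_of_int .
    then have "3 * of_nat t \<simeq> 3 * (1 / 3) \<langle>1\<rangle>" by simp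
    then have "of_nat t \<simeq> 1 / 3 \<langle>1\<rangle>" by (rule pcong_cancel[OF _ p_unit_3])
    from pcong_lmult[OF this Zp_numeral(1)] have "2 * of_nat t \<simeq> 2 * (1 / 3) \<langle>1\<rangle>" .
    from pcong_scale[OF this, of 1] show ?thesis by (simp add: q_def \<pi>_def numeral_2_eq_2 mult.commute)
  qed
  have q_small: "q \<simeq> 0 \<langle>1\<rangle>" unfolding q_def by (intro p_pcong_0 Zp_of_nat)
  have qZ: "q \<in> Zp" using q_small pcong_Zp by auto
  define \<rho> where "\<rho> = z - int n"
  have a: "of_int \<rho> \<simeq> a \<langle>2\<rangle>"
  proof -
    have "q - of_nat n \<simeq> \<pi> - of_nat n \<langle>2\<rangle>" by (intro pcong_diff q_cong pcong_refl)
    moreover have "\<pi> - of_nat n = a" using a_plus_n by simp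
    ultimately show ?thesis by (simp add: \<rho>_def zq)
  qed
  define u :: rat where "u = (- fact (p - 1)) ^ (2 * t)"
  have u: "p_unit p u" unfolding u_def by (rule p_unit_power[OF fact_unit])
  have \<gamma>0: "\<gamma> 0 \<simeq> 1 \<langle>2\<rangle>" by (rule \<gamma>_0[OF p2])
  have \<gamma>q: "\<gamma> z \<approx> u"
  proof (rule unit_congI[OF _ u])
    have "\<gamma> z \<simeq> u * \<gamma> 0 \<langle>2\<rangle>" using \<gamma>_multiple[OF p2, of 0 "2 * t"] by (simp add: z_def u_def)
    also have "\<dots> \<simeq> u * 1 \<langle>2\<rangle>" by (intro pcong_lmult \<gamma>0 p_unit_Zp(1)[OF u])
    finally show "\<gamma> z \<simeq> u \<langle>2\<rangle>" by simp
  qed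
  have \<gamma>2q: "\<gamma> (2 * z) \<approx> u ^ 2"
  proof (rule unit_congI[OF _ p_unit_power[OF u]])
    have "2 * z = int p * (int (2 * t) + int (2 * t))" by (simp add: z_def)
    then have "\<gamma> (2 * z) \<simeq> u * \<gamma> z \<langle>2\<rangle>" using \<gamma>_multiple[OF p2, of "int (2 * t)" "2 * t"] by (simp only: z_def u_def)
    also have "\<dots> \<simeq> u * u \<langle>2\<rangle>" using \<gamma>q by (intro pcong_lmult p_unit_Zp(1)[OF u]) (simp add: unit_cong_def)
    finally show "\<gamma> (2 * z) \<simeq> u ^ 2 \<langle>2\<rangle>" by (simp add: power2_eq_square)
  qed
  have \<gamma>mq: "\<gamma> (- z) \<approx> 1 / u"
  proof (rule unit_congI[OF pcong_cancel[OF _ u] p_unit_inverse[OF u]])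
    have "u * \<gamma> (- z) \<simeq> \<gamma> 0 \<langle>2\<rangle>"
      using pcong_sym[OF \<gamma>_multiple[OF p2, of "- int (2 * t)" "2 * t"]] by (simp add: z_def u_def)
    also have "\<dots> \<simeq> u * (1 / u) \<langle>2\<rangle>" using \<gamma>0 p_unit_Zp(3)[OF u] by simp
    finally show "u * \<gamma> (- z) \<simeq> u * (1 / u) \<langle>2\<rangle>" .
  qed
  have zdvd: "int p dvd z" by (simp add: z_def)
  have near: "p_unit p (of_nat l + y)" if "\<not> p dvd l" "y \<simeq> 0 \<langle>1\<rangle>" for l y
    by (intro p_unit_near p_unit_of_nat that)
  have small: "- q \<simeq> 0 \<langle>1\<rangle>" "- (2 * q) \<simeq> 0 \<langle>1\<rangle>" "- (2 * \<pi>) \<simeq> 0 \<langle>1\<rangle>"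
    using pcong_minus[OF q_small] pcong_minus[OF pcong_lmult[OF q_small, of 2]]
      pcong_minus[OF pcong_lmult[OF \<pi>_small, of 2]] by simp_all
  have nd: "\<not> p dvd l" if "l \<in> {1..n}" for l using that n_bounds by (auto dest!: dvd_imp_le)
  have nd2: "\<not> p dvd l" if "l \<in> {1..2 * n} - {p}" for l
  proof
    assume "p dvd l"
    then obtain k where k: "l = p * k" by auto
    have "l \<le> 2 * n" using that by auto
    then have "p * k < p * 2" using n_bounds unfolding k by linarith
    then have "k < 2" by simp
    moreover have "k \<noteq> 0" "k \<noteq> 1" using k that by auto
    ultimately show False by simp
  qed
  define V' where "V' = (\<Prod>l\<in>{1..n - 1}. of_nat l + - q)"
  define V where "V = (\<Prod>l\<in>{1..n}. of_nat l + - q)"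
  define D' where "D' = (\<Prod>l\<in>{1..2 * n - 1} - {p}. of_nat l + - (2 * q))"
  define D where "D = (\<Prod>l\<in>{1..2 * n} - {p}. of_nat l + - (2 * q))"
  have uV': "p_unit p V'" unfolding V'_def by (intro p_unit_prod near nd small) auto
  have uV: "p_unit p V" unfolding V_def by (intro p_unit_prod near nd small) auto
  have uD': "p_unit p D'" unfolding D'_def by (intro p_unit_prod near nd2 small) auto
  have \<gamma>1: "\<gamma> (1 + \<rho>) \<approx> u / V'"
  proof -
    have "(\<Prod>l\<in>{1..n - 1}. - \<gamma>_factor (z - int l)) = V'"
      unfolding V'_def
    proof (rule prod.cong[OF refl])
      fix l assume "l \<in> {1..n - 1}"
      then have "\<not> p dvd l" by (intro nd) auto
      then have "\<not> int p dvd z - int l" using zdvd by (simp add: dvd_diff_right_iff)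
      then show "- \<gamma>_factor (z - int l) = of_nat l + - q" by (simp add: \<gamma>_factor_def zq)
    qed
    moreover have "z - int (n - 1) = 1 + \<rho>" using n_bounds by (simp add: \<rho>_def of_nat_diff)
    ultimately have "\<gamma> z \<simeq> \<gamma> (1 + \<rho>) * V' \<langle>2\<rangle>" using \<gamma>_descend[OF p2, of z "n - 1"] by metis
    then have "\<gamma> (1 + \<rho>) * V' \<approx> \<gamma> z"
      by (intro unit_congI[OF pcong_sym] \<gamma>_unit)
    then have "\<gamma> (1 + \<rho>) * V' / V' \<approx> u / V'"
      by (intro unit_cong_divide unit_cong_refl uV') (rule unit_cong_trans[OF _ \<gamma>q])
    then show ?thesis using p_unit_Zp(3)[OF uV'] by simp
  qed
  have \<gamma>2: "\<gamma> (1 + 2 * \<rho>) \<approx> u ^ 2 / - D'"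
  proof -
    have "(\<Prod>l\<in>{1..2 * n - 1}. - \<gamma>_factor (2 * z - int l))
       = - \<gamma>_factor (2 * z - int p) * (\<Prod>l\<in>{1..2 * n - 1} - {p}. - \<gamma>_factor (2 * z - int l))"
      using n_bounds by (intro prod.remove) auto
    \<comment> \<open>At \<open>l = p\<close> the argument is a multiple of \<open>p\<close>, so
      only a sign remains; it is the minus in front of \<open>D'\<close>.\<close>
    also have "- \<gamma>_factor (2 * z - int p) = -1" using zdvd by (simp add: \<gamma>_factor_def)
    also have "(\<Prod>l\<in>{1..2 * n - 1} - {p}. - \<gamma>_factor (2 * z - int l)) = D'"
      unfolding D'_def
    proof (rule prod.cong[OF refl])
      fix l assume "l \<in> {1..2 * n - 1} - {p}"
      then have "\<not> p dvd l" by (intro nd2) auto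
      then have "\<not> int p dvd 2 * z - int l" using zdvd by (simp add: dvd_diff_right_iff)
      then show "- \<gamma>_factor (2 * z - int l) = of_nat l + - (2 * q)" by (simp add: \<gamma>_factor_def zq)
    qed
    finally have "(\<Prod>l\<in>{1..2 * n - 1}. - \<gamma>_factor (2 * z - int l)) = - D'" by simp
    moreover have "2 * z - int (2 * n - 1) = 1 + 2 * \<rho>" using n_bounds by (simp add: \<rho>_def of_nat_diff)
    ultimately have "\<gamma> (2 * z) \<simeq> \<gamma> (1 + 2 * \<rho>) * - D' \<langle>2\<rangle>" using \<gamma>_descend[OF p2, of "2 * z" "2 * n - 1"] by metis
    then have "\<gamma> (1 + 2 * \<rho>) * - D' \<approx> \<gamma> (2 * z)"
      by (intro unit_congI[OF pcong_sym] \<gamma>_unit)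
    then have "\<gamma> (1 + 2 * \<rho>) * - D' / - D' \<approx> u ^ 2 / - D'"
      by (intro unit_cong_divide unit_cong_refl p_unit_minus uD') (rule unit_cong_trans[OF _ \<gamma>2q])
    then show ?thesis using p_unit_Zp(3)[OF uD'] by simp
  qed
  have \<gamma>3: "\<gamma> (1 - \<rho>) \<approx> (-1) ^ Suc n * V * (1 / u)"
  proof -
    have e: "- z + 1 + int n = 1 - \<rho>" by (simp add: \<rho>_def)
    have "int p dvd - z" using zdvd by simp
    from \<gamma>_ascend[OF p2 this n_bounds(1)]
    have "\<gamma> (1 - \<rho>) \<simeq> (-1) ^ Suc n * V * \<gamma> (- z) \<langle>2\<rangle>"
      unfolding e V_def of_int_minus zq .
    moreover have s: "p_unit p ((-1) ^ Suc n * V)"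
      using p_unit_minus[OF p_unit_1] by (intro p_unit_mult p_unit_power uV)
    ultimately have "\<gamma> (1 - \<rho>) \<approx> (-1) ^ Suc n * V * \<gamma> (- z)"
      by (intro unit_congI p_unit_mult[OF s] \<gamma>_unit)
    also have "\<dots> \<approx> (-1) ^ Suc n * V * (1 / u)" by (intro unit_cong_mult unit_cong_refl s \<gamma>mq)
    finally show ?thesis .
  qed
  \<comment> \<open>The last factor of \<open>V\<close>, and half of the last factor of
    \<open>D\<close>. It represents \<open>- a\<close> and will cancel the factor \<open>r\<close>
    of the constant.\<close>
  define m where "m = of_nat n + - q"
  have m: "p_unit p m" unfolding m_def using n_bounds by (intro near nd small) auto
  have Vm: "V = V' * m"
  proof -
    obtain n' where n': "n = Suc n'" using n_bounds gr0_implies_Suc by blast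
    show ?thesis unfolding V_def V'_def m_def n' by (simp add: prod.nat_ivl_Suc' del: of_nat_Suc)
  qed
  have Dm: "D = D' * (2 * m)"
  proof -
    have ins: "{1..2 * n} - {p} = insert (2 * n) ({1..2 * n - 1} - {p})" using n_bounds by auto
    have "D = (of_nat (2 * n) + - (2 * q)) * D'"
      unfolding D_def D'_def ins using n_bounds by (subst prod.insert) auto
    then show ?thesis by (simp add: m_def algebra_simps)
  qed
  define K where "K = pochhammer (1 + - (2 * \<pi>)) n"
  have K: "p_unit p K" unfolding K_def by (intro p_unit_pochhammer_1 small) simp
  have f: "p_unit p (pochhammer 1 n)" by (rule p_unit_pochhammer_1n)
  have V_cong: "V \<approx> pochhammer (1 + - \<pi>) n"
  proof (rule unit_congI)
    have e: "pochhammer (1 + - \<pi>) n = (\<Prod>l\<in>{1..n}. of_nat l + - \<pi>)"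
      unfolding pochhammer_prod
      by (rule prod.reindex_bij_witness[of _ "\<lambda>l. l - 1" Suc]) (auto simp: of_nat_diff)
    show "V \<simeq> pochhammer (1 + - \<pi>) n \<langle>2\<rangle>"
      unfolding V_def e by (intro pcong_prod pcong_add pcong_minus q_cong pcong_refl Zp_add Zp_minus \<pi>_Zp Zp_of_nat)
    show "p_unit p (pochhammer (1 + - \<pi>) n)" by (intro p_unit_pochhammer_1 minus_\<pi>_small) simp
  qed
  \<comment> \<open>The factors up to \<open>n\<close> form \<open>K\<close>; those above
    \<open>n\<close>, with \<open>p\<close> left out, form \<open>Y\<close>.\<close>
  have D_cong: "D \<approx> K * Y"
  proof (rule unit_congI)
    have K': "K = (\<Prod>l\<in>{1..n}. of_nat l + - (2 * \<pi>))"
      unfolding K_def pochhammer_prod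
      by (rule prod.reindex_bij_witness[of _ "\<lambda>l. l - 1" Suc]) (auto simp: of_nat_diff)
    have Y': "Y = (\<Prod>l\<in>{n<..2 * n} - {p}. of_nat l + - (2 * \<pi>))"
      unfolding Y_def R_def
    proof (rule prod.reindex_bij_witness[of _ "\<lambda>l. l - n - 1" "\<lambda>i. n + 1 + i"])
      fix i assume "i \<in> {..<n - 0} - {i0}"
      then show "n + 1 + i \<in> {n<..2 * n} - {p}" using n_bounds by (auto simp: i0_def)
    next
      fix l assume "l \<in> {n<..2 * n} - {p}"
      then show "l - n - 1 \<in> {..<n - 0} - {i0}" using n_bounds by (auto simp: i0_def)
    next
      fix i
      show "of_nat (n + 1 + i) + - (2 * \<pi>) = 1 - a + of_nat i + - \<pi>"
        unfolding one_minus_a by simp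
    qed auto
    have un: "{1..2 * n} - {p} = {1..n} \<union> ({n<..2 * n} - {p})" using n_bounds by auto
    have KY: "K * Y = (\<Prod>l\<in>{1..2 * n} - {p}. of_nat l + - (2 * \<pi>))"
      unfolding K' Y' un by (rule prod.union_disjoint[symmetric]) auto
    show "D \<simeq> K * Y \<langle>2\<rangle>"
      unfolding D_def KY
      by (intro pcong_prod pcong_add pcong_minus pcong_lmult q_cong pcong_refl Zp_add Zp_minus Zp_mult \<pi>_Zp Zp_of_nat Zp_numeral)
    show "p_unit p (K * Y)" by (intro p_unit_mult K p_unit_Y)
  qed
  \<comment> \<open>Both sides have the first-order term \<open>- (2 * \<pi>) * Hn\<close>; with
    this, \<open>K\<close> cancels in \<open>D ^ 3 / (V ^ 2) ^ 3\<close>.\<close>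
  have V2: "V ^ 2 \<approx> pochhammer 1 n * K"
  proof -
    have "first_order (pochhammer (1 + - \<pi>) n * pochhammer (1 + - \<pi>) n) (pochhammer 1 n * pochhammer 1 n) (- \<pi> * Hn + - \<pi> * Hn)"
      by (intro first_order_mult first_order_1 minus_\<pi>_small)
    moreover have "first_order (pochhammer 1 n * K) (pochhammer 1 n * pochhammer 1 n) (0 + - (2 * \<pi>) * Hn)"
      unfolding K_def by (intro first_order_mult first_order_1 first_order_const small p_unit_Zp(1)[OF f])
    moreover have "- \<pi> * Hn + - \<pi> * Hn = 0 + - (2 * \<pi>) * Hn" by simp
    ultimately have "pochhammer (1 + - \<pi>) n ^ 2 \<simeq> pochhammer 1 n * K \<langle>2\<rangle>"
      unfolding first_order_def power2_eq_square by (metis pcong_trans pcong_sym)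
    then have "pochhammer (1 + - \<pi>) n ^ 2 \<approx> pochhammer 1 n * K" by (intro unit_congI p_unit_mult f K)
    from unit_cong_trans[OF unit_cong_power[OF V_cong] this] show ?thesis .
  qed
  have m_cong: "m \<approx> - (of_int r / 3)"
  proof (rule unit_congI)
    have "- (of_int r / 3) = of_nat n + - \<pi>" using a_plus_n by (simp add: a_def)
    moreover have "m \<simeq> of_nat n + - \<pi> \<langle>2\<rangle>" unfolding m_def by (intro pcong_add pcong_minus q_cong pcong_refl)
    moreover have "p_unit p (of_nat n + - \<pi>)" using n_bounds by (intro near nd minus_\<pi>_small) auto
    ultimately show "m \<simeq> - (of_int r / 3) \<langle>2\<rangle>" "p_unit p (- (of_int r / 3))" by simp_all
  qed
  have r0: "of_int r \<noteq> (0 :: rat)" using not3 by auto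
  have nz: "u \<noteq> 0" "V' \<noteq> 0" "m \<noteq> 0" "D' \<noteq> 0" "K \<noteq> 0" "pochhammer 1 n \<noteq> (0::rat)"
    using p_unit_Zp(3) u uV' m uD' K f by auto
  have "\<gamma> (1 + \<rho>) ^ 2 / (\<gamma> (1 + 2 * \<rho>) ^ 3 * \<gamma> (1 - \<rho>) ^ 4) \<approx>
     (u / V') ^ 2 / ((u ^ 2 / - D') ^ 3 * ((-1) ^ Suc n * V * (1 / u)) ^ 4)"
    by (intro unit_cong_divide unit_cong_mult unit_cong_power \<gamma>1 \<gamma>2 \<gamma>3)
  \<comment> \<open>The exponents of \<open>u\<close> add up to \<open>2 - 6 + 4 = 0\<close>, so the
    unknown unit disappears.\<close>
  also have "(u / V') ^ 2 / ((u ^ 2 / - D') ^ 3 * ((-1) ^ Suc n * V * (1 / u)) ^ 4) = - (D ^ 3 / (8 * (m * (V ^ 2) ^ 3)))"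
  proof -
    have sg: "((-1) ^ Suc n * V * (1 / u)) ^ 4 = (V * (1 / u)) ^ 4"
    proof -
      have "((-1) ^ Suc n) ^ 4 = (1 :: rat)" by (simp only: power_mult[symmetric]) simp
      then show ?thesis by (simp only: mult.assoc power_mult_distrib mult_1)
    qed
    show ?thesis unfolding sg Vm Dm using nz
      by (simp add: field_simps power_mult_distrib power_divide eval_nat_numeral)
  qed
  finally have "\<gamma> (1 + \<rho>) ^ 2 / (\<gamma> (1 + 2 * \<rho>) ^ 3 * \<gamma> (1 - \<rho>) ^ 4) \<approx> - (D ^ 3 / (8 * (m * (V ^ 2) ^ 3)))" .
  then have "80 * of_int r / 81 * (\<gamma> (1 + \<rho>) ^ 2 / (\<gamma> (1 + 2 * \<rho>) ^ 3 * \<gamma> (1 - \<rho>) ^ 4)) \<simeq>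
      80 * of_int r / 81 * - (D ^ 3 / (8 * (m * (V ^ 2) ^ 3))) \<langle>2\<rangle>"
    using p_unit_power[OF p_unit_3, of 4] unfolding unit_cong_def
    by (intro pcong_lmult p_unit_divide) (auto intro: Zp_mult)
  also have "80 * of_int r / 81 * - (D ^ 3 / (8 * (m * (V ^ 2) ^ 3))) = - (10 * of_int r / 81) * (D ^ 3 / (m * (V ^ 2) ^ 3))"
    using nz by (simp add: field_simps)
  also have "\<dots> \<simeq> - (10 * of_int r / 81) * ((K * Y) ^ 3 / (- (of_int r / 3) * (pochhammer 1 n * K) ^ 3)) \<langle>2\<rangle>"
  proof (rule pcong_lmult)
    have "D ^ 3 / (m * (V ^ 2) ^ 3) \<approx> (K * Y) ^ 3 / (- (of_int r / 3) * (pochhammer 1 n * K) ^ 3)"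
      by (intro unit_cong_divide unit_cong_mult unit_cong_power D_cong V2 m_cong)
    then show "D ^ 3 / (m * (V ^ 2) ^ 3) \<simeq> (K * Y) ^ 3 / (- (of_int r / 3) * (pochhammer 1 n * K) ^ 3) \<langle>2\<rangle>"
      by (simp add: unit_cong_def)
    show "- (10 * of_int r / 81) \<in> Zp"
      using p_unit_power[OF p_unit_3, of 4] by (intro Zp_minus p_unit_divide) (auto intro: Zp_mult)
  qed
  also have "- (10 * of_int r / 81) * ((K * Y) ^ 3 / (- (of_int r / 3) * (pochhammer 1 n * K) ^ 3)) = 10 / 27 * (Y / pochhammer 1 n) ^ 3"
    using nz r0 by (simp add: field_simps power_mult_distrib power_divide)
  finally have main: "80 * of_int r / 81 * (\<gamma> (1 + \<rho>) ^ 2 / (\<gamma> (1 + 2 * \<rho>) ^ 3 * \<gamma> (1 - \<rho>) ^ 4)) \<simeq>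
      10 / 27 * (Y / pochhammer 1 n) ^ 3 \<langle>2\<rangle>" .
  show ?thesis by (rule that[OF a main])
qed

lemma Gamma_at_2:
  assumes x: "x \<in> Zp" and z: "of_int z \<simeq> x \<langle>2\<rangle>"
  shows "of_int (padic_Gamma p (padic_of_rat p x) 2) \<simeq> \<gamma> z \<langle>2\<rangle>"
proof -
  have p2: "p > 2" using p_gt by simp
  define m where "m = nat (z mod int p ^ 2) + p ^ 2"
  have m: "[z = int m] (mod int p ^ 2)" unfolding m_def by (rule \<gamma>_representative)
  have "of_int z \<simeq> of_int (padic_of_rat p x 2) \<langle>2\<rangle>"
    by (rule pcong_trans[OF z pcong_sym[OF padic_of_rat_at(2)[OF x]]])
  then have "[int m = padic_of_rat p x 2] (mod int p ^ 2)"
    unfolding pcong_of_int using m cong_sym cong_trans by blast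
  from padic_Gamma_at(2)[OF p2 padic_of_rat_at(1)[OF x] this]
  have "of_int (padic_Gamma p (padic_of_rat p x) 2) \<simeq> of_int (padic_Gamma_nat p m) \<langle>2\<rangle>"
    unfolding pcong_of_int .
  also have "\<dots> \<simeq> \<gamma> z \<langle>2\<rangle>" by (rule \<gamma>_nat[OF p2 m])
  finally show ?thesis .
qed

text \<open>\<open>n\<close> and \<open>r\<close> have the same parity because
  \<open>3 * n + r = 2 * p\<close>.\<close>

lemma sign_eq: "(-1) powi (r + 1) = - ((-1) ^ n :: rat)"
proof -
  have "even (r + 1) \<longleftrightarrow> odd n"
  proof -
    have "even (3 * int n) \<longleftrightarrow> even (2 * int p - r)" using n_eq by simp
    then show ?thesis by simp
  qed
  then show ?thesis by (cases "even n") (simp_all add: power_int_minus_one_minus power_int_minus_left)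
qed

lemma supercongruence:
  "padic_cong p 6
    (padic_of_rat p
      (\<Sum>k = 0..p - 1. (6 * of_nat k + of_int r) *
        (pochhammer a k ^ 6 / pochhammer 1 k ^ 6)))
    (padic_of_rat p ((-1) powi (r + 1) * 80 * of_int r * of_nat p ^ 4 / 81)
      \<otimes>\<^bsub>Zring\<^esub>
        (padic_Gamma p (padic_of_rat p (1 + a)) [^]\<^bsub>Zring\<^esub> (2::nat)
          \<otimes>\<^bsub>Zring\<^esub> inv\<^bsub>Zring\<^esub>
           (padic_Gamma p (padic_of_rat p (1 + 2 * a)) [^]\<^bsub>Zring\<^esub> (3::nat)
            \<otimes>\<^bsub>Zring\<^esub>
            padic_Gamma p (padic_of_rat p (1 - a)) [^]\<^bsub>Zring\<^esub> (4::nat)))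
      \<otimes>\<^bsub>Zring\<^esub> padic_of_rat p F0)"
proof -
  interpret Zring: cring Zring by (rule padic_cring)
  have p2: "p > 2" using p_gt by simp
  define S where "S = (\<Sum>k = 0..p - 1. (6 * of_nat k + of_int r) * (pochhammer a k ^ 6 / pochhammer 1 k ^ 6))"
  define c' where "c' = (-1) powi (r + 1) * (80 * of_int r / 81 :: rat)"
  define c where "c = (-1) powi (r + 1) * 80 * of_int r * of_nat p ^ 4 / (81 :: rat)"
  have c: "c = of_nat p ^ 4 * c'" by (simp add: c_def c'_def)
  have c'Z: "c' \<in> Zp"
    unfolding c'_def sign_eq using p_unit_power[OF p_unit_3, of 4]
    by (intro Zp_mult Zp_minus Zp_power p_unit_divide Zp_of_int Zp_numeral) simp_all
  have cZ: "c \<in> Zp" unfolding c by (intro Zp_mult Zp_power c'Z) simp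
  obtain \<rho> where \<rho>: "of_int \<rho> \<simeq> a \<langle>2\<rangle>"
    and ratio: "80 * of_int r / 81 * (\<gamma> (1 + \<rho>) ^ 2 / (\<gamma> (1 + 2 * \<rho>) ^ 3 * \<gamma> (1 - \<rho>) ^ 4)) \<simeq>
      10 / 27 * (Y / pochhammer 1 n) ^ 3 \<langle>2\<rangle>"
    by (rule \<gamma>_cong_ratio)
  define G1 G2 G3 where "G1 = padic_Gamma p (padic_of_rat p (1 + a))"
    and "G2 = padic_Gamma p (padic_of_rat p (1 + 2 * a))" and "G3 = padic_Gamma p (padic_of_rat p (1 - a))"
  have aZ: "1 + a \<in> Zp" "1 + 2 * a \<in> Zp" "1 - a \<in> Zp"
    by (intro Zp_add Zp_diff Zp_mult a_Zp Zp_numeral)+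
  have carr: "G1 \<in> carrier Zring" "G2 \<in> carrier Zring" "G3 \<in> carrier Zring"
    unfolding G1_def G2_def G3_def by (intro padic_Gamma_at(1) p2 padic_of_rat_at(1) aZ)+
  have "of_int (1 + \<rho>) \<simeq> 1 + a \<langle>2\<rangle>" "of_int (1 + 2 * \<rho>) \<simeq> 1 + 2 * a \<langle>2\<rangle>" "of_int (1 - \<rho>) \<simeq> 1 - a \<langle>2\<rangle>"
    unfolding of_int_add of_int_diff of_int_mult of_int_1 of_int_numeral
    by (intro pcong_add pcong_diff pcong_lmult pcong_refl \<rho> Zp_numeral)+
  then have g: "of_int (G1 2) \<approx> \<gamma> (1 + \<rho>)" "of_int (G2 2) \<approx> \<gamma> (1 + 2 * \<rho>)" "of_int (G3 2) \<approx> \<gamma> (1 - \<rho>)"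
    unfolding G1_def G2_def G3_def using aZ by (auto intro!: unit_congI Gamma_at_2 \<gamma>_unit simp del: of_int_add of_int_diff)
  define B where "B = G2 [^]\<^bsub>Zring\<^esub> (3::nat) \<otimes>\<^bsub>Zring\<^esub> G3 [^]\<^bsub>Zring\<^esub> (4::nat)"
  have Bc: "B \<in> carrier Zring" using carr by (simp add: B_def)
  have uB: "p_unit p (\<gamma> (1 + 2 * \<rho>) ^ 3 * \<gamma> (1 - \<rho>) ^ 4)"
    by (intro p_unit_mult p_unit_power \<gamma>_unit)
  have B2: "of_int (B 2) \<approx> \<gamma> (1 + 2 * \<rho>) ^ 3 * \<gamma> (1 - \<rho>) ^ 4"
  proof (rule unit_congI[OF _ uB])
    have "B 2 mod int p ^ 2 = (G2 2 ^ 3 * G3 2 ^ 4) mod int p ^ 2"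
      by (simp add: B_def padic_mult_at padic_pow_at mod_mult_eq)
    then have "of_int (B 2) \<simeq> of_int (G2 2 ^ 3 * G3 2 ^ 4) \<langle>2\<rangle>"
      unfolding pcong_of_int cong_def .
    also have "of_int (G2 2 ^ 3 * G3 2 ^ 4) = of_int (G2 2) ^ 3 * (of_int (G3 2) ^ 4 :: rat)" by simp
    also have "\<dots> \<simeq> \<gamma> (1 + 2 * \<rho>) ^ 3 * \<gamma> (1 - \<rho>) ^ 4 \<langle>2\<rangle>"
      using unit_cong_mult[OF unit_cong_power[OF g(2)] unit_cong_power[OF g(3)], of 3 4] by (simp add: unit_cong_def)
    finally show "of_int (B 2) \<simeq> \<gamma> (1 + 2 * \<rho>) ^ 3 * \<gamma> (1 - \<rho>) ^ 4 \<langle>2\<rangle>" .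
  qed
  have "\<not> int p dvd B 2" using B2 p_unit_iff_not_dvd unfolding unit_cong_def by blast
  moreover have "B 2 mod int p = B 1" using padic_reduce[OF Bc, of 1 1] by (simp add: numeral_2_eq_2)
  ultimately have "\<not> int p dvd B 1" by (metis dvd_mod_iff dvd_refl)
  from padic_Units[OF Bc this] have BU: "B \<in> Units Zring" .
  define I where "I = inv\<^bsub>Zring\<^esub> B"
  have Ic: "I \<in> carrier Zring" using padic_inv_at(1)[OF BU] by (simp add: I_def)
  define A where "A = G1 [^]\<^bsub>Zring\<^esub> (2::nat) \<otimes>\<^bsub>Zring\<^esub> I"
  have Ac: "A \<in> carrier Zring" using carr Ic by (simp add: A_def)
  define g2 where "g2 = \<gamma> (1 + \<rho>) ^ 2 / (\<gamma> (1 + 2 * \<rho>) ^ 3 * \<gamma> (1 - \<rho>) ^ 4)"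
  have A2: "of_int (A 2) \<simeq> g2 \<langle>2\<rangle>"
  proof -
    have uB2: "p_unit p (of_int (B 2))" using B2 by (simp add: unit_cong_def)
    have "of_int (B 2 * I 2) \<simeq> of_int 1 \<langle>2\<rangle>"
      unfolding pcong_of_int I_def by (rule padic_inv_at(2)[OF BU])
    then have "of_int (B 2) * of_int (I 2) \<simeq> of_int (B 2) * (1 / of_int (B 2)) \<langle>2\<rangle>"
      using p_unit_Zp(3)[OF uB2] by simp
    then have I2: "of_int (I 2) \<simeq> 1 / of_int (B 2) \<langle>2\<rangle>" by (rule pcong_cancel[OF _ uB2])
    have "[A 2 = G1 2 ^ 2 * I 2] (mod int p ^ 2)"
      by (simp add: A_def padic_mult_at padic_pow_at mod_mult_left_eq cong_def)
    then have "of_int (A 2) \<simeq> of_int (G1 2 ^ 2 * I 2) \<langle>2\<rangle>" unfolding pcong_of_int .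
    also have "of_int (G1 2 ^ 2 * I 2) = of_int (G1 2) ^ 2 * (of_int (I 2) :: rat)" by simp
    also have "\<dots> \<simeq> of_int (G1 2) ^ 2 * (1 / of_int (B 2)) \<langle>2\<rangle>"
      by (intro pcong_lmult I2 Zp_power Zp_of_int)
    also have "\<dots> = of_int (G1 2) ^ 2 / of_int (B 2)" by simp
    also have "\<dots> \<simeq> g2 \<langle>2\<rangle>"
      unfolding g2_def using unit_cong_divide[OF unit_cong_power[OF g(1)] B2, of 2] by (simp add: unit_cong_def)
    finally show ?thesis .
  qed
  \<comment> \<open>The Gamma quotient is multiplied by \<open>p ^ 4\<close>, so its sixth component
    matters only modulo \<open>p ^ 2\<close> and the second component determines it.\<close>
  have A6: "of_int (A 6) \<simeq> g2 \<langle>2\<rangle>"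
  proof -
    have "[A 6 = A 2] (mod int p ^ 2)"
      using padic_reduce[OF Ac, of 2 4] padic_range[OF Ac, of 2] by (simp add: cong_def)
    then have "of_int (A 6) \<simeq> of_int (A 2) \<langle>2\<rangle>" unfolding pcong_of_int .
    from pcong_trans[OF this A2] show ?thesis .
  qed
  have unit_part: "c' * of_int (A 6) * F0 \<simeq> - 5 * W \<langle>2\<rangle>"
  proof -
    have "c' * of_int (A 6) * F0 \<simeq> c' * g2 * F0 \<langle>2\<rangle>"
      by (intro pcong_rmult pcong_lmult A6 c'Z F0_Zp)
    also have "c' * g2 * F0 = (- ((-1) ^ n) * F0) * (80 * of_int r / 81 * g2)"
      by (simp add: c'_def sign_eq)
    also have "\<dots> \<simeq> (- ((-1) ^ n) * F0) * (10 / 27 * (Y / pochhammer 1 n) ^ 3) \<langle>2\<rangle>"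
      unfolding g2_def by (intro pcong_lmult ratio Zp_mult Zp_minus Zp_power F0_Zp Zp_minus_1)
    \<comment> \<open>The constants meet here: \<open>10 / 27\<close> is five times the factor
      \<open>2 / 27\<close> in \<open>W\<close>.\<close>
    also have "\<dots> = - 5 * W" by (simp add: W_def)
    finally show ?thesis .
  qed
  define X where "X = padic_of_rat p c \<otimes>\<^bsub>Zring\<^esub> A \<otimes>\<^bsub>Zring\<^esub> padic_of_rat p F0"
  have Xc: "X \<in> carrier Zring"
    unfolding X_def by (intro Zring.m_closed padic_of_rat_at(1) cZ F0_Zp Ac)
  have "[X 6 = padic_of_rat p c 6 * A 6 * padic_of_rat p F0 6] (mod int p ^ 6)"
    by (simp add: X_def padic_mult_at mod_mult_left_eq cong_def)
  then have "of_int (X 6) \<simeq> of_int (padic_of_rat p c 6 * A 6 * padic_of_rat p F0 6) \<langle>6\<rangle>"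
    unfolding pcong_of_int .
  also have "of_int (padic_of_rat p c 6 * A 6 * padic_of_rat p F0 6)
     = of_int (padic_of_rat p c 6) * of_int (A 6) * (of_int (padic_of_rat p F0 6) :: rat)" by simp
  also have "\<dots> \<simeq> c * of_int (A 6) * F0 \<langle>6\<rangle>"
    by (intro pcong_mult pcong_rmult padic_of_rat_at(2) cZ F0_Zp Zp_mult Zp_of_int)
  also have "\<dots> = of_nat p ^ 4 * (c' * (of_int (A 6)) * F0)" by (simp add: c)
  also have "\<dots> \<simeq> of_nat p ^ 4 * (- 5 * W) \<langle>6\<rangle>"
    using pcong_scale[OF unit_part, of 4] by simp
  finally have X6: "of_int (X 6) \<simeq> of_nat p ^ 4 * (- 5 * W) \<langle>6\<rangle>" by simp
  have SW: "S \<simeq> of_nat p ^ 4 * (- 5 * W) \<langle>6\<rangle>" unfolding S_def by (rule truncated_sum_cong)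
  have SZ: "S \<in> Zp" by (rule pcong_Zp[OF SW]) (intro Zp_mult Zp_power Zp_of_nat Zp_minus Zp_numeral W_Zp)
  have "of_int (padic_of_rat p S 6) \<simeq> of_int (X 6) \<langle>6\<rangle>"
    by (rule pcong_trans[OF padic_of_rat_at(2)[OF SZ] pcong_trans[OF SW pcong_sym[OF X6]]])
  then have "padic_of_rat p S 6 = X 6"
    unfolding pcong_of_int cong_def padic_range[OF Xc] padic_range[OF padic_of_rat_at(1)[OF SZ]] .
  then have "padic_cong p 6 (padic_of_rat p S) X"
    using padic_cong_iff[OF padic_of_rat_at(1)[OF SZ] Xc] by blast
  then show ?thesis unfolding S_def X_def A_def I_def B_def G1_def G2_def G3_def c_def .
qed

end

theorem theorem1p1:
  fixes r :: int and p :: nat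
  assumes "r \<le> 1" and "coprime r 3"
    and "prime p" and "p > 3"
    and "[int p = - r] (mod 3)" and "int p \<ge> 3 - r"
  shows "padic_cong p 6
    (padic_of_rat p
      (\<Sum>k = 0..p - 1. (6 * of_nat k + of_int r) *
        (pochhammer (of_int r / 3) k ^ 6 / pochhammer 1 k ^ 6)))
    (padic_of_rat p ((-1) powi (r + 1) * 80 * of_int r * of_nat p ^ 4 / 81)
      \<otimes>\<^bsub>padic_ring p\<^esub>
        (padic_Gamma p (padic_of_rat p (1 + of_int r / 3)) [^]\<^bsub>padic_ring p\<^esub> (2::nat)
          \<otimes>\<^bsub>padic_ring p\<^esub> inv\<^bsub>padic_ring p\<^esub>
           (padic_Gamma p (padic_of_rat p (1 + 2 * of_int r / 3)) [^]\<^bsub>padic_ring p\<^esub> (3::nat)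
            \<otimes>\<^bsub>padic_ring p\<^esub>
            padic_Gamma p (padic_of_rat p (1 - of_int r / 3)) [^]\<^bsub>padic_ring p\<^esub> (4::nat)))
      \<otimes>\<^bsub>padic_ring p\<^esub>
        padic_of_rat p
          (\<Sum>k = 0..nat (1 - r).
            (pochhammer (of_int r - 1) k * pochhammer (of_int r / 3) k ^ 3) /
            (pochhammer 1 k * pochhammer (2 * of_int r / 3) k ^ 3)))"
proof -
  \<comment> \<open>The residue of \<open>p\<close> modulo 3 makes this division exact.\<close>
  define n where "n = nat ((2 * int p - r) div 3)"
  have "3 dvd int p + r" using assms(5) by (simp add: cong_iff_dvd_diff)
  moreover have "2 * int p - r = 2 * (int p + r) - 3 * r" by simp
  ultimately have "3 dvd 2 * int p - r" by (metis dvd_diff dvd_mult dvd_triv_left)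
  moreover have "(2 * int p - r) div 3 \<ge> 0" using assms(1,4) by (simp add: pos_imp_zdiv_nonneg_iff)
  ultimately have n: "3 * int n = 2 * int p - r" by (simp add: n_def)
  have "\<not> 3 dvd r"
  proof
    assume "3 dvd r"
    then have "is_unit (3::int)" using assms(2) coprime_common_divisor dvd_refl by blast
    then show False by simp
  qed
  then interpret perturbed_sum p r n
    using assms n by unfold_locales auto
  have "F0 = (\<Sum>k = 0..nat (1 - r). (pochhammer (of_int r - 1) k * pochhammer (of_int r / 3) k ^ 3) /
      (pochhammer 1 k * pochhammer (2 * of_int r / 3) k ^ 3))"
  proof -
    have "- of_nat N = (of_int r - 1 :: rat)"
      using int_N by (metis minus_diff_eq of_int_1 of_int_diff of_int_of_nat_eq)
    then show ?thesis by (simp add: F0_def a_def N_def atMost_atLeast0)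
  qed
  then show ?thesis using supercongruence by (simp add: a_def)
qed

end
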